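(* Let $(x \in X)$ be any singularity of embedding dimension $e$. If $\Omega_X^p$ is free for some $1 \le p \le e$, then $(x \in X)$ is smooth.
   Context: We work over $\mathbb{C}$. A singularity $(x \in X)$ is a germ of a complex space (smooth germs are allowed). Its embedding dimension is $e = \dim_{\mathbb{C}} \mathfrak{m}_x/\mathfrak{m}_x^2$, where $\mathfrak{m}_x \subset \mathcal{O}_{X,x}$ is the maximal ideal. $\Omega_X^p = \bigwedge^p \Omega_X^1$ is the sheaf of K\"ahler $p$-forms, where locally, for $X$ cut out by holomorphic functions $f_1,\dots,f_r$ in a complex manifold $Y$, $\Omega_X^1 = \Omega_Y^1|_X / \langle \mathrm{d}f_1,\dots,\mathrm{d}f_r\rangle$. *)

theory Defs
  imports "HOL-Analysis.Analysis" "HOL-Algebra.Module" "HOL-Algebra.QuotRing" "HOL-Algebra.Ideal_Product"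
begin

section \<open>Modules over a commutative ring\<close>

text \<open>
  The library's module record extends the ring record; its fields \<open>mult\<close> and \<open>one\<close> play no role
  for a module and are left undefined below.
\<close>

definition free_mod :: "('r, 'k) ring_scheme \<Rightarrow> 'a set \<Rightarrow> ('r, 'a \<Rightarrow> 'r) module" where
  "free_mod R A =
    \<lparr>carrier = {c. (\<forall>a\<in>A. c a \<in> carrier R) \<and> (\<forall>a. a \<notin> A \<longrightarrow> c a = \<zero>\<^bsub>R\<^esub>) \<and> finite {a. c a \<noteq> \<zero>\<^bsub>R\<^esub>}},
     mult = undefined, one = undefined,
     zero = (\<lambda>_. \<zero>\<^bsub>R\<^esub>), add = (\<lambda>c d a. c a \<oplus>\<^bsub>R\<^esub> d a), smult = (\<lambda>r c a. r \<otimes>\<^bsub>R\<^esub> c a)\<rparr>"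

definition unit_vec :: "('r, 'k) ring_scheme \<Rightarrow> 'a \<Rightarrow> 'a \<Rightarrow> 'r" where
  "unit_vec R a = (\<lambda>b. if b = a then \<one>\<^bsub>R\<^esub> else \<zero>\<^bsub>R\<^esub>)"

definition mod_span :: "('r, 'k) ring_scheme \<Rightarrow> ('r, 'm, 'l) module_scheme \<Rightarrow> 'm set \<Rightarrow> 'm set" where
  "mod_span R M S = \<Inter>{N. submodule N R M \<and> S \<subseteq> N}"

definition quot_mod :: "('r, 'm, 'l) module_scheme \<Rightarrow> 'm set \<Rightarrow> ('r, 'm set) module" where
  "quot_mod M N =
    \<lparr>carrier = a_rcosets\<^bsub>M\<^esub> N, mult = undefined, one = undefined,
     zero = N, add = set_add M, smult = (\<lambda>r C. \<Union>m\<in>C. N +>\<^bsub>M\<^esub> (r \<odot>\<^bsub>M\<^esub> m))\<rparr>"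

definition module_basis :: "('r, 'k) ring_scheme \<Rightarrow> ('r, 'm, 'l) module_scheme \<Rightarrow> 'm set \<Rightarrow> bool" where
  "module_basis R M B \<longleftrightarrow> B \<subseteq> carrier M \<and>
    (\<forall>m\<in>carrier M. \<exists>!c. c \<in> carrier (free_mod R B) \<and>
       m = (\<Oplus>\<^bsub>M\<^esub>b\<in>{b. c b \<noteq> \<zero>\<^bsub>R\<^esub>}. c b \<odot>\<^bsub>M\<^esub> b))"

definition is_free :: "('r, 'k) ring_scheme \<Rightarrow> ('r, 'm, 'l) module_scheme \<Rightarrow> bool" where
  "is_free R M \<longleftrightarrow> (\<exists>B. module_basis R M B)"

definition has_dim :: "('r, 'k) ring_scheme \<Rightarrow> ('r, 'm, 'l) module_scheme \<Rightarrow> nat \<Rightarrow> bool" where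
  "has_dim K V d \<longleftrightarrow> (\<exists>B. module_basis K V B \<and> finite B \<and> card B = d)"

text \<open>
  The exterior power \<open>\<And>\<^sup>p M\<close> is the free module on all \<open>p\<close>-tuples (lists of length \<open>p\<close>) of elements
  of \<open>M\<close>, modulo the relations saying that the class of \<open>xs\<close>, i.e. \<open>xs ! 0 \<and> \<dots> \<and> xs ! (p - 1)\<close>,
  is multilinear and alternating in \<open>xs\<close>.
\<close>

definition tuples :: "nat \<Rightarrow> 'm set \<Rightarrow> 'm list set" where
  "tuples p A = {xs. length xs = p \<and> set xs \<subseteq> A}"

definition wedge_relations ::
    "('r, 'k) ring_scheme \<Rightarrow> nat \<Rightarrow> ('r, 'm, 'l) module_scheme \<Rightarrow> ('m list \<Rightarrow> 'r) set" where
  "wedge_relations R p M =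
    (let T = free_mod R (tuples p (carrier M)); e = unit_vec R in
      {e (xs[i := a \<oplus>\<^bsub>M\<^esub> b]) \<ominus>\<^bsub>T\<^esub> (e (xs[i := a]) \<oplus>\<^bsub>T\<^esub> e (xs[i := b])) | xs i a b.
         xs \<in> tuples p (carrier M) \<and> i < p \<and> a \<in> carrier M \<and> b \<in> carrier M} \<union>
      {e (xs[i := r \<odot>\<^bsub>M\<^esub> a]) \<ominus>\<^bsub>T\<^esub> (r \<odot>\<^bsub>T\<^esub> e (xs[i := a])) | xs i r a.
         xs \<in> tuples p (carrier M) \<and> i < p \<and> r \<in> carrier R \<and> a \<in> carrier M} \<union>
      {e xs | xs. xs \<in> tuples p (carrier M) \<and> (\<exists>i j. i < j \<and> j < p \<and> xs ! i = xs ! j)})"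

definition ext_power ::
    "('r, 'k) ring_scheme \<Rightarrow> nat \<Rightarrow> ('r, 'm, 'l) module_scheme \<Rightarrow> ('r, ('m list \<Rightarrow> 'r) set) module" where
  "ext_power R p M =
    (let T = free_mod R (tuples p (carrier M)) in quot_mod T (mod_span R T (wedge_relations R p M)))"


section \<open>Germs of holomorphic functions\<close>

definition holo_on :: "(complex^'n \<Rightarrow> complex) \<Rightarrow> (complex^'n) set \<Rightarrow> bool" (infix "holo'_on" 50) where
  "f holo_on U \<longleftrightarrow> open U \<and>
    (\<forall>z\<in>U. \<exists>D. (f has_derivative D) (at z) \<and> (\<forall>c v. D (c *s v) = c * D v))"

definition holo_near :: "(complex^'n) \<Rightarrow> (complex^'n \<Rightarrow> complex) \<Rightarrow> bool" where
  "holo_near x f \<longleftrightarrow> (\<exists>U. x \<in> U \<and> f holo_on U)"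

definition partial :: "'n \<Rightarrow> (complex^'n \<Rightarrow> complex) \<Rightarrow> (complex^'n \<Rightarrow> complex)" where
  "partial i f = (\<lambda>z. deriv (\<lambda>t. f (z + t *s axis i 1)) 0)"

definition holo_ring :: "complex^'n \<Rightarrow> (complex^'n \<Rightarrow> complex) ring" where
  "holo_ring x = \<lparr>carrier = {f. holo_near x f}, mult = (\<lambda>f g z. f z * g z), one = (\<lambda>_. 1),
     zero = (\<lambda>_. 0), add = (\<lambda>f g z. f z + g z)\<rparr>"

definition null_ideal :: "complex^'n \<Rightarrow> (complex^'n \<Rightarrow> complex) set" where
  "null_ideal x = {f. holo_near x f \<and> (\<forall>\<^sub>F z in nhds x. f z = 0)}"

definition germ_ring :: "complex^'n \<Rightarrow> (complex^'n \<Rightarrow> complex) set ring" where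
  "germ_ring x = holo_ring x Quot null_ideal x"

definition germ :: "complex^'n \<Rightarrow> (complex^'n \<Rightarrow> complex) \<Rightarrow> (complex^'n \<Rightarrow> complex) set" where
  "germ x f = null_ideal x +>\<^bsub>holo_ring x\<^esub> f"


section \<open>Germs of complex spaces\<close>

text \<open>
  Every germ of a complex space is represented by a local model: the complex subspace \<open>X\<close> of an
  open set \<open>U\<close> in \<open>\<complex>\<^sup>n\<close> cut out by finitely many holomorphic functions, at one of its points.
  \<open>X\<close> may be non-reduced, and \<open>U\<close> need not have the smallest possible dimension.
\<close>

definition local_model ::
    "(complex^'n) set \<Rightarrow> (complex^'n \<Rightarrow> complex) set \<Rightarrow> complex^'n \<Rightarrow> bool" where
  "local_model U F x \<longleftrightarrow> open U \<and> x \<in> U \<and> finite F \<and> (\<forall>f\<in>F. f holo_on U \<and> f x = 0)"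

definition ideal_germ :: "(complex^'n \<Rightarrow> complex) set \<Rightarrow> complex^'n \<Rightarrow> (complex^'n \<Rightarrow> complex) set set" where
  "ideal_germ F x = Idl\<^bsub>germ_ring x\<^esub> (germ x ` F)"

text \<open>The stalk of \<open>\<O>\<^sub>X\<close> at \<open>x\<close>, and the element of it induced by a function on the ambient space.\<close>

definition local_ring ::
    "(complex^'n \<Rightarrow> complex) set \<Rightarrow> complex^'n \<Rightarrow> (complex^'n \<Rightarrow> complex) set set ring" where
  "local_ring F x = germ_ring x Quot ideal_germ F x"

definition restr ::
    "(complex^'n \<Rightarrow> complex) set \<Rightarrow> complex^'n \<Rightarrow> (complex^'n \<Rightarrow> complex) \<Rightarrow> (complex^'n \<Rightarrow> complex) set set" where
  "restr F x f = ideal_germ F x +>\<^bsub>germ_ring x\<^esub> germ x f"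

definition max_ideal :: "('r, 'k) ring_scheme \<Rightarrow> 'r set" where
  "max_ideal R = (THE m. maximalideal m R)"

definition complex_field :: "complex ring" where
  "complex_field = \<lparr>carrier = UNIV, mult = (*), one = 1, zero = 0, add = (+)\<rparr>"

text \<open>The cotangent space \<open>m/m\<^sup>2\<close> as a complex vector space.\<close>

definition cotangent_space ::
    "(complex^'n \<Rightarrow> complex) set \<Rightarrow> complex^'n \<Rightarrow> (complex, (complex^'n \<Rightarrow> complex) set set set) module" where
  "cotangent_space F x =
    (let R = local_ring F x; m = max_ideal R in
      quot_mod
        \<lparr>carrier = m, mult = undefined, one = undefined, zero = \<zero>\<^bsub>R\<^esub>, add = add R,
         smult = (\<lambda>c a. restr F x (\<lambda>_. c) \<otimes>\<^bsub>R\<^esub> a)\<rparr>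
        (ideal_prod R m m))"

definition has_embdim :: "(complex^'n \<Rightarrow> complex) set \<Rightarrow> complex^'n \<Rightarrow> nat \<Rightarrow> bool" where
  "has_embdim F x e \<longleftrightarrow> has_dim complex_field (cotangent_space F x) e"

text \<open>
  The stalk at \<open>x\<close> of the restriction to \<open>X\<close> of \<open>\<Omega>\<^sup>1\<close> of the ambient space is free over \<open>\<O>\<^sub>X\<close> with
  basis \<open>dz\<^sub>i\<close>, so its elements are written as coefficient vectors indexed by \<open>i\<close>.
\<close>

definition differential ::
    "(complex^'n \<Rightarrow> complex) set \<Rightarrow> complex^'n \<Rightarrow> (complex^'n \<Rightarrow> complex) \<Rightarrow> 'n \<Rightarrow> (complex^'n \<Rightarrow> complex) set set" where
  "differential F x f = (\<lambda>i. restr F x (partial i f))"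

definition kaehler1 ::
    "(complex^'n \<Rightarrow> complex) set \<Rightarrow> complex^'n \<Rightarrow>
     ((complex^'n \<Rightarrow> complex) set set, ('n \<Rightarrow> (complex^'n \<Rightarrow> complex) set set) set) module" where
  "kaehler1 F x =
    (let R = local_ring F x; M = free_mod R (UNIV :: 'n set) in
      quot_mod M (mod_span R M (differential F x ` F)))"

definition kaehler ::
    "(complex^'n \<Rightarrow> complex) set \<Rightarrow> complex^'n \<Rightarrow> nat \<Rightarrow>
     ((complex^'n \<Rightarrow> complex) set set,
      (('n \<Rightarrow> (complex^'n \<Rightarrow> complex) set set) set list \<Rightarrow> (complex^'n \<Rightarrow> complex) set set) set) module" where
  "kaehler F x p = ext_power (local_ring F x) p (kaehler1 F x)"

text \<open>
  Isomorphisms of germs of complex spaces correspond to isomorphisms of the stalks as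
  \<open>\<complex>\<close>-algebras. The germs may live in different ambient spaces.
\<close>

definition germ_iso ::
    "(complex^'n \<Rightarrow> complex) set \<Rightarrow> complex^'n \<Rightarrow> (complex^'m \<Rightarrow> complex) set \<Rightarrow> complex^'m \<Rightarrow> bool" where
  "germ_iso F x G y \<longleftrightarrow>
    (\<exists>\<phi> \<in> ring_iso (local_ring F x) (local_ring G y). \<forall>c. \<phi> (restr F x (\<lambda>_. c)) = restr G y (\<lambda>_. c))"

text \<open>
  A germ is smooth if it is isomorphic to the germ of some \<open>\<complex>\<^sup>d\<close> at the origin. Here \<open>\<complex>\<^sup>d\<close> is
  realised as the coordinate subspace of \<open>\<complex>\<^sup>n\<close> where the coordinates in \<open>S\<close> vanish, with
  \<open>d = n - card S\<close>. This covers all \<open>d\<close> from \<open>0\<close> to \<open>n\<close>; a larger \<open>d\<close> is impossible, since the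
  embedding dimension of a germ in \<open>\<complex>\<^sup>n\<close> is at most \<open>n\<close>.
\<close>

definition smooth_germ :: "(complex^'n \<Rightarrow> complex) set \<Rightarrow> complex^'n \<Rightarrow> bool" where
  "smooth_germ F x \<longleftrightarrow> (\<exists>S :: 'n set. germ_iso F x ((\<lambda>i z. z $ i) ` S) (0 :: complex^'n))"

end

theory Submission
  imports Defs "HOL-Complex_Analysis.Cauchy_Integral_Formula"
begin

text \<open>
  Let \<open>R\<close> be the local ring, \<open>I\<close> the ideal of the germ in the ring of ambient germs and \<open>M\<close> the module
  of Kaehler differentials. Equations with independent differentials at \<open>x\<close>, as many as
  possible, are completed by ambient coordinates \<open>w\<^sub>k\<close> (\<open>k \<in> T\<close>) to a chart
  (\<open>adapted_coordinates_exist\<close>); the coordinates \<open>w\<^sub>s\<close> with \<open>s \<notin> T\<close> are then elements of \<open>I\<close>. The germ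
  thus lies in the coordinate subspace on which these \<open>w\<^sub>s\<close> vanish, and it is shown to be equal to it. The
  classes of the \<open>w\<^sub>k\<close> with \<open>k \<in> T\<close> span the cotangent space, so \<open>e \<le> card T\<close>
  (\<open>embdim_le_card_T\<close>), and therefore \<open>1 \<le> p \<le> card T\<close>.

  The algebraic core is \<open>independent_if_ext_power_free\<close>: if the \<open>p\<close>-th exterior power of \<open>M\<close> is free, then
  the \<open>dw\<^sub>k\<close> with \<open>k \<in> T\<close> satisfy no linear relation over \<open>R\<close>. Minors are functionals on the exterior power
  with values in the residue field, and as the exterior power is free they lift to linear forms with values in \<open>R\<close>
  (\<open>semilinear_lifts_if_free\<close>). Composing with the wedge by \<open>p - 1\<close> of the \<open>dw\<^sub>j\<close> gives
  linear forms on \<open>M\<close> that are dual to the \<open>dw\<^sub>k\<close> modulo the maximal ideal. Applied to a linear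
  relation they give a linear system with an invertible matrix, so that all coefficients of the relation vanish.

  For \<open>f \<in> I\<close> the chain rule writes \<open>df = 0\<close> in \<open>M\<close> as \<open>\<Sum>k\<in>T. (\<partial>f/\<partial>w\<^sub>k) dw\<^sub>k = 0\<close>. The independence
  of the \<open>dw\<^sub>k\<close> says that \<open>I\<close> is closed under the derivatives \<open>\<partial>/\<partial>w\<^sub>k\<close>
  (\<open>ideal_closed_under_tangential_derivatives\<close>). As all elements of \<open>I\<close> vanish at \<open>x\<close>, so do all their
  iterated derivatives in these directions. Hence they vanish on the coordinate subspace
  (\<open>vanishing_on_slice\<close>), and by Hadamard's lemma (\<open>hadamard\<close>) they lie in the ideal generated by the \<open>w\<^sub>s\<close>
  with \<open>s \<notin> T\<close>. So this ideal is equal to \<open>I\<close>.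
\<close>

section \<open>Quotients, spans and free modules\<close>

lemma quot_mod_simps:
  "carrier (quot_mod M N) = a_rcosets\<^bsub>M\<^esub> N" "\<zero>\<^bsub>quot_mod M N\<^esub> = N"
  "A \<oplus>\<^bsub>quot_mod M N\<^esub> B = A <+>\<^bsub>M\<^esub> B"
  "r \<odot>\<^bsub>quot_mod M N\<^esub> A = (\<Union>m\<in>A. N +>\<^bsub>M\<^esub> (r \<odot>\<^bsub>M\<^esub> m))"
  by (simp_all only: quot_mod_def partial_object.simps ring.simps module.simps)

lemma (in module) abelian_subgroup_of_submodule:
  assumes "submodule N R M"
  shows "abelian_subgroup N M"
proof -
  have "subgroup N (add_monoid M)"
    using assms by (simp add: submodule_def)
  then show ?thesis
    by (intro abelian_subgroupI3 additive_subgroup.intro) (auto intro: M.abelian_group_axioms)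
qed

lemma (in module) coset_eq_iff:
  assumes N: "submodule N R M" and "a \<in> carrier M" "b \<in> carrier M"
  shows "N +>\<^bsub>M\<^esub> a = N +>\<^bsub>M\<^esub> b \<longleftrightarrow> a \<ominus>\<^bsub>M\<^esub> b \<in> N"
proof -
  interpret abelian_subgroup N M by (rule abelian_subgroup_of_submodule[OF N])
  have "a \<in> N +>\<^bsub>M\<^esub> b \<longleftrightarrow> a \<ominus>\<^bsub>M\<^esub> b \<in> N"
    using a_rcos_module[OF assms(3,2)] by (simp add: a_minus_def)
  then show ?thesis
    using assms a_repr_independence'[of a b] a_rcos_self[of a] by auto
qed

lemma (in module) coset_eq_zero_iff:
  assumes N: "submodule N R M" and "a \<in> carrier M"
  shows "N +>\<^bsub>M\<^esub> a = N \<longleftrightarrow> a \<in> N"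
proof -
  interpret abelian_subgroup N M by (rule abelian_subgroup_of_submodule[OF N])
  show ?thesis
    using assms(2) a_coset_join1 a_coset_join2 a_subgroup a_rcos_self by blast
qed

lemma (in module) quot_mod_carrier:
  "carrier (quot_mod M N) = (\<lambda>a. N +>\<^bsub>M\<^esub> a) ` carrier M"
  unfolding quot_mod_simps A_RCOSETS_def' UNION_singleton_eq_range by (rule refl)

lemma (in module) quot_mod_zero: "\<zero>\<^bsub>quot_mod M N\<^esub> = N"
  by (rule quot_mod_simps)

lemma (in module) quot_mod_add:
  assumes N: "submodule N R M" and "a \<in> carrier M" "b \<in> carrier M"
  shows "(N +>\<^bsub>M\<^esub> a) \<oplus>\<^bsub>quot_mod M N\<^esub> (N +>\<^bsub>M\<^esub> b) = N +>\<^bsub>M\<^esub> (a \<oplus>\<^bsub>M\<^esub> b)"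
proof -
  interpret abelian_subgroup N M by (rule abelian_subgroup_of_submodule[OF N])
  show ?thesis unfolding quot_mod_simps by (rule a_rcos_sum[OF assms(2,3)])
qed

lemma (in module) quot_mod_smult:
  assumes N: "submodule N R M" and "r \<in> carrier R" "a \<in> carrier M"
  shows "r \<odot>\<^bsub>quot_mod M N\<^esub> (N +>\<^bsub>M\<^esub> a) = N +>\<^bsub>M\<^esub> (r \<odot>\<^bsub>M\<^esub> a)"
proof -
  interpret abelian_subgroup N M by (rule abelian_subgroup_of_submodule[OF N])
  have "N +>\<^bsub>M\<^esub> (r \<odot>\<^bsub>M\<^esub> m) = N +>\<^bsub>M\<^esub> (r \<odot>\<^bsub>M\<^esub> a)" if m: "m \<in> N +>\<^bsub>M\<^esub> a" for m
  proof -
    have mc: "m \<in> carrier M"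
      using m a_r_coset_subset_G[OF a_subset assms(3)] by (rule subsetD[rotated])
    have "m \<ominus>\<^bsub>M\<^esub> a \<in> N"
      using m mc assms(3) a_rcos_module[OF assms(3) mc] by (simp add: a_minus_def)
    then have "r \<odot>\<^bsub>M\<^esub> (m \<ominus>\<^bsub>M\<^esub> a) \<in> N"
      by (rule submodule.smult_closed[OF N assms(2)])
    then have "r \<odot>\<^bsub>M\<^esub> m \<ominus>\<^bsub>M\<^esub> r \<odot>\<^bsub>M\<^esub> a \<in> N"
      using mc assms(2,3) by (simp add: a_minus_def smult_r_distr smult_r_minus)
    then show ?thesis using coset_eq_iff[OF N, of "r \<odot>\<^bsub>M\<^esub> m" "r \<odot>\<^bsub>M\<^esub> a"] mc assms(2,3) by simp
  qed
  moreover have "a \<in> N +>\<^bsub>M\<^esub> a" by (rule a_rcos_self[OF assms(3)])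
  ultimately show ?thesis unfolding quot_mod_simps by (intro UN_constant_eq ballI)
qed

lemma (in module) quot_mod_module:
  assumes N: "submodule N R M"
  shows "module R (quot_mod M N)"
proof -
  let ?Q = "quot_mod M N"
  note [simp] = quot_mod_add[OF N] quot_mod_smult[OF N] quot_mod_carrier
  have z: "\<zero>\<^bsub>?Q\<^esub> = N +>\<^bsub>M\<^esub> \<zero>\<^bsub>M\<^esub>"
    using coset_eq_zero_iff[OF N, of "\<zero>\<^bsub>M\<^esub>"] submoduleE(2)[OF N]
    by (metis M.zero_closed N quot_mod_zero subgroup.one_closed submodule_def monoid.simps(2))
  have "abelian_group ?Q"
  proof (rule abelian_groupI, goal_cases)
    case (6 x)
    then obtain a where a: "a \<in> carrier M" "x = N +>\<^bsub>M\<^esub> a" by auto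
    then show ?case
      by (intro bexI[of _ "N +>\<^bsub>M\<^esub> (\<ominus>\<^bsub>M\<^esub> a)"]) (auto simp: z M.l_neg)
  qed (auto simp: z M.a_ac)
  then show ?thesis
    by (intro moduleI) (auto simp: smult_l_distr smult_r_distr smult_assoc1 intro: R.cring_axioms)
qed

lemma (in module) mod_span_submodule:
  assumes S: "S \<subseteq> carrier M"
  shows "submodule (mod_span R M S) R M"
proof (rule submoduleI)
  have c: "submodule (carrier M) R M" by (rule carrier_is_submodule)
  show "mod_span R M S \<subseteq> carrier M" using c S by (auto simp: mod_span_def)
  note s = submodule_def subgroup_def
  show "\<zero>\<^bsub>M\<^esub> \<in> mod_span R M S"
    by (auto simp: mod_span_def s)
  show "\<ominus>\<^bsub>M\<^esub> a \<in> mod_span R M S" if "a \<in> mod_span R M S" for a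
    using that submoduleE(3) by (auto simp: mod_span_def)
  show "a \<oplus>\<^bsub>M\<^esub> b \<in> mod_span R M S" if "a \<in> mod_span R M S" "b \<in> mod_span R M S" for a b
    using that submoduleE(5) by (auto simp: mod_span_def)
  show "r \<odot>\<^bsub>M\<^esub> a \<in> mod_span R M S" if "r \<in> carrier R" "a \<in> mod_span R M S" for r a
    using that submodule.smult_closed by (fastforce simp: mod_span_def)
qed

lemma mod_span_superset: "S \<subseteq> mod_span R M S"
  by (auto simp: mod_span_def)

lemma mod_span_least: "submodule N R M \<Longrightarrow> S \<subseteq> N \<Longrightarrow> mod_span R M S \<subseteq> N"
  by (auto simp: mod_span_def)

lemma (in cring) free_mod_module:
  fixes A :: "'c set"
  shows "module R (free_mod R A)"
proof -
  let ?F = "free_mod R A"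
  have fin: "finite {a. c a \<oplus> d a \<noteq> \<zero>}"
    if "finite {a. c a \<noteq> \<zero>}" "finite {a. d a \<noteq> \<zero>}" for c d :: "'c \<Rightarrow> 'a"
    by (rule finite_subset[OF _ finite_UnI[OF that]]) auto
  have fin2: "finite {a. r \<otimes> c a \<noteq> \<zero>}"
    if "finite {a. c a \<noteq> \<zero>}" "r \<in> carrier R" for r and c :: "'c \<Rightarrow> 'a"
    by (rule finite_subset[OF _ that(1)]) (use that in auto)
  have car: "c a \<in> carrier R" if "c \<in> carrier ?F" for c a
    using that by (cases "a \<in> A") (auto simp: free_mod_def)
  have carI: "c \<in> carrier ?F \<longleftrightarrow> (\<forall>a. c a \<in> carrier R) \<and> (\<forall>a. a \<notin> A \<longrightarrow> c a = \<zero>) \<and> finite {a. c a \<noteq> \<zero>}" for c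
    using car by (auto simp: free_mod_def)
  note [simp] = carI
  have [simp]: "c \<oplus>\<^bsub>?F\<^esub> d = (\<lambda>a. c a \<oplus> d a)" "r \<odot>\<^bsub>?F\<^esub> c = (\<lambda>a. r \<otimes> c a)" "\<zero>\<^bsub>?F\<^esub> = (\<lambda>a. \<zero>)" for c d r
    by (auto simp: free_mod_def)
  have "abelian_group ?F"
  proof (rule abelian_groupI, goal_cases)
    case (1 c d)
    then show ?case using fin[of c d] by auto
  next
    case (6 c)
    then show ?case
    proof (intro bexI[of _ "\<lambda>a. \<ominus> c a"])
      have "{a. \<ominus> c a \<noteq> \<zero>} \<subseteq> {a. c a \<noteq> \<zero>}" by auto
      with 6 show "(\<lambda>a. \<ominus> c a) \<in> carrier ?F" by (auto intro: finite_subset)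
    qed (auto simp: l_neg)
  qed (auto simp: a_ac)
  then show ?thesis
    by (intro moduleI) (auto simp: fin2 l_distr r_distr m_assoc intro: cring_axioms)
qed

lemma free_mod_simps:
  "c \<oplus>\<^bsub>free_mod R A\<^esub> d = (\<lambda>a. c a \<oplus>\<^bsub>R\<^esub> d a)" "r \<odot>\<^bsub>free_mod R A\<^esub> c = (\<lambda>a. r \<otimes>\<^bsub>R\<^esub> c a)"
  "\<zero>\<^bsub>free_mod R A\<^esub> = (\<lambda>a. \<zero>\<^bsub>R\<^esub>)"
  by (auto simp: free_mod_def)

lemma (in cring) free_mod_coeff: "c \<in> carrier (free_mod R A) \<Longrightarrow> c a \<in> carrier R"
  by (cases "a \<in> A") (auto simp: free_mod_def)

lemma free_mod_finite: "c \<in> carrier (free_mod R A) \<Longrightarrow> finite {a. c a \<noteq> \<zero>\<^bsub>R\<^esub>}"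
  by (auto simp: free_mod_def)

lemma (in cring) unit_vec_closed: "a \<in> A \<Longrightarrow> unit_vec R a \<in> carrier (free_mod R A)"
proof -
  have "{b. unit_vec R a b \<noteq> \<zero>} \<subseteq> {a}" by (auto simp: unit_vec_def)
  then have "finite {b. unit_vec R a b \<noteq> \<zero>}" by (rule finite_subset) simp
  then show "a \<in> A \<Longrightarrow> ?thesis" by (auto simp: free_mod_def unit_vec_def)
qed

section \<open>Linear maps and the residue field\<close>

text \<open>
  Functionals on an \<open>R\<close>-module take values in a vector space over the residue field, on which
  \<open>R\<close> acts by the residue; \<open>s\<close> is this action, for scalars and for column vectors.
\<close>

definition semilinear ::
    "('r, 'k) ring_scheme \<Rightarrow> ('r, 'm, 'l) module_scheme \<Rightarrow> ('r \<Rightarrow> 'v \<Rightarrow> 'v) \<Rightarrow> ('m \<Rightarrow> 'v::ab_group_add) \<Rightarrow> bool" where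
  "semilinear R M s f \<longleftrightarrow>
    (\<forall>a\<in>carrier M. \<forall>b\<in>carrier M. f (a \<oplus>\<^bsub>M\<^esub> b) = f a + f b) \<and>
    (\<forall>r\<in>carrier R. \<forall>a\<in>carrier M. f (r \<odot>\<^bsub>M\<^esub> a) = s r (f a))"

lemma semilinear_add:
  "semilinear R M s f \<Longrightarrow> a \<in> carrier M \<Longrightarrow> b \<in> carrier M \<Longrightarrow> f (a \<oplus>\<^bsub>M\<^esub> b) = f a + f b"
  by (auto simp: semilinear_def)

lemma semilinear_smult:
  "semilinear R M s f \<Longrightarrow> r \<in> carrier R \<Longrightarrow> a \<in> carrier M \<Longrightarrow> f (r \<odot>\<^bsub>M\<^esub> a) = s r (f a)"
  by (auto simp: semilinear_def)

lemma (in module) semilinear_zero: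
  assumes "semilinear R M s f" shows "f \<zero>\<^bsub>M\<^esub> = 0"
  using semilinear_add[OF assms, of "\<zero>\<^bsub>M\<^esub>" "\<zero>\<^bsub>M\<^esub>"] by simp

lemma (in module) semilinear_minus:
  assumes f: "semilinear R M s f" and ab: "a \<in> carrier M" "b \<in> carrier M"
  shows "f (a \<ominus>\<^bsub>M\<^esub> b) = f a - f b"
proof -
  have "f ((a \<ominus>\<^bsub>M\<^esub> b) \<oplus>\<^bsub>M\<^esub> b) = f (a \<ominus>\<^bsub>M\<^esub> b) + f b"
    using ab by (intro semilinear_add[OF f]) auto
  moreover have "(a \<ominus>\<^bsub>M\<^esub> b) \<oplus>\<^bsub>M\<^esub> b = a"
    using ab by (simp add: a_minus_def M.a_assoc M.l_neg)
  ultimately show ?thesis by simp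
qed

lemma (in module) semilinear_kernel:
  assumes f: "semilinear R M s f" and s: "\<And>r. r \<in> carrier R \<Longrightarrow> s r 0 = 0"
  shows "submodule {a \<in> carrier M. f a = 0} R M"
proof (rule submoduleI, goal_cases)
  case 2 then show ?case using semilinear_zero[OF f] by simp
next
  case (3 a)
  then show ?case using semilinear_minus[OF f, of "\<zero>\<^bsub>M\<^esub>" a] semilinear_zero[OF f]
    by (simp add: a_minus_def)
qed (auto simp: semilinear_add[OF f] semilinear_smult[OF f] s)

lemma (in module) semilinear_descends:
  assumes N: "submodule N R M" and f: "semilinear R M s f" and fN: "\<And>a. a \<in> N \<Longrightarrow> f a = 0"
  shows "\<exists>h. semilinear R (quot_mod M N) s h \<and> (\<forall>a\<in>carrier M. h (N +>\<^bsub>M\<^esub> a) = f a)"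
proof -
  define h where "h X = f (SOME a. a \<in> carrier M \<and> X = N +>\<^bsub>M\<^esub> a)" for X
  have h: "h (N +>\<^bsub>M\<^esub> a) = f a" if a: "a \<in> carrier M" for a
  proof -
    define b where "b = (SOME b. b \<in> carrier M \<and> N +>\<^bsub>M\<^esub> a = N +>\<^bsub>M\<^esub> b)"
    have b: "b \<in> carrier M \<and> N +>\<^bsub>M\<^esub> a = N +>\<^bsub>M\<^esub> b"
      unfolding b_def by (rule someI[of _ a]) (simp add: a)
    then have "a \<ominus>\<^bsub>M\<^esub> b \<in> N" using coset_eq_iff[OF N a, of b] by simp
    then have "f a = f b" using fN semilinear_minus[OF f a, of b] b by force
    then show ?thesis by (simp add: h_def b_def)
  qed
  have "semilinear R (quot_mod M N) s h"
    unfolding semilinear_def quot_mod_carrier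
    by (auto simp: quot_mod_add[OF N] quot_mod_smult[OF N] h semilinear_add[OF f] semilinear_smult[OF f])
  then show ?thesis using h by blast
qed

lemma (in module) semilinear_descends_span:
  assumes S: "S \<subseteq> carrier M" and f: "semilinear R M s f" and s: "\<And>r. r \<in> carrier R \<Longrightarrow> s r 0 = 0"
    and fS: "\<And>a. a \<in> S \<Longrightarrow> f a = 0"
  shows "\<exists>h. semilinear R (quot_mod M (mod_span R M S)) s h \<and>
    (\<forall>a\<in>carrier M. h (mod_span R M S +>\<^bsub>M\<^esub> a) = f a)"
proof (rule semilinear_descends[OF mod_span_submodule[OF S] f])
  have "mod_span R M S \<subseteq> {a \<in> carrier M. f a = 0}"
    using S fS by (intro mod_span_least semilinear_kernel[OF f s]) auto
  then show "f a = 0" if "a \<in> mod_span R M S" for a using that by auto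
qed

text \<open>
  \<open>ev\<close> is the residue map, \<open>ev_unit\<close> says that \<open>R\<close> is local, and \<open>const\<close> is a section of \<open>ev\<close>
  through which residues are lifted.
\<close>

locale residue_ring = cring R for R (structure) +
  fixes ev :: "'a \<Rightarrow> 'c::field" and const :: "'c \<Rightarrow> 'a"
  assumes ev_add: "a \<in> carrier R \<Longrightarrow> b \<in> carrier R \<Longrightarrow> ev (a \<oplus> b) = ev a + ev b"
    and ev_mult: "a \<in> carrier R \<Longrightarrow> b \<in> carrier R \<Longrightarrow> ev (a \<otimes> b) = ev a * ev b"
    and ev_one: "ev \<one> = 1"
    and const_closed [simp]: "const c \<in> carrier R"
    and ev_const: "ev (const c) = c"
    and ev_unit: "a \<in> carrier R \<Longrightarrow> ev a \<noteq> 0 \<Longrightarrow> a \<in> Units R"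
begin

lemma ev_zero: "ev \<zero> = 0"
  using ev_add[of \<zero> \<zero>] by (metis add_cancel_right_left r_zero zero_closed)

lemma ev_minus: "a \<in> carrier R \<Longrightarrow> b \<in> carrier R \<Longrightarrow> ev (a \<ominus> b) = ev a - ev b"
  using ev_add[of "a \<ominus> b" b] by (simp add: minus_eq a_assoc l_neg)

lemma semilinear_on_free_mod:
  fixes \<psi> :: "'x \<Rightarrow> 'c"
  defines "\<Psi> \<equiv> \<lambda>c. \<Sum>a | c a \<noteq> \<zero>. ev (c a) * \<psi> a"
  shows "semilinear R (free_mod R A) (\<lambda>r x. ev r * x) \<Psi>" and "\<Psi> (unit_vec R a) = \<psi> a"
proof -
  let ?F = "free_mod R A"
  interpret F: module R ?F by (rule free_mod_module)
  have \<Psi>: "\<Psi> c = (\<Sum>a\<in>X. ev (c a) * \<psi> a)" if "finite X" "{a. c a \<noteq> \<zero>} \<subseteq> X" for c X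
    unfolding \<Psi>_def using that by (intro sum.mono_neutral_left) (auto simp: ev_zero)
  show "semilinear R ?F (\<lambda>r x. ev r * x) \<Psi>"
    unfolding semilinear_def
  proof (intro conjI ballI)
    fix c d assume cd: "c \<in> carrier ?F" "d \<in> carrier ?F"
    let ?X = "{a. c a \<noteq> \<zero>} \<union> {a. d a \<noteq> \<zero>}"
    have X: "finite ?X" using cd free_mod_finite by auto
    have "\<Psi> (c \<oplus>\<^bsub>?F\<^esub> d) = (\<Sum>a\<in>?X. ev ((c \<oplus>\<^bsub>?F\<^esub> d) a) * \<psi> a)"
      by (rule \<Psi>[OF X]) (auto simp: free_mod_simps)
    also have "\<dots> = (\<Sum>a\<in>?X. ev (c a) * \<psi> a) + (\<Sum>a\<in>?X. ev (d a) * \<psi> a)"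
      using cd by (simp add: free_mod_simps ev_add free_mod_coeff ring_distribs sum.distrib)
    also have "\<dots> = \<Psi> c + \<Psi> d" using \<Psi>[OF X, of c] \<Psi>[OF X, of d] by auto
    finally show "\<Psi> (c \<oplus>\<^bsub>?F\<^esub> d) = \<Psi> c + \<Psi> d" .
  next
    fix r c assume rc: "r \<in> carrier R" "c \<in> carrier ?F"
    let ?X = "{a. c a \<noteq> \<zero>}"
    have X: "finite ?X" using rc free_mod_finite by auto
    have "\<Psi> (r \<odot>\<^bsub>?F\<^esub> c) = (\<Sum>a\<in>?X. ev ((r \<odot>\<^bsub>?F\<^esub> c) a) * \<psi> a)"
      by (rule \<Psi>[OF X]) (auto simp: free_mod_simps rc)
    also have "\<dots> = ev r * \<Psi> c" using rc \<Psi>[OF X, of c]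
      by (simp add: free_mod_simps ev_mult free_mod_coeff sum_distrib_left mult.assoc)
    finally show "\<Psi> (r \<odot>\<^bsub>?F\<^esub> c) = ev r * \<Psi> c" .
  qed
  have "\<Psi> (unit_vec R a) = (\<Sum>b\<in>{a}. ev (unit_vec R a b) * \<psi> b)"
    by (rule \<Psi>) (auto simp: unit_vec_def)
  then show "\<Psi> (unit_vec R a) = \<psi> a" by (simp add: unit_vec_def ev_one)
qed

text \<open>
  Nakayama's lemma in matrix form: a matrix that is the identity modulo the maximal ideal is
  invertible. The diagonal entries are units, and eliminating one of them changes the other entries
  only by elements of the maximal ideal, so Gaussian elimination can go on.
\<close>

lemma trivial_kernel_if_residue_identity:
  assumes "finite T" and "\<And>k j. k \<in> T \<Longrightarrow> j \<in> T \<Longrightarrow> A k j \<in> carrier R"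
    and "\<And>j. j \<in> T \<Longrightarrow> a j \<in> carrier R"
    and "\<And>k j. k \<in> T \<Longrightarrow> j \<in> T \<Longrightarrow> ev (A k j) = of_bool (k = j)"
    and "\<And>k. k \<in> T \<Longrightarrow> (\<Oplus>j\<in>T. A k j \<otimes> a j) = \<zero>"
  shows "\<forall>j\<in>T. a j = \<zero>"
  using assms
proof (induction T arbitrary: A rule: finite_induct)
  case (insert i T)
  note A = insert.prems(1) note a = insert.prems(2) note e = insert.prems(3) note z = insert.prems(4)
  have [simp]: "a i \<in> carrier R" "A i i \<in> carrier R" using a A by auto
  have U: "A i i \<in> Units R" using e[of i i] by (intro ev_unit) auto
  define u where "u = inv (A i i)"
  have [simp]: "u \<in> carrier R" and u: "u \<otimes> A i i = \<one>" using U by (auto simp: u_def)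
  \<comment> \<open>the Schur complement of the pivot \<open>A i i\<close>\<close>
  define B where "B k j = A k j \<ominus> (A k i \<otimes> u) \<otimes> A i j" for k j
  have split: "A k i \<otimes> a i \<oplus> (\<Oplus>j\<in>T. A k j \<otimes> a j) = \<zero>" if "k \<in> insert i T" for k
  proof -
    have "(\<Oplus>j\<in>insert i T. A k j \<otimes> a j) = A k i \<otimes> a i \<oplus> (\<Oplus>j\<in>T. A k j \<otimes> a j)"
      using that insert.hyps A a by (intro finsum_insert) auto
    then show ?thesis using z[OF that] by simp
  qed
  have "\<forall>j\<in>T. a j = \<zero>"
  proof (rule insert.IH[of B])
    show "B k j \<in> carrier R" if "k \<in> T" "j \<in> T" for k j using that A by (auto simp: B_def)
    show "a j \<in> carrier R" if "j \<in> T" for j using that a by auto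
    show "ev (B k j) = of_bool (k = j)" if "k \<in> T" "j \<in> T" for k j
    proof -
      have "k \<noteq> i" using that insert.hyps by auto
      then show ?thesis using that A e[of k j] e[of k i] by (simp add: B_def ev_minus ev_mult)
    qed
    show "(\<Oplus>j\<in>T. B k j \<otimes> a j) = \<zero>" if k: "k \<in> T" for k
    proof -
      let ?v = "A k i \<otimes> u" and ?S = "\<lambda>k. \<Oplus>j\<in>T. A k j \<otimes> a j"
      have [simp]: "A k i \<in> carrier R" using k A by auto
      have S: "?S l \<in> carrier R" if "l \<in> insert i T" for l
        using that A a by (intro finsum_closed) auto
      have [simp]: "?S i \<in> carrier R" "?S k \<in> carrier R" using S k by auto
      have "(\<Oplus>j\<in>T. B k j \<otimes> a j) = (\<Oplus>j\<in>T. A k j \<otimes> a j \<oplus> (\<ominus> ?v) \<otimes> (A i j \<otimes> a j))"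
        using k A a by (intro finsum_cong') (auto simp: B_def minus_eq l_distr l_minus m_assoc)
      also have "\<dots> = ?S k \<oplus> (\<Oplus>j\<in>T. (\<ominus> ?v) \<otimes> (A i j \<otimes> a j))"
        using k A a by (intro finsum_addf) auto
      also have "(\<Oplus>j\<in>T. (\<ominus> ?v) \<otimes> (A i j \<otimes> a j)) = (\<ominus> ?v) \<otimes> ?S i"
        using k A a insert.hyps by (intro finsum_rdistr[symmetric]) auto
      also have "?S i = \<ominus> (A i i \<otimes> a i)"
        using split[of i] by (metis \<open>A i i \<in> carrier R\<close> \<open>a i \<in> carrier R\<close> \<open>?S i \<in> carrier R\<close> add.inv_equality a_comm insertI1 m_closed minus_equality)
      also have "(\<ominus> ?v) \<otimes> (\<ominus> (A i i \<otimes> a i)) = A k i \<otimes> ((u \<otimes> A i i) \<otimes> a i)"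
        by (simp add: l_minus r_minus m_assoc)
      also have "\<dots> = A k i \<otimes> a i" by (simp add: u)
      also have "?S k \<oplus> A k i \<otimes> a i = \<zero>" using split[of k] k by (simp add: a_comm)
      finally show ?thesis .
    qed
  qed
  moreover have "a i = \<zero>"
  proof -
    have "(\<Oplus>j\<in>T. A i j \<otimes> a j) = (\<Oplus>j\<in>T. \<zero>)"
      using calculation A by (intro finsum_cong') auto
    then have "A i i \<otimes> a i = \<zero>" using split[of i] by simp
    then have "u \<otimes> (A i i \<otimes> a i) = \<zero>" by simp
    then show ?thesis by (simp add: m_assoc[symmetric] u)
  qed
  ultimately show ?case by simp
qed simp

end

text \<open>
  With this module the linear combinations of ring elements are instances of \<open>lincomb\<close> below, so
  linear forms and vectors are built by the same lemmas.
\<close>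

definition self_mod :: "('r, 'k) ring_scheme \<Rightarrow> ('r, 'r) module" where
  "self_mod R = \<lparr>carrier = carrier R, mult = mult R, one = one R, zero = zero R, add = add R, smult = mult R\<rparr>"

lemma self_mod_simps:
  "carrier (self_mod R) = carrier R" "zero (self_mod R) = zero R" "add (self_mod R) = add R"
  "smult (self_mod R) = mult R"
  by (simp_all add: self_mod_def)

lemma (in cring) self_mod_module: "module R (self_mod R)"
proof -
  have "abelian_group (self_mod R)"
  proof (rule abelian_groupI, goal_cases)
    case (6 x)
    then show ?case by (intro bexI[of _ "\<ominus> x"]) (auto simp: self_mod_simps l_neg)
  qed (auto simp: self_mod_simps a_ac)
  then show ?thesis
    by (intro moduleI) (auto simp: self_mod_simps l_distr r_distr m_assoc cring_axioms)
qed

definition lincomb :: "('r, 'k) ring_scheme \<Rightarrow> ('r, 'm, 'l) module_scheme \<Rightarrow> ('b \<Rightarrow> 'r) \<Rightarrow> ('b \<Rightarrow> 'm) \<Rightarrow> 'm" where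
  "lincomb R M c u = (\<Oplus>\<^bsub>M\<^esub>b\<in>{b. c b \<noteq> \<zero>\<^bsub>R\<^esub>}. c b \<odot>\<^bsub>M\<^esub> u b)"

context module
begin

lemma lincomb_superset:
  assumes "c \<in> carrier (free_mod R B)" "u \<in> B \<rightarrow> carrier M" "finite X" "{b. c b \<noteq> \<zero>} \<subseteq> X" "X \<subseteq> B"
  shows "lincomb R M c u = (\<Oplus>\<^bsub>M\<^esub>b\<in>X. c b \<odot>\<^bsub>M\<^esub> u b)"
proof -
  have "u b \<in> carrier M" if "b \<in> X" for b using assms(2,5) that by auto
  then show ?thesis
    unfolding lincomb_def using assms(3,4) free_mod_coeff[OF assms(1)]
    by (intro M.add.finprod_mono_neutral_cong_left) auto
qed

lemma free_mod_support: "c \<in> carrier (free_mod R B) \<Longrightarrow> {b. c b \<noteq> \<zero>} \<subseteq> B"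
  by (auto simp: free_mod_def)

lemma lincomb_closed:
  assumes c: "c \<in> carrier (free_mod R B)" and u: "u \<in> B \<rightarrow> carrier M"
  shows "lincomb R M c u \<in> carrier M"
  unfolding lincomb_def using free_mod_coeff[OF c] free_mod_support[OF c] u
  by (intro M.finsum_closed) auto

lemma lincomb_add:
  assumes c: "c \<in> carrier (free_mod R B)" and d: "d \<in> carrier (free_mod R B)" and u: "u \<in> B \<rightarrow> carrier M"
  shows "lincomb R M (c \<oplus>\<^bsub>free_mod R B\<^esub> d) u = lincomb R M c u \<oplus>\<^bsub>M\<^esub> lincomb R M d u"
proof -
  interpret F: module R "free_mod R B" by (rule R.free_mod_module)
  let ?X = "{b. c b \<noteq> \<zero>} \<union> {b. d b \<noteq> \<zero>}"
  have X: "finite ?X" "?X \<subseteq> B" using free_mod_finite[OF c] free_mod_finite[OF d] free_mod_support[OF c] free_mod_support[OF d] by auto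
  have uc: "u b \<in> carrier M" if "b \<in> ?X" for b
    using subsetD[OF X(2) that] u by (rule funcset_mem[rotated])
  have "lincomb R M (c \<oplus>\<^bsub>free_mod R B\<^esub> d) u = (\<Oplus>\<^bsub>M\<^esub>b\<in>?X. (c \<oplus>\<^bsub>free_mod R B\<^esub> d) b \<odot>\<^bsub>M\<^esub> u b)"
    using X by (intro lincomb_superset[OF F.M.a_closed[OF c d] u]) (auto simp: free_mod_simps)
  also have "\<dots> = (\<Oplus>\<^bsub>M\<^esub>b\<in>?X. c b \<odot>\<^bsub>M\<^esub> u b \<oplus>\<^bsub>M\<^esub> d b \<odot>\<^bsub>M\<^esub> u b)"
    using X uc free_mod_coeff[OF c] free_mod_coeff[OF d]
    by (intro M.finsum_cong') (auto simp: free_mod_simps smult_l_distr)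
  also have "\<dots> = (\<Oplus>\<^bsub>M\<^esub>b\<in>?X. c b \<odot>\<^bsub>M\<^esub> u b) \<oplus>\<^bsub>M\<^esub> (\<Oplus>\<^bsub>M\<^esub>b\<in>?X. d b \<odot>\<^bsub>M\<^esub> u b)"
    using X uc free_mod_coeff[OF c] free_mod_coeff[OF d] by (intro M.finsum_addf) auto
  also have "\<dots> = lincomb R M c u \<oplus>\<^bsub>M\<^esub> lincomb R M d u"
    using lincomb_superset[OF c u X(1) _ X(2)] lincomb_superset[OF d u X(1) _ X(2)] by auto
  finally show ?thesis .
qed

lemma smult_finsum:
  assumes "finite X" "f \<in> X \<rightarrow> carrier M" "r \<in> carrier R"
  shows "r \<odot>\<^bsub>M\<^esub> (\<Oplus>\<^bsub>M\<^esub>b\<in>X. f b) = (\<Oplus>\<^bsub>M\<^esub>b\<in>X. r \<odot>\<^bsub>M\<^esub> f b)"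
  using assms by (induction X rule: finite_induct) (auto simp: smult_r_distr Pi_iff)

lemma lincomb_smult:
  assumes c: "c \<in> carrier (free_mod R B)" and u: "u \<in> B \<rightarrow> carrier M" and r: "r \<in> carrier R"
  shows "lincomb R M (r \<odot>\<^bsub>free_mod R B\<^esub> c) u = r \<odot>\<^bsub>M\<^esub> lincomb R M c u"
proof -
  interpret F: module R "free_mod R B" by (rule R.free_mod_module)
  let ?X = "{b. c b \<noteq> \<zero>}"
  have X: "finite ?X" "?X \<subseteq> B" using free_mod_finite[OF c] free_mod_support[OF c] by auto
  have uc: "u b \<in> carrier M" if "b \<in> ?X" for b
    using subsetD[OF X(2) that] u by (rule funcset_mem[rotated])
  have "lincomb R M (r \<odot>\<^bsub>free_mod R B\<^esub> c) u = (\<Oplus>\<^bsub>M\<^esub>b\<in>?X. (r \<odot>\<^bsub>free_mod R B\<^esub> c) b \<odot>\<^bsub>M\<^esub> u b)"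
    using X r by (intro lincomb_superset[OF F.smult_closed[OF r c] u]) (auto simp: free_mod_simps)
  also have "\<dots> = (\<Oplus>\<^bsub>M\<^esub>b\<in>?X. r \<odot>\<^bsub>M\<^esub> (c b \<odot>\<^bsub>M\<^esub> u b))"
    using X uc r free_mod_coeff[OF c]
    by (intro M.finsum_cong') (auto simp: free_mod_simps smult_assoc1)
  also have "\<dots> = r \<odot>\<^bsub>M\<^esub> lincomb R M c u"
    unfolding lincomb_def using X uc r free_mod_coeff[OF c] by (intro smult_finsum[symmetric]) auto
  finally show ?thesis .
qed

lemma semilinear_finsum:
  assumes f: "semilinear R M s f" and "finite X" "c \<in> X \<rightarrow> carrier R" "u \<in> X \<rightarrow> carrier M"
  shows "f (\<Oplus>\<^bsub>M\<^esub>b\<in>X. c b \<odot>\<^bsub>M\<^esub> u b) = (\<Sum>b\<in>X. s (c b) (f (u b)))"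
  using assms(2-)
proof (induction X rule: finite_induct)
  case (insert x X)
  then have "f (\<Oplus>\<^bsub>M\<^esub>b\<in>insert x X. c b \<odot>\<^bsub>M\<^esub> u b) = f (c x \<odot>\<^bsub>M\<^esub> u x \<oplus>\<^bsub>M\<^esub> (\<Oplus>\<^bsub>M\<^esub>b\<in>X. c b \<odot>\<^bsub>M\<^esub> u b))"
    by (subst M.finsum_insert) auto
  also have "\<dots> = s (c x) (f (u x)) + f (\<Oplus>\<^bsub>M\<^esub>b\<in>X. c b \<odot>\<^bsub>M\<^esub> u b)"
    using insert by (subst semilinear_add[OF f]) (auto simp: semilinear_smult[OF f] intro!: M.finsum_closed)
  finally show ?case using insert by (simp add: Pi_iff)
qed (simp add: semilinear_zero[OF f])

end

section \<open>Exterior powers\<close>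

definition wedge ::
    "('r, 'k) ring_scheme \<Rightarrow> nat \<Rightarrow> ('r, 'm, 'l) module_scheme \<Rightarrow> 'm list \<Rightarrow> ('m list \<Rightarrow> 'r) set" where
  "wedge R p M xs =
    (let T = free_mod R (tuples p (carrier M)) in mod_span R T (wedge_relations R p M) +>\<^bsub>T\<^esub> unit_vec R xs)"

lemma tuples_update: "xs \<in> tuples p A \<Longrightarrow> a \<in> A \<Longrightarrow> xs[i := a] \<in> tuples p A"
  by (auto simp: tuples_def dest: set_update_subset_insert[THEN subsetD])

context module
begin

lemma wedge_relations_closed:
  "wedge_relations R p M \<subseteq> carrier (free_mod R (tuples p (carrier M)))"
proof -
  interpret T: module R "free_mod R (tuples p (carrier M))" by (rule R.free_mod_module)
  note [simp] = R.unit_vec_closed tuples_update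
  show ?thesis unfolding wedge_relations_def Let_def by auto
qed

lemma ext_power_module: "module R (ext_power R p M)"
proof -
  interpret T: module R "free_mod R (tuples p (carrier M))" by (rule R.free_mod_module)
  show ?thesis unfolding ext_power_def Let_def
    by (intro T.quot_mod_module T.mod_span_submodule wedge_relations_closed)
qed

lemma wedge_closed: "xs \<in> tuples p (carrier M) \<Longrightarrow> wedge R p M xs \<in> carrier (ext_power R p M)"
proof -
  interpret T: module R "free_mod R (tuples p (carrier M))" by (rule R.free_mod_module)
  show "xs \<in> tuples p (carrier M) \<Longrightarrow> ?thesis"
    unfolding ext_power_def Let_def wedge_def T.quot_mod_carrier by (intro imageI R.unit_vec_closed)
qed

text \<open>
  For fixed \<open>L\<close>, wedging with \<open>L\<close> is a linear map from \<open>M\<close> to its exterior power. Linear forms on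
  the exterior power are pulled back to \<open>M\<close> along it.
\<close>

lemma wedge_Cons_add:
  assumes L: "L \<in> tuples q (carrier M)" and ab: "a \<in> carrier M" "b \<in> carrier M"
  shows "wedge R (Suc q) M ((a \<oplus>\<^bsub>M\<^esub> b) # L) =
    wedge R (Suc q) M (a # L) \<oplus>\<^bsub>ext_power R (Suc q) M\<^esub> wedge R (Suc q) M (b # L)"
proof -
  let ?T = "free_mod R (tuples (Suc q) (carrier M))" and ?e = "unit_vec R"
  let ?S = "mod_span R ?T (wedge_relations R (Suc q) M)"
  interpret T: module R ?T by (rule R.free_mod_module)
  have S: "submodule ?S R ?T" by (intro T.mod_span_submodule wedge_relations_closed)
  have t: "c # L \<in> tuples (Suc q) (carrier M)" if "c \<in> carrier M" for c
    using L that by (auto simp: tuples_def)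
  have e: "?e (c # L) \<in> carrier ?T" if "c \<in> carrier M" for c
    using t[OF that] by (rule R.unit_vec_closed)
  have "?e ((a # L)[0 := a \<oplus>\<^bsub>M\<^esub> b]) \<ominus>\<^bsub>?T\<^esub> (?e ((a # L)[0 := a]) \<oplus>\<^bsub>?T\<^esub> ?e ((a # L)[0 := b]))
      \<in> wedge_relations R (Suc q) M"
    unfolding wedge_relations_def Let_def
    by (rule UnI1, rule UnI1, rule CollectI, rule exI[of _ "a # L"], rule exI[of _ 0], rule exI[of _ a],
      rule exI[of _ b]) (simp add: t ab)
  then have "?e ((a \<oplus>\<^bsub>M\<^esub> b) # L) \<ominus>\<^bsub>?T\<^esub> (?e (a # L) \<oplus>\<^bsub>?T\<^esub> ?e (b # L)) \<in> ?S"
    using subsetD[OF mod_span_superset] by (metis list_update_code(2))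
  then have "?S +>\<^bsub>?T\<^esub> ?e ((a \<oplus>\<^bsub>M\<^esub> b) # L) = ?S +>\<^bsub>?T\<^esub> (?e (a # L) \<oplus>\<^bsub>?T\<^esub> ?e (b # L))"
    using T.coset_eq_iff[OF S] e ab by auto
  then show ?thesis
    unfolding wedge_def ext_power_def Let_def using T.quot_mod_add[OF S e[OF ab(1)] e[OF ab(2)]] by simp
qed

lemma wedge_Cons_smult:
  assumes L: "L \<in> tuples q (carrier M)" and a: "a \<in> carrier M" and r: "r \<in> carrier R"
  shows "wedge R (Suc q) M ((r \<odot>\<^bsub>M\<^esub> a) # L) = r \<odot>\<^bsub>ext_power R (Suc q) M\<^esub> wedge R (Suc q) M (a # L)"
proof -
  let ?T = "free_mod R (tuples (Suc q) (carrier M))" and ?e = "unit_vec R"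
  let ?S = "mod_span R ?T (wedge_relations R (Suc q) M)"
  interpret T: module R ?T by (rule R.free_mod_module)
  have S: "submodule ?S R ?T" by (intro T.mod_span_submodule wedge_relations_closed)
  have t: "c # L \<in> tuples (Suc q) (carrier M)" if "c \<in> carrier M" for c
    using L that by (auto simp: tuples_def)
  have e: "?e (c # L) \<in> carrier ?T" if "c \<in> carrier M" for c
    using t[OF that] by (rule R.unit_vec_closed)
  have "?e ((a # L)[0 := r \<odot>\<^bsub>M\<^esub> a]) \<ominus>\<^bsub>?T\<^esub> (r \<odot>\<^bsub>?T\<^esub> ?e ((a # L)[0 := a])) \<in> wedge_relations R (Suc q) M"
    unfolding wedge_relations_def Let_def
    by (rule UnI1, rule UnI2, rule CollectI, rule exI[of _ "a # L"], rule exI[of _ 0], rule exI[of _ r],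
      rule exI[of _ a]) (simp add: t a r)
  then have "?e ((r \<odot>\<^bsub>M\<^esub> a) # L) \<ominus>\<^bsub>?T\<^esub> (r \<odot>\<^bsub>?T\<^esub> ?e (a # L)) \<in> ?S"
    using subsetD[OF mod_span_superset] by (metis list_update_code(2))
  then have "?S +>\<^bsub>?T\<^esub> ?e ((r \<odot>\<^bsub>M\<^esub> a) # L) = ?S +>\<^bsub>?T\<^esub> (r \<odot>\<^bsub>?T\<^esub> ?e (a # L))"
    using T.coset_eq_iff[OF S] e a r by auto
  then show ?thesis
    unfolding wedge_def ext_power_def Let_def using T.quot_mod_smult[OF S r e[OF a]] by simp
qed

end

context residue_ring
begin

text \<open>
  The universal property of the exterior power, for multilinear alternating maps into the residue
  field: the linear extension to the free module on all tuples kills the defining relations.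
\<close>

lemma wedge_functional:
  fixes \<psi> :: "'m list \<Rightarrow> 'c"
  assumes M: "module R M"
    and add: "\<And>xs i a b. xs \<in> tuples p (carrier M) \<Longrightarrow> i < p \<Longrightarrow> a \<in> carrier M \<Longrightarrow> b \<in> carrier M \<Longrightarrow>
      \<psi> (xs[i := a \<oplus>\<^bsub>M\<^esub> b]) = \<psi> (xs[i := a]) + \<psi> (xs[i := b])"
    and smult: "\<And>xs i r a. xs \<in> tuples p (carrier M) \<Longrightarrow> i < p \<Longrightarrow> r \<in> carrier R \<Longrightarrow> a \<in> carrier M \<Longrightarrow>
      \<psi> (xs[i := r \<odot>\<^bsub>M\<^esub> a]) = ev r * \<psi> (xs[i := a])"
    and alt: "\<And>xs i j. xs \<in> tuples p (carrier M) \<Longrightarrow> i < j \<Longrightarrow> j < p \<Longrightarrow> xs ! i = xs ! j \<Longrightarrow> \<psi> xs = 0"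
  obtains h where "semilinear R (ext_power R p M) (\<lambda>r x. ev r * x) h"
    and "\<And>xs. xs \<in> tuples p (carrier M) \<Longrightarrow> h (wedge R p M xs) = \<psi> xs"
proof -
  interpret M: module R M by (rule M)
  let ?T = "free_mod R (tuples p (carrier M))" and ?e = "unit_vec R"
  interpret T: module R ?T by (rule free_mod_module)
  obtain \<Psi> where \<Psi>: "semilinear R ?T (\<lambda>r x. ev r * x) \<Psi>" and \<Psi>e: "\<And>xs. \<Psi> (?e xs) = \<psi> xs"
    using semilinear_on_free_mod[of _ \<psi>] by blast
  have e: "?e xs \<in> carrier ?T" if "xs \<in> tuples p (carrier M)" for xs
    using that by (rule unit_vec_closed)
  have "\<Psi> c = 0" if c: "c \<in> wedge_relations R p M" for c
    using c unfolding wedge_relations_def Let_def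
  proof (elim UnE, goal_cases)
    case 1
    then obtain xs i a b where *: "c = ?e (xs[i := a \<oplus>\<^bsub>M\<^esub> b]) \<ominus>\<^bsub>?T\<^esub> (?e (xs[i := a]) \<oplus>\<^bsub>?T\<^esub> ?e (xs[i := b]))"
      "xs \<in> tuples p (carrier M)" "i < p" "a \<in> carrier M" "b \<in> carrier M" by auto
    have [simp]: "?e (xs[i := d]) \<in> carrier ?T" if "d \<in> carrier M" for d
      using that * by (intro e tuples_update)
    show ?case unfolding *(1)
      using * T.semilinear_minus[OF \<Psi>] semilinear_add[OF \<Psi>] by (simp add: \<Psi>e add)
  next
    case 2
    then obtain xs i r a where *: "c = ?e (xs[i := r \<odot>\<^bsub>M\<^esub> a]) \<ominus>\<^bsub>?T\<^esub> (r \<odot>\<^bsub>?T\<^esub> ?e (xs[i := a]))"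
      "xs \<in> tuples p (carrier M)" "i < p" "r \<in> carrier R" "a \<in> carrier M" by auto
    have [simp]: "?e (xs[i := d]) \<in> carrier ?T" if "d \<in> carrier M" for d
      using that * by (intro e tuples_update)
    show ?case unfolding *(1)
      using * T.semilinear_minus[OF \<Psi>] semilinear_smult[OF \<Psi>] by (simp add: \<Psi>e smult)
  next
    case 3
    then obtain xs i j where "c = ?e xs" "xs \<in> tuples p (carrier M)" "i < j" "j < p" "xs ! i = xs ! j" by auto
    then show ?case using alt by (simp add: \<Psi>e)
  qed
  from T.semilinear_descends_span[OF M.wedge_relations_closed \<Psi> _ this]
  obtain h where h: "semilinear R (ext_power R p M) (\<lambda>r x. ev r * x) h"
    "\<And>c. c \<in> carrier ?T \<Longrightarrow> h (mod_span R ?T (wedge_relations R p M) +>\<^bsub>?T\<^esub> c) = \<Psi> c"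
    unfolding ext_power_def Let_def by auto
  show ?thesis
    by (rule that[OF h(1)]) (simp add: wedge_def Let_def h(2) e \<Psi>e)
qed

text \<open>
  Freeness is used only through this lifting property: a functional into the residue field is the
  reduction of a linear form with values in \<open>R\<close>, obtained by lifting its values on a basis.
\<close>

lemma semilinear_lifts_if_free:
  assumes N: "module R N" and free: "is_free R N" and h: "semilinear R N (\<lambda>r x. ev r * x) h"
  obtains l where "l \<in> carrier N \<rightarrow> carrier R"
    and "\<And>a b. a \<in> carrier N \<Longrightarrow> b \<in> carrier N \<Longrightarrow> l (a \<oplus>\<^bsub>N\<^esub> b) = l a \<oplus> l b"
    and "\<And>r a. r \<in> carrier R \<Longrightarrow> a \<in> carrier N \<Longrightarrow> l (r \<odot>\<^bsub>N\<^esub> a) = r \<otimes> l a"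
    and "\<And>a. a \<in> carrier N \<Longrightarrow> ev (l a) = h a"
proof -
  interpret N: module R N by (rule N)
  interpret S: module R "self_mod R" by (rule self_mod_module)
  obtain B where B: "B \<subseteq> carrier N" and
    ex1: "\<And>m. m \<in> carrier N \<Longrightarrow> \<exists>!c. c \<in> carrier (free_mod R B) \<and> m = lincomb R N c (\<lambda>b. b)"
    using free unfolding is_free_def module_basis_def lincomb_def
    by (elim exE conjE) (rule that, assumption, drule (1) bspec, simp only: lincomb_def)
  interpret F: module R "free_mod R B" by (rule free_mod_module)
  define co where "co m = (THE c. c \<in> carrier (free_mod R B) \<and> m = lincomb R N c (\<lambda>b. b))" for m
  have co: "co m \<in> carrier (free_mod R B)" "lincomb R N (co m) (\<lambda>b. b) = m" if "m \<in> carrier N" for m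
    using theI'[OF ex1[OF that]] by (auto simp: co_def)
  have co_eq: "co m = c" if "c \<in> carrier (free_mod R B)" "m = lincomb R N c (\<lambda>b. b)" "m \<in> carrier N" for c m
    unfolding co_def by (rule the1_equality[OF ex1[OF that(3)]]) (intro conjI that)
  have id: "(\<lambda>b. b) \<in> B \<rightarrow> carrier N" using B by auto
  define u where "u b = const (h b)" for b
  have u: "u \<in> B \<rightarrow> carrier (self_mod R)" by (auto simp: u_def self_mod_simps)
  define l where "l m = lincomb R (self_mod R) (co m) u" for m
  show ?thesis
  proof
    show "l \<in> carrier N \<rightarrow> carrier R"
      using S.lincomb_closed[OF co(1) u] by (auto simp: l_def self_mod_simps)
    fix a assume a: "a \<in> carrier N"
    show "l (a \<oplus>\<^bsub>N\<^esub> b) = l a \<oplus> l b" if b: "b \<in> carrier N" for b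
    proof -
      have "co (a \<oplus>\<^bsub>N\<^esub> b) = co a \<oplus>\<^bsub>free_mod R B\<^esub> co b"
        using a b co N.lincomb_add[OF co(1)[OF a] co(1)[OF b] id] by (intro co_eq) auto
      then show ?thesis
        using S.lincomb_add[OF co(1)[OF a] co(1)[OF b] u] by (simp add: l_def self_mod_simps)
    qed
    show "l (r \<odot>\<^bsub>N\<^esub> a) = r \<otimes> l a" if r: "r \<in> carrier R" for r
    proof -
      have "co (r \<odot>\<^bsub>N\<^esub> a) = r \<odot>\<^bsub>free_mod R B\<^esub> co a"
        using a r co N.lincomb_smult[OF co(1)[OF a] id r] by (intro co_eq) auto
      then show ?thesis
        using S.lincomb_smult[OF co(1)[OF a] u r] by (simp add: l_def self_mod_simps)
    qed
    have ev: "semilinear R (self_mod R) (\<lambda>r x. ev r * x) ev"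
      by (auto simp: semilinear_def self_mod_simps ev_add ev_mult)
    let ?X = "{b. co a b \<noteq> \<zero>}"
    have X: "finite ?X" "?X \<subseteq> B" using free_mod_finite[OF co(1)[OF a]] N.free_mod_support[OF co(1)[OF a]] by auto
    have "ev (l a) = (\<Sum>b\<in>?X. ev (co a b) * ev (u b))"
      unfolding l_def lincomb_def
      using X free_mod_coeff[OF co(1)[OF a]] u by (intro S.semilinear_finsum[OF ev]) auto
    also have "\<dots> = (\<Sum>b\<in>?X. ev (co a b) * h b)" by (simp add: u_def ev_const)
    also have "\<dots> = h (lincomb R N (co a) (\<lambda>b. b))"
      unfolding lincomb_def
      using X free_mod_coeff[OF co(1)[OF a]] B by (intro N.semilinear_finsum[OF h, symmetric]) auto
    also have "\<dots> = h a" by (simp add: co(2)[OF a])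
    finally show "ev (l a) = h a" .
  qed
qed

end

section \<open>Relations among generators of a module with a free exterior power\<close>

context residue_ring
begin

text \<open>
  The \<open>g k\<close> are sent to different unit vectors by \<open>\<theta>\<close>, so for each \<open>k\<close> there are a tuple \<open>L\<close> of \<open>p - 1\<close>
  of the other \<open>g j\<close> and a minor \<open>\<psi>\<close>, a functional on the exterior power, with
  \<open>\<psi> (g j \<and> L)\<close> equal to \<open>1\<close> for \<open>j = k\<close> and to \<open>0\<close> otherwise; \<open>p \<le> card T\<close> provides enough
  elements for \<open>L\<close>. Lifting \<open>\<psi>\<close> to a linear form on the free module and composing with the wedge by
  \<open>L\<close> gives a linear form \<open>l k\<close> on \<open>M\<close>. A relation with coefficients \<open>a\<close> is thereby turned into a
  linear system for \<open>a\<close> with a matrix that is the identity modulo the maximal ideal.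
\<close>

lemma independent_if_ext_power_free:
  fixes g :: "'n::finite \<Rightarrow> 'm" and \<theta> :: "'m \<Rightarrow> 'c^'n"
  assumes M: "module R M" and \<theta>: "semilinear R M (\<lambda>r v. ev r *s v) \<theta>"
    and g: "\<And>k. k \<in> T \<Longrightarrow> g k \<in> carrier M" and \<theta>g: "\<And>k. k \<in> T \<Longrightarrow> \<theta> (g k) = axis k 1"
    and p: "1 \<le> p" "p \<le> card T" and free: "is_free R (ext_power R p M)"
    and a: "\<And>k. k \<in> T \<Longrightarrow> a k \<in> carrier R" and rel: "(\<Oplus>\<^bsub>M\<^esub>k\<in>T. a k \<odot>\<^bsub>M\<^esub> g k) = \<zero>\<^bsub>M\<^esub>"
  shows "\<forall>k\<in>T. a k = \<zero>"
proof -
  interpret M: module R M by (rule M)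
  define linear_form where "linear_form l \<longleftrightarrow> l \<in> carrier M \<rightarrow> carrier R \<and>
    (\<forall>a\<in>carrier M. \<forall>b\<in>carrier M. l (a \<oplus>\<^bsub>M\<^esub> b) = l a \<oplus> l b) \<and>
    (\<forall>r\<in>carrier R. \<forall>a\<in>carrier M. l (r \<odot>\<^bsub>M\<^esub> a) = r \<otimes> l a)" for l
  have "\<forall>k\<in>T. \<exists>l. linear_form l \<and> (\<forall>j\<in>T. ev (l (g j)) = of_bool (k = j))"
  proof
    fix k assume k: "k \<in> T"
    obtain q where q: "p = Suc q" using p by (cases p) auto
    have "q \<le> card (T - {k})" using p q k by simp
    then obtain K where K: "K \<subseteq> T - {k}" "card K = q" "finite K"
      using obtain_subset_with_card_n by blast
    then obtain ks where ks: "set ks = K" "distinct ks" "length ks = q"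
      using finite_distinct_list distinct_card by metis
    define L where "L = map g ks"
    define \<kappa> where "\<kappa> = k # ks"
    have \<kappa>: "distinct \<kappa>" "length \<kappa> = p" "set \<kappa> \<subseteq> T" using ks K k q by (auto simp: \<kappa>_def)
    define pos where "pos i = (THE j. j < p \<and> \<kappa> ! j = i)" for i
    have pos: "pos (\<kappa> ! j) = j" if "j < p" for j
      unfolding pos_def using that \<kappa> by (intro the_equality) (auto simp: nth_eq_iff_index_eq)
    have pos_lt: "pos i < p" "\<kappa> ! pos i = i" if "i \<in> set \<kappa>" for i
      using that pos \<kappa> by (metis in_set_conv_nth)+
    \<comment> \<open>the minor of the entries of a tuple in the rows \<open>\<kappa>\<close>, written as a determinant of full size by filling up with unit vectors\<close>
    define \<psi> where "\<psi> xs = det (\<chi> i. if i \<in> set \<kappa> then \<theta> (xs ! pos i) else axis i 1)" for xs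
    have row: "(\<chi> i. if i \<in> set \<kappa> then \<theta> (xs[j := c] ! pos i) else axis i 1) =
        (\<chi> i. if i = \<kappa> ! j then \<theta> c else if i \<in> set \<kappa> then \<theta> (xs ! pos i) else axis i 1)"
      if "j < p" "length xs = p" for xs j c
      using that \<kappa> pos pos_lt by (auto simp: vec_eq_iff nth_list_update)
    have L: "L \<in> tuples q (carrier M)" using ks K g by (auto simp: L_def tuples_def)
    obtain h where h: "semilinear R (ext_power R p M) (\<lambda>r x. ev r * x) h"
      and hw: "\<And>xs. xs \<in> tuples p (carrier M) \<Longrightarrow> h (wedge R p M xs) = \<psi> xs"
    proof (rule wedge_functional[OF M, of p \<psi>])
      fix xs j assume xs: "xs \<in> tuples p (carrier M)"
      then have len: "length xs = p" by (simp add: tuples_def)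
      show "\<psi> (xs[j := a \<oplus>\<^bsub>M\<^esub> b]) = \<psi> (xs[j := a]) + \<psi> (xs[j := b])"
        if "j < p" "a \<in> carrier M" "b \<in> carrier M" for a b
        unfolding \<psi>_def row[OF that(1) len] semilinear_add[OF \<theta> that(2,3)] by (rule det_row_add)
      show "\<psi> (xs[j := r \<odot>\<^bsub>M\<^esub> a]) = ev r * \<psi> (xs[j := a])"
        if "j < p" "r \<in> carrier R" "a \<in> carrier M" for r a
        unfolding \<psi>_def row[OF that(1) len] semilinear_smult[OF \<theta> that(2,3)] by (rule det_row_mul)
      show "\<psi> xs = 0" if "j < j'" "j' < p" "xs ! j = xs ! j'" for j'
      proof -
        have "\<kappa> ! j \<noteq> \<kappa> ! j'" using that \<kappa> by (simp add: nth_eq_iff_index_eq)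
        then show ?thesis unfolding \<psi>_def
          by (rule det_identical_rows) (use that \<kappa> pos in \<open>auto simp: row_def vec_eq_iff\<close>)
      qed
    qed auto
    obtain l where l: "l \<in> carrier (ext_power R p M) \<rightarrow> carrier R"
      and l_add: "\<And>a b. a \<in> carrier (ext_power R p M) \<Longrightarrow> b \<in> carrier (ext_power R p M) \<Longrightarrow>
        l (a \<oplus>\<^bsub>ext_power R p M\<^esub> b) = l a \<oplus> l b"
      and l_smult: "\<And>r a. r \<in> carrier R \<Longrightarrow> a \<in> carrier (ext_power R p M) \<Longrightarrow>
        l (r \<odot>\<^bsub>ext_power R p M\<^esub> a) = r \<otimes> l a"
      and evl: "\<And>a. a \<in> carrier (ext_power R p M) \<Longrightarrow> ev (l a) = h a"
      using semilinear_lifts_if_free[OF M.ext_power_module free h] by blast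
    define w where "w m = wedge R p M (m # L)" for m
    have t: "m # L \<in> tuples p (carrier M)" if "m \<in> carrier M" for m
      using L that q by (auto simp: tuples_def)
    have w: "w m \<in> carrier (ext_power R p M)" if "m \<in> carrier M" for m
      unfolding w_def by (intro M.wedge_closed t that)
    have w_add: "w (a \<oplus>\<^bsub>M\<^esub> b) = w a \<oplus>\<^bsub>ext_power R p M\<^esub> w b" if "a \<in> carrier M" "b \<in> carrier M" for a b
      using M.wedge_Cons_add[OF L that] by (simp add: w_def q)
    have w_smult: "w (r \<odot>\<^bsub>M\<^esub> a) = r \<odot>\<^bsub>ext_power R p M\<^esub> w a" if "r \<in> carrier R" "a \<in> carrier M" for r a
      using M.wedge_Cons_smult[OF L that(2,1)] by (simp add: w_def q)
    have det: "\<psi> (g j # L) = of_bool (k = j)" if j: "j \<in> T" for j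
    proof -
      have xs: "\<theta> ((g j # L) ! pos i) = (if i = k then axis j 1 else axis i 1)" if i: "i \<in> set \<kappa>" for i
      proof (cases "i = k")
        case True
        then have "pos i = 0" using pos[of 0] p by (simp add: \<kappa>_def)
        then show ?thesis using True \<theta>g j by simp
      next
        case False
        then have "pos i \<noteq> 0" using pos_lt[OF i] by (metis \<kappa>_def nth_Cons_0)
        then obtain s where s: "pos i = Suc s" by (cases "pos i") auto
        then have "s < q" "ks ! s = i" using pos_lt[OF i] q by (auto simp: \<kappa>_def)
        then have "L ! s = g i" "i \<in> T" using ks K by (auto simp: L_def)
        then show ?thesis using False s \<theta>g by simp
      qed
      \<comment> \<open>the identity matrix if \<open>j = k\<close>; otherwise the rows \<open>j\<close> and \<open>k\<close> agree\<close>
      have eq: "(\<chi> i. if i \<in> set \<kappa> then \<theta> ((g j # L) ! pos i) else axis i 1) =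
          (\<chi> i. if i = k then axis j 1 else axis i 1)"
        using xs by (auto simp: vec_eq_iff \<kappa>_def)
      show ?thesis
      proof (cases "k = j")
        case True
        then have "(\<chi> i. if i = k then axis j 1 else axis i 1 :: 'c^'n^'n) = mat 1"
          by (auto simp: vec_eq_iff mat_def axis_def)
        then show ?thesis using True by (simp add: \<psi>_def eq)
      next
        case False
        have "det (\<chi> i. if i = k then axis j 1 else axis i 1 :: 'c^'n^'n) = 0"
          using False by (intro det_identical_rows[of k j]) (auto simp: row_def vec_eq_iff)
        then show ?thesis using False by (simp add: \<psi>_def eq)
      qed
    qed
    show "\<exists>l. linear_form l \<and> (\<forall>j\<in>T. ev (l (g j)) = of_bool (k = j))"
    proof (intro exI[of _ "\<lambda>m. l (w m)"] conjI)
      show "linear_form (\<lambda>m. l (w m))"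
        unfolding linear_form_def using l w by (auto simp: w_add w_smult l_add l_smult)
      show "\<forall>j\<in>T. ev (l (w (g j))) = of_bool (k = j)"
        using evl w g hw t det by (simp add: w_def)
    qed
  qed
  then obtain l where lk: "\<And>k. k \<in> T \<Longrightarrow> linear_form (l k)"
    and evl: "\<And>k j. k \<in> T \<Longrightarrow> j \<in> T \<Longrightarrow> ev (l k (g j)) = of_bool (k = j)"
    using bchoice by (metis (no_types, lifting))
  have l: "l k \<in> carrier M \<rightarrow> carrier R"
    and add: "a \<in> carrier M \<Longrightarrow> b \<in> carrier M \<Longrightarrow> l k (a \<oplus>\<^bsub>M\<^esub> b) = l k a \<oplus> l k b"
    and smult: "r \<in> carrier R \<Longrightarrow> a \<in> carrier M \<Longrightarrow> l k (r \<odot>\<^bsub>M\<^esub> a) = r \<otimes> l k a"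
    if "k \<in> T" for k r a b
    using lk[OF that] by (simp_all add: linear_form_def)
  have hom: "l k (\<Oplus>\<^bsub>M\<^esub>j\<in>X. a j \<odot>\<^bsub>M\<^esub> g j) = (\<Oplus>j\<in>X. a j \<otimes> l k (g j))" if k: "k \<in> T" and X: "X \<subseteq> T" for k X
    using finite[of X] X
  proof (induction X rule: finite_induct)
    case empty
    have "l k (\<zero> \<odot>\<^bsub>M\<^esub> \<zero>\<^bsub>M\<^esub>) = \<zero> \<otimes> l k \<zero>\<^bsub>M\<^esub>" by (rule smult[OF k]) auto
    moreover have "l k \<zero>\<^bsub>M\<^esub> \<in> carrier R" using l[OF k] by auto
    ultimately show ?case by simp
  next
    case (insert x X)
    have gl: "l k (g j) \<in> carrier R" if "j \<in> T" for j using l[OF k] g[OF that] by auto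
    have s: "(\<Oplus>\<^bsub>M\<^esub>j\<in>X. a j \<odot>\<^bsub>M\<^esub> g j) \<in> carrier M" using insert.prems a g by (intro M.M.finsum_closed) auto
    have "(\<Oplus>\<^bsub>M\<^esub>j\<in>insert x X. a j \<odot>\<^bsub>M\<^esub> g j) = a x \<odot>\<^bsub>M\<^esub> g x \<oplus>\<^bsub>M\<^esub> (\<Oplus>\<^bsub>M\<^esub>j\<in>X. a j \<odot>\<^bsub>M\<^esub> g j)"
      using insert.prems insert.hyps a g by (intro M.M.finsum_insert) auto
    also have "l k \<dots> = a x \<otimes> l k (g x) \<oplus> l k (\<Oplus>\<^bsub>M\<^esub>j\<in>X. a j \<odot>\<^bsub>M\<^esub> g j)"
      using insert.prems a g s k by (simp add: add smult)
    also have "\<dots> = (\<Oplus>j\<in>insert x X. a j \<otimes> l k (g j))"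
      using insert a gl by (subst finsum_insert) auto
    finally show ?case .
  qed
  show ?thesis
  proof (rule trivial_kernel_if_residue_identity[of T "\<lambda>k j. l k (g j)"])
    fix k assume k: "k \<in> T"
    have gl: "l k (g j) \<in> carrier R" if "j \<in> T" for j using l[OF k] g[OF that] by auto
    have "(\<Oplus>j\<in>T. l k (g j) \<otimes> a j) = (\<Oplus>j\<in>T. a j \<otimes> l k (g j))"
      using a gl by (intro finsum_cong') (auto simp: m_comm)
    also have "\<dots> = l k \<zero>\<^bsub>M\<^esub>" using hom[OF k, of T] rel by simp
    also have "\<dots> = \<zero>" using hom[OF k, of "{}"] by simp
    finally show "(\<Oplus>j\<in>T. l k (g j) \<otimes> a j) = \<zero>" .
  qed (use l g a evl in auto)
qed

end

section \<open>Holomorphic functions of several variables\<close>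

lemma bounded_linear_gradient: "bounded_linear (\<lambda>v :: complex^'n. \<Sum>i\<in>UNIV. v $ i * c i)"
  by (intro bounded_linear_sum bounded_linear_mult_const bounded_linear_vec_nth)

text \<open>
  A complex linear derivative is determined by its values on the axes. From here on derivatives are
  written as gradients.
\<close>

lemma has_derivative_imp_partial:
  fixes f :: "complex^'n \<Rightarrow> complex"
  assumes f: "(f has_derivative D) (at z)" and D: "\<And>c v. D (c *s v) = c * D v"
  shows "partial i f z = D (axis i 1)" and "D v = (\<Sum>i\<in>UNIV. v $ i * partial i f z)"
proof -
  have l: "linear D" using f by (rule has_derivative_linear)
  have *: "partial i f z = D (axis i 1)" for i
  proof -
    have "bounded_linear (\<lambda>t::complex. t *s axis i (1::complex) :: complex^'n)"
      by (simp add: linear_iff linear_conv_bounded_linear[symmetric] vec_eq_iff algebra_simps)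
    then have "((\<lambda>t. z + t *s axis i 1) has_derivative (\<lambda>t. t *s axis i 1)) (at 0)"
      by (auto intro!: derivative_eq_intros bounded_linear_imp_has_derivative)
    then have "((\<lambda>t. f (z + t *s axis i 1)) has_derivative (\<lambda>t. D (t *s axis i 1))) (at 0)"
      using f by (intro has_derivative_compose[of "\<lambda>t. z + t *s axis i 1" _ _ _ f]) auto
    then have "((\<lambda>t. f (z + t *s axis i 1)) has_field_derivative D (axis i 1)) (at 0)"
      by (rule has_derivative_imp_has_field_derivative) (simp add: D mult.commute)
    then show ?thesis unfolding partial_def by (rule DERIV_imp_deriv)
  qed
  then show "partial i f z = D (axis i 1)" .
  have "D v = D (\<Sum>i\<in>UNIV. (v $ i) *s axis i 1)" by (simp add: basis_expansion)
  also have "\<dots> = (\<Sum>i\<in>UNIV. v $ i * D (axis i 1))" by (simp add: linear_sum[OF l] D)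
  finally show "D v = (\<Sum>i\<in>UNIV. v $ i * partial i f z)" by (simp add: *)
qed

lemma holo_on_has_derivative:
  assumes "f holo_on U" "z \<in> U"
  shows "(f has_derivative (\<lambda>v. \<Sum>i\<in>UNIV. v $ i * partial i f z)) (at z)"
proof -
  obtain D where D: "(f has_derivative D) (at z)" "\<And>c v. D (c *s v) = c * D v"
    using assms unfolding holo_on_def by blast
  have "D = (\<lambda>v. \<Sum>i\<in>UNIV. v $ i * partial i f z)"
    using has_derivative_imp_partial(2)[OF D] by blast
  then show ?thesis using D by simp
qed

lemma holo_onI:
  assumes "open U" "\<And>z. z \<in> U \<Longrightarrow> \<exists>c. (f has_derivative (\<lambda>v. \<Sum>i\<in>UNIV. v $ i * c i)) (at z)"
  shows "f holo_on U"
  unfolding holo_on_def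
proof (intro conjI ballI assms(1))
  fix z assume "z \<in> U"
  then obtain c where "(f has_derivative (\<lambda>v. \<Sum>i\<in>UNIV. v $ i * c i)) (at z)" using assms(2) by blast
  then show "\<exists>D. (f has_derivative D) (at z) \<and> (\<forall>c v. D (c *s v) = c * D v)"
    by (intro exI[of _ "\<lambda>v. \<Sum>i\<in>UNIV. v $ i * c i"]) (simp add: sum_distrib_left mult.assoc)
qed

lemma partial_unique:
  assumes "(f has_derivative (\<lambda>v. \<Sum>i\<in>UNIV. v $ i * c i)) (at z)"
  shows "partial i f z = c i"
proof -
  have "partial i f z = (\<Sum>j\<in>UNIV. axis i 1 $ j * c j)"
    by (rule has_derivative_imp_partial(1)[OF assms]) (simp add: sum_distrib_left mult.assoc)
  also have "\<dots> = (\<Sum>j\<in>UNIV. if j = i then c j else 0)" by (intro sum.cong) (auto simp: axis_def)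
  finally show ?thesis by simp
qed

lemma has_derivative_coordinate:
  fixes z :: "complex^'n"
  shows "((\<lambda>z. z $ j + c) has_derivative (\<lambda>v. \<Sum>i\<in>UNIV. v $ i * (if i = j then 1 else 0))) (at z)"
proof -
  have "((\<lambda>z. z $ j + c) has_derivative (\<lambda>v. v $ j)) (at z)"
    by (auto intro!: derivative_eq_intros bounded_linear_imp_has_derivative bounded_linear_vec_nth)
  then show ?thesis by (simp add: if_distrib[of "\<lambda>a. _ * a"] cong: if_cong)
qed

lemma holo_on_open: "f holo_on U \<Longrightarrow> open U" by (simp add: holo_on_def)

lemma holo_on_subset: "f holo_on U \<Longrightarrow> open V \<Longrightarrow> V \<subseteq> U \<Longrightarrow> f holo_on V"
  by (auto simp: holo_on_def)

lemma holo_on_continuous: "f holo_on U \<Longrightarrow> continuous_on U f"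
  by (intro continuous_at_imp_continuous_on ballI has_derivative_continuous[OF holo_on_has_derivative])

lemma holo_on_const: "open U \<Longrightarrow> (\<lambda>z. c) holo_on U"
  unfolding holo_on_def by (auto intro!: exI[of _ "\<lambda>_. 0"])

lemma holo_on_coordinate: "open U \<Longrightarrow> (\<lambda>z. z $ i) holo_on U"
  unfolding holo_on_def
  by (auto intro!: exI[of _ "\<lambda>z. z $ i"] bounded_linear_imp_has_derivative bounded_linear_vec_nth)

lemma holo_on_add:
  assumes "f holo_on U" "g holo_on U" shows "(\<lambda>z. f z + g z) holo_on U"
proof (rule holo_onI)
  fix z assume z: "z \<in> U"
  show "\<exists>c. ((\<lambda>z. f z + g z) has_derivative (\<lambda>v. \<Sum>i\<in>UNIV. v $ i * c i)) (at z)"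
    using has_derivative_add[OF holo_on_has_derivative[OF assms(1) z] holo_on_has_derivative[OF assms(2) z]]
    by (intro exI[of _ "\<lambda>i. partial i f z + partial i g z"]) (simp add: sum.distrib ring_distribs)
qed (use assms holo_on_open in auto)

lemma holo_on_mult:
  assumes "f holo_on U" "g holo_on U" shows "(\<lambda>z. f z * g z) holo_on U"
proof (rule holo_onI)
  fix z assume z: "z \<in> U"
  have "(\<lambda>v. f z * (\<Sum>i\<in>UNIV. v $ i * partial i g z) + (\<Sum>i\<in>UNIV. v $ i * partial i f z) * g z)
     = (\<lambda>v. \<Sum>i\<in>UNIV. v $ i * (f z * partial i g z + partial i f z * g z))"
    by (simp add: sum_distrib_left sum_distrib_right sum.distrib[symmetric] algebra_simps)
  then show "\<exists>c. ((\<lambda>z. f z * g z) has_derivative (\<lambda>v. \<Sum>i\<in>UNIV. v $ i * c i)) (at z)"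
    using has_derivative_mult[OF holo_on_has_derivative[OF assms(1) z] holo_on_has_derivative[OF assms(2) z]]
    by auto
qed (use assms holo_on_open in auto)

lemma holo_on_minus: "f holo_on U \<Longrightarrow> g holo_on U \<Longrightarrow> (\<lambda>z. f z - g z) holo_on U"
  using holo_on_add[of f U "\<lambda>z. (-1) * g z"] holo_on_mult[of "\<lambda>_. -1" U g] holo_on_const[of U "-1"] holo_on_open[of f U]
  by simp

lemma holo_on_sum: "open U \<Longrightarrow> (\<And>a. a \<in> A \<Longrightarrow> f a holo_on U) \<Longrightarrow> (\<lambda>z. \<Sum>a\<in>A. f a z) holo_on U"
  by (induction A rule: infinite_finite_induct) (auto intro: holo_on_const holo_on_add)

lemma holo_on_inverse:
  assumes "f holo_on U" "\<And>z. z \<in> U \<Longrightarrow> f z \<noteq> 0" shows "(\<lambda>z. inverse (f z)) holo_on U"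
proof (rule holo_onI)
  fix z assume z: "z \<in> U"
  have "(\<lambda>v. - (inverse (f z) * (\<Sum>i\<in>UNIV. v $ i * partial i f z) * inverse (f z)))
     = (\<lambda>v. \<Sum>i\<in>UNIV. v $ i * (- (inverse (f z) * partial i f z * inverse (f z))))"
    by (simp add: sum_distrib_left sum_distrib_right sum_negf algebra_simps)
  then show "\<exists>c. ((\<lambda>z. inverse (f z)) has_derivative (\<lambda>v. \<Sum>i\<in>UNIV. v $ i * c i)) (at z)"
    using Deriv.has_derivative_inverse[OF assms(2)[OF z] holo_on_has_derivative[OF assms(1) z]]
    by metis
qed (use assms holo_on_open in auto)

lemma holo_on_local:
  assumes "open U" and "\<And>z. z \<in> U \<Longrightarrow> \<exists>V g. open V \<and> z \<in> V \<and> g holo_on V \<and> (\<forall>w\<in>V. f w = g w)"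
  shows "f holo_on U"
proof (rule holo_onI[OF assms(1)])
  fix z assume "z \<in> U"
  then obtain V g where V: "open V" "z \<in> V" "g holo_on V" "\<And>w. w \<in> V \<Longrightarrow> f w = g w" using assms(2) by metis
  have "(f has_derivative (\<lambda>v. \<Sum>i\<in>UNIV. v $ i * partial i g z)) (at z)"
    by (rule has_derivative_transform_within_open[OF holo_on_has_derivative[OF V(3,2)] V(1,2)]) (simp add: V(4))
  then show "\<exists>c. (f has_derivative (\<lambda>v. \<Sum>i\<in>UNIV. v $ i * c i)) (at z)"
    by (rule exI[of _ "\<lambda>i. partial i g z"])
qed

lemma has_derivative_vec:
  fixes \<phi> :: "'a::real_normed_vector \<Rightarrow> complex^'n"
  assumes "\<And>j. ((\<lambda>z. \<phi> z $ j) has_derivative D j) (at z)"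
  shows "(\<phi> has_derivative (\<lambda>v. \<chi> j. D j v)) (at z)"
  unfolding has_derivative_componentwise_within[of \<phi>]
  using assms by (auto simp: Basis_vec_def inner_axis intro!: has_derivative_inner_left)

lemma has_derivative_holo_compose:
  fixes \<phi> :: "complex^'m \<Rightarrow> complex^'n"
  assumes f: "f holo_on V" and \<phi>: "\<And>j. (\<lambda>z. \<phi> z $ j) holo_on U" and z: "z \<in> U" "\<phi> z \<in> V"
  shows "((\<lambda>z. f (\<phi> z)) has_derivative
    (\<lambda>v. \<Sum>i\<in>UNIV. v $ i * (\<Sum>j\<in>UNIV. partial j f (\<phi> z) * partial i (\<lambda>z. \<phi> z $ j) z))) (at z)"
proof -
  have "(\<phi> has_derivative (\<lambda>v. \<chi> j. \<Sum>i\<in>UNIV. v $ i * partial i (\<lambda>z. \<phi> z $ j) z)) (at z)"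
    by (intro has_derivative_vec holo_on_has_derivative[OF \<phi> z(1)])
  from has_derivative_compose[OF this holo_on_has_derivative[OF f z(2)]]
  have "((\<lambda>z. f (\<phi> z)) has_derivative
      (\<lambda>v. \<Sum>j\<in>UNIV. (\<Sum>i\<in>UNIV. v $ i * partial i (\<lambda>z. \<phi> z $ j) z) * partial j f (\<phi> z))) (at z)"
    by simp
  moreover have "(\<Sum>j\<in>UNIV. (\<Sum>i\<in>UNIV. v $ i * partial i (\<lambda>z. \<phi> z $ j) z) * partial j f (\<phi> z)) =
      (\<Sum>i\<in>UNIV. v $ i * (\<Sum>j\<in>UNIV. partial j f (\<phi> z) * partial i (\<lambda>z. \<phi> z $ j) z))" for v :: "complex^'m"
    unfolding sum_distrib_left sum_distrib_right
    by (subst sum.swap) (simp add: algebra_simps)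
  ultimately show ?thesis by simp
qed

lemma holo_on_compose:
  fixes \<phi> :: "complex^'m \<Rightarrow> complex^'n"
  assumes "f holo_on V" "\<And>j. (\<lambda>z. \<phi> z $ j) holo_on U" "\<And>z. z \<in> U \<Longrightarrow> \<phi> z \<in> V"
  shows "(\<lambda>z. f (\<phi> z)) holo_on U"
proof (rule holo_onI)
  show "open U" using assms(2) by (rule holo_on_open)
  show "\<exists>c. ((\<lambda>z. f (\<phi> z)) has_derivative (\<lambda>v. \<Sum>i\<in>UNIV. v $ i * c i)) (at z)" if "z \<in> U" for z
    by (rule exI[of _ "\<lambda>i. \<Sum>j\<in>UNIV. partial j f (\<phi> z) * partial i (\<lambda>z. \<phi> z $ j) z"])
      (rule has_derivative_holo_compose[OF assms(1,2) that assms(3)[OF that]])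
qed

lemma partial_compose:
  fixes \<phi> :: "complex^'m \<Rightarrow> complex^'n"
  assumes "f holo_on V" "\<And>j. (\<lambda>z. \<phi> z $ j) holo_on U" "z \<in> U" "\<phi> z \<in> V"
  shows "partial i (\<lambda>z. f (\<phi> z)) z = (\<Sum>j\<in>UNIV. partial j f (\<phi> z) * partial i (\<lambda>z. \<phi> z $ j) z)"
  by (rule partial_unique[OF has_derivative_holo_compose[OF assms]])

lemma norm_smult_axis: "norm (c *s axis i (1::complex) :: complex^'n) = cmod c"
proof -
  have "(\<Sum>j\<in>UNIV. (cmod ((c *s axis i (1::complex) :: complex^'n) $ j))\<^sup>2) = (\<Sum>j\<in>UNIV. if j = i then (cmod c)\<^sup>2 else 0)"
    by (intro sum.cong) (auto simp: axis_def)
  then show ?thesis by (simp add: norm_vec_def L2_set_def)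
qed

lemma holo_on_line:
  assumes f: "f holo_on U" and t: "z + t *s v \<in> U"
  shows "((\<lambda>t. f (z + t *s v)) has_field_derivative (\<Sum>i\<in>UNIV. v $ i * partial i f (z + t *s v))) (at t)"
proof -
  have "bounded_linear (\<lambda>t::complex. t *s v)"
    by (simp add: linear_iff linear_conv_bounded_linear[symmetric] vec_eq_iff algebra_simps)
  then have "((\<lambda>t. z + t *s v) has_derivative (\<lambda>t. t *s v)) (at t)"
    by (auto intro!: derivative_eq_intros bounded_linear_imp_has_derivative)
  from has_derivative_compose[OF this holo_on_has_derivative[OF f t]]
  moreover have "(\<lambda>s. \<Sum>i\<in>UNIV. (s *s v) $ i * partial i f (z + t *s v)) =
      (*) (\<Sum>i\<in>UNIV. v $ i * partial i f (z + t *s v))"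
    by (simp add: fun_eq_iff sum_distrib_left sum_distrib_right algebra_simps)
  ultimately show ?thesis by (simp add: has_field_derivative_def)
qed

text \<open>
  Cauchy's formula on the circle of radius \<open>r\<close> in the direction of the \<open>i\<close>-th axis. It expresses
  derivatives of \<open>f\<close> by values of \<open>f\<close>.
\<close>

lemma partial_integral_formula:
  fixes f :: "complex^'n \<Rightarrow> complex"
  assumes f: "f holo_on U" and r: "r > 0" and sub: "cball z r \<subseteq> U"
  shows "((\<lambda>x. f (z + (of_real r * exp (2 * of_real pi * \<i> * of_real x)) *s axis i 1) /
            (of_real r * exp (2 * of_real pi * \<i> * of_real x))) has_integral partial i f z) {0..1}"
proof -
  define h where "h t = f (z + t *s axis i 1)" for t
  have inU: "z + t *s axis i 1 \<in> U" if "t \<in> cball 0 r" for t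
    using that sub norm_smult_axis[of t i] by (auto simp: dist_norm)
  have d: "h field_differentiable at t" if "t \<in> cball 0 r" for t
    using holo_on_line[OF f inU[OF that]] unfolding h_def field_differentiable_def by blast
  have "((\<lambda>u. h u / (u - 0) ^ (Suc 1)) has_contour_integral ((2 * pi * \<i>) / (fact 1) * (deriv ^^ 1) h 0)) (circlepath 0 r)"
  proof (rule Cauchy_has_contour_integral_higher_derivative_circlepath)
    show "continuous_on (cball 0 r) h"
      using d by (intro continuous_at_imp_continuous_on ballI field_differentiable_imp_continuous_at)
    show "h holomorphic_on ball 0 r"
      using d by (auto simp: holomorphic_on_def intro: field_differentiable_at_within)
  qed (use r in auto)
  then have "((\<lambda>x. h (circlepath 0 r x) / (circlepath 0 r x)\<^sup>2 * vector_derivative (circlepath 0 r) (at x within {0..1}))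
      has_integral (2 * pi * \<i> * deriv h 0)) {0..1}"
    by (simp add: has_contour_integral_def power2_eq_square)
  then have "((\<lambda>x. h (circlepath 0 r x) / (circlepath 0 r x)\<^sup>2 * vector_derivative (circlepath 0 r) (at x within {0..1}) * inverse (2 * pi * \<i>))
      has_integral (2 * pi * \<i> * deriv h 0) * inverse (2 * pi * \<i>)) {0..1}"
    by (rule has_integral_mult_left)
  moreover have "(2 * pi * \<i> * deriv h 0) * inverse (2 * pi * \<i>) = partial i f z"
    by (simp add: partial_def h_def[abs_def] field_simps)
  moreover have "h (circlepath 0 r x) / (circlepath 0 r x)\<^sup>2 * vector_derivative (circlepath 0 r) (at x within {0..1}) * inverse (2 * pi * \<i>)
     = f (z + (of_real r * exp (2 * of_real pi * \<i> * of_real x)) *s axis i 1) /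
            (of_real r * exp (2 * of_real pi * \<i> * of_real x))" if "x \<in> {0..1}" for x
  proof -
    have v: "vector_derivative (circlepath 0 r) (at x within {0..1}) = 2 * pi * \<i> * r * exp (2 * of_real pi * \<i> * x)"
      using that by (intro vector_derivative_circlepath01) auto
    have c: "circlepath 0 r x = r * exp (2 * of_real pi * \<i> * x)" by (simp add: circlepath)
    show ?thesis unfolding v c h_def using r by (simp add: field_simps power2_eq_square)
  qed
  ultimately show ?thesis by (metis (no_types, lifting) has_integral_eq)
qed

lemma uniform_radius:
  fixes z :: "'a::metric_space"
  assumes "open U" "z \<in> U"
  obtains r where "r > 0" "ball z r \<subseteq> U" "\<forall>w\<in>ball z r. cball w r \<subseteq> U"
proof -
  obtain \<epsilon> where e: "\<epsilon> > 0" "cball z \<epsilon> \<subseteq> U" using assms open_contains_cball by blast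
  have "cball w (\<epsilon> / 2) \<subseteq> U" if "w \<in> ball z (\<epsilon> / 2)" for w
  proof
    fix y assume "y \<in> cball w (\<epsilon> / 2)"
    then have "dist z y \<le> \<epsilon>" using that dist_triangle[of z y w] by auto
    then show "y \<in> U" using e by auto
  qed
  then show ?thesis using e by (intro that[of "\<epsilon> / 2"]) auto
qed

text \<open>
  Holomorphy is defined by differentiability at each point, so that continuity of the derivative has
  to be proved: the integral in Cauchy's formula depends continuously on its parameters.
\<close>

lemma continuous_on_partial_param:
  fixes F :: "complex^'n \<Rightarrow> 'p::t2_space \<Rightarrow> complex"
  assumes cont: "continuous_on (U \<times> K) (\<lambda>(z, t). F z t)" and holo: "\<And>t. t \<in> K \<Longrightarrow> (\<lambda>z. F z t) holo_on U"
    and U: "open U"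
  shows "continuous_on (U \<times> K) (\<lambda>(z, t). partial i (\<lambda>z. F z t) z)"
  unfolding continuous_on_eq_continuous_within
proof
  fix zt assume "zt \<in> U \<times> K"
  then obtain z t where zt: "zt = (z, t)" "z \<in> U" "t \<in> K" by auto
  obtain r where r: "r > 0" and bU: "ball z r \<subseteq> U" and sub_all: "\<forall>w\<in>ball z r. cball w r \<subseteq> U"
    using uniform_radius[OF U zt(2)] .
  note sub = bspec[OF sub_all]
  let ?e = "\<lambda>x. of_real r * exp (2 * of_real pi * \<i> * of_real x) :: complex"
  let ?G = "\<lambda>p x. F (fst p + ?e x *s axis i 1) (snd p) / ?e x"
  have "continuous_on (ball z r \<times> K) (\<lambda>p. integral (cbox 0 1) (?G p))"
  proof (rule integral_continuous_on_param)
    have m: "fst (fst q) + ?e (snd q) *s axis i 1 \<in> U" if "q \<in> (ball z r \<times> K) \<times> cbox (0::real) 1" for q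
    proof -
      have "norm (?e (snd q) *s axis i 1 :: complex^'n) = r"
        using r by (simp add: norm_smult_axis norm_mult)
      then have "fst (fst q) + ?e (snd q) *s axis i 1 \<in> cball (fst (fst q)) r" by (simp add: dist_norm)
      moreover have "cball (fst (fst q)) r \<subseteq> U" using that by (intro sub) auto
      ultimately show ?thesis by blast
    qed
    have c: "continuous_on ((ball z r \<times> K) \<times> cbox (0::real) 1) (\<lambda>q. (fst (fst q) + ?e (snd q) *s axis i 1, snd (fst q)))"
      by (auto intro!: continuous_intros simp: vector_scalar_mult_def)
    have "continuous_on ((ball z r \<times> K) \<times> cbox (0::real) 1) (\<lambda>q. F (fst (fst q) + ?e (snd q) *s axis i 1) (snd (fst q)))"
    proof -
      have "(\<lambda>q. (fst (fst q) + ?e (snd q) *s axis i 1, snd (fst q))) ` ((ball z r \<times> K) \<times> cbox (0::real) 1) \<subseteq> U \<times> K"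
        using m by (intro image_subsetI SigmaI) auto
      from continuous_on_compose2[OF cont c this] show ?thesis by simp
    qed
    then show "continuous_on ((ball z r \<times> K) \<times> cbox 0 1) (\<lambda>(p, x). ?G p x)"
      unfolding split_beta using r by (intro continuous_intros) auto
  qed
  moreover have "integral (cbox 0 1) (?G p) = (case p of (z, t) \<Rightarrow> partial i (\<lambda>z. F z t) z)" if "p \<in> ball z r \<times> K" for p
    using partial_integral_formula[OF holo r sub, of "snd p" "fst p" i] that
    by (auto intro!: integral_unique)
  ultimately have "continuous_on (ball z r \<times> K) (\<lambda>(z, t). partial i (\<lambda>z. F z t) z)"
    by (simp cong: continuous_on_cong)
  then have "continuous (at zt within ball z r \<times> K) (\<lambda>(z, t). partial i (\<lambda>z. F z t) z)"
    using zt r by (auto simp: continuous_on_eq_continuous_within)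
  moreover have "at zt within ball z r \<times> K = at zt within U \<times> K"
    using zt r bU by (intro at_within_nhd[of _ "ball z r \<times> UNIV"]) (auto intro: open_Times)
  ultimately show "continuous (at zt within U \<times> K) (\<lambda>(z, t). partial i (\<lambda>z. F z t) z)" by simp
qed

text \<open>
  Differentiation under the integral sign. With Cauchy's formula it gives holomorphy of partial
  derivatives, and with the fundamental theorem of calculus it gives Hadamard's lemma.
\<close>

lemma holo_on_integral:
  fixes F :: "complex^'n \<Rightarrow> real \<Rightarrow> complex"
  assumes cont: "continuous_on (U \<times> {0..1}) (\<lambda>(z, t). F z t)" and holo: "\<And>t. t \<in> {0..1} \<Longrightarrow> (\<lambda>z. F z t) holo_on U"
    and U: "open U"
  shows "(\<lambda>z. integral {0..1} (F z)) holo_on U"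
proof (rule holo_onI[OF U])
  fix z0 assume "z0 \<in> U"
  then obtain r where r: "r > 0" "ball z0 r \<subseteq> U" using U open_contains_ball by blast
  define P where "P i z t = partial i (\<lambda>z. F z t) z" for i z t
  define D where "D z t = Blinfun (\<lambda>v :: complex^'n. \<Sum>i\<in>UNIV. v $ i * P i z t)" for z t
  have D: "blinfun_apply (D z t) = (\<lambda>v. \<Sum>i\<in>UNIV. v $ i * P i z t)" for z t
    unfolding D_def by (rule bounded_linear_Blinfun_apply[OF bounded_linear_gradient])
  have contP: "continuous_on (U \<times> {0..1}) (\<lambda>(z, t). P i z t)" for i
    unfolding P_def by (rule continuous_on_partial_param[OF cont holo U])
  have contD: "continuous_on (ball z0 r \<times> cbox 0 1) (\<lambda>(z, t). D z t)"
  proof (rule continuous_on_blinfun_componentwise)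
    fix v :: "complex^'n"
    have "continuous_on (ball z0 r \<times> cbox 0 1) (\<lambda>q. P i (fst q) (snd q))" for i
      using continuous_on_subset[OF contP[of i], of "ball z0 r \<times> cbox 0 1"] r by (auto simp: split_beta)
    then show "continuous_on (ball z0 r \<times> cbox 0 1) (\<lambda>q. blinfun_apply (case q of (z, t) \<Rightarrow> D z t) v)"
      unfolding split_beta D by (intro continuous_intros)
  qed
  have "((\<lambda>z. integral (cbox 0 1) (F z)) has_derivative integral (cbox 0 1) (D z0)) (at z0 within ball z0 r)"
  proof (rule leibniz_rule[OF _ _ contD])
    fix z t assume z: "z \<in> ball z0 r" and t: "t \<in> cbox 0 (1::real)"
    show "((\<lambda>z. F z t) has_derivative blinfun_apply (D z t)) (at z within ball z0 r)"
    proof -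
      have "t \<in> {0..1}" "z \<in> U" using t z r by auto
      from has_derivative_at_withinI[OF holo_on_has_derivative[OF holo[OF this(1)] this(2)]]
      show ?thesis by (simp only: D P_def)
    qed
  next
    fix z assume z: "z \<in> ball z0 r"
    have "continuous_on (cbox 0 1) (\<lambda>t. case (z, t) of (z, t) \<Rightarrow> F z t)"
      using z r by (intro continuous_on_compose2[OF cont, of _ "\<lambda>t. (z, t)"]) (auto intro!: continuous_intros)
    then show "F z integrable_on cbox 0 1" by (intro integrable_continuous) auto
  qed (use r in auto)
  then have "((\<lambda>z. integral {0..1} (F z)) has_derivative blinfun_apply (integral {0..1} (D z0))) (at z0)"
    using r by (simp add: at_within_open[of z0 "ball z0 r"])
  moreover have "blinfun_apply (integral {0..1} (D z0)) v = (\<Sum>i\<in>UNIV. v $ i * integral {0..1} (P i z0))" for v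
  proof -
    have ci: "continuous_on {0..1} (\<lambda>t. case (z0, t) of (z, t) \<Rightarrow> P i z t)" for i
      using r by (intro continuous_on_compose2[OF contP, of _ "\<lambda>t. (z0, t)"]) (auto intro!: continuous_intros)
    then have ii: "P i z0 integrable_on {0..1}" for i
      by (intro integrable_continuous_interval) auto
    have "continuous_on {0..1} (\<lambda>t. case (z0, t) of (z, t) \<Rightarrow> D z t)"
      using r by (intro continuous_on_compose2[OF contD, of _ "\<lambda>t. (z0, t)"]) (auto intro!: continuous_intros)
    then have "D z0 integrable_on {0..1}" by (intro integrable_continuous_interval) auto
    then have "blinfun_apply (integral {0..1} (D z0)) v = integral {0..1} (\<lambda>t. \<Sum>i\<in>UNIV. v $ i * P i z0 t)"
      by (simp add: blinfun_apply_integral D)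
    also have "\<dots> = (\<Sum>i\<in>UNIV. integral {0..1} (\<lambda>t. v $ i * P i z0 t))"
      by (intro integral_sum) (auto intro!: integrable_on_mult_right ii)
    finally show ?thesis by simp
  qed
  then have "blinfun_apply (integral {0..1} (D z0)) = (\<lambda>v. \<Sum>i\<in>UNIV. v $ i * integral {0..1} (P i z0))"
    by (rule ext)
  ultimately show "\<exists>c. ((\<lambda>z. integral {0..1} (F z)) has_derivative (\<lambda>v. \<Sum>i\<in>UNIV. v $ i * c i)) (at z0)"
    by (intro exI[of _ "\<lambda>i. integral {0..1} (P i z0)"]) (simp only:)
qed

lemma holo_on_partial:
  assumes f: "f holo_on U" shows "partial i f holo_on U"
proof (rule holo_on_local)
  show U: "open U" using f by (rule holo_on_open)
  fix z assume zU: "z \<in> U"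
  obtain r where r: "r > 0" and bU: "ball z r \<subseteq> U" and sub_all: "\<forall>w\<in>ball z r. cball w r \<subseteq> U"
    using uniform_radius[OF U zU] .
  note sub = bspec[OF sub_all]
  let ?e = "\<lambda>x. of_real r * exp (2 * of_real pi * \<i> * of_real x) :: complex"
  let ?G = "\<lambda>w x. f (w + ?e x *s axis i 1) / ?e x"
  have m: "w + ?e x *s axis i 1 \<in> U" if "w \<in> ball z r" for w x
  proof -
    have "norm (?e x *s axis i 1 :: complex^'a) = r" using r by (simp add: norm_smult_axis norm_mult)
    then have "w + ?e x *s axis i 1 \<in> cball w r" by (simp add: dist_norm)
    then show ?thesis using sub[OF that] by auto
  qed
  have "(\<lambda>w. integral {0..1} (?G w)) holo_on ball z r"
  proof (rule holo_on_integral)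
    have c: "continuous_on (ball z r \<times> {0..1}) (\<lambda>q. fst q + ?e (snd q) *s axis i 1)"
      by (auto intro!: continuous_intros simp: vector_scalar_mult_def)
    have "continuous_on (ball z r \<times> {0..1}) (\<lambda>q. f (fst q + ?e (snd q) *s axis i 1))"
      using m by (intro continuous_on_compose2[OF holo_on_continuous[OF f] c]) auto
    then show "continuous_on (ball z r \<times> {0..1}) (\<lambda>(w, x). ?G w x)"
      unfolding split_beta using r by (intro continuous_intros) auto
    fix x :: real
    have "(\<lambda>w. f (w + ?e x *s axis i 1)) holo_on ball z r"
    proof (rule holo_on_compose[OF f _ m])
      show "(\<lambda>w. (w + ?e x *s axis i 1) $ j) holo_on ball z r" for j
        using holo_on_add[OF holo_on_coordinate holo_on_const, of "ball z r" j "(?e x *s axis i 1) $ j"] by simp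
    qed
    then have "(\<lambda>w. f (w + ?e x *s axis i 1) * inverse (?e x)) holo_on ball z r"
      by (intro holo_on_mult holo_on_const) auto
    then show "(\<lambda>w. ?G w x) holo_on ball z r" by (simp add: divide_inverse)
  qed simp
  moreover have "integral {0..1} (?G w) = partial i f w" if "w \<in> ball z r" for w
    by (intro integral_unique partial_integral_formula[OF f r sub[OF that]])
  ultimately show "\<exists>V g. open V \<and> z \<in> V \<and> g holo_on V \<and> (\<forall>w\<in>V. partial i f w = g w)"
    using r by (intro exI[of _ "ball z r"] exI[of _ "\<lambda>w. integral {0..1} (?G w)"]) auto
qed

section \<open>Vanishing on coordinate subspaces and local inverses\<close>

definition slice :: "'n set \<Rightarrow> complex^'n \<Rightarrow> complex^'n" where
  "slice S w = (\<chi> i. if i \<in> S then 0 else w $ i)"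

lemma norm_vec_mono:
  fixes v w :: "complex^'n"
  assumes "\<And>i. cmod (v $ i) \<le> cmod (w $ i)" shows "norm v \<le> norm w"
  unfolding norm_vec_def by (rule L2_set_mono) (use assms in auto)

text \<open>
  The function is integrated along the segment from \<open>slice S w\<close> to \<open>w\<close>, in whose direction only the
  coordinates in \<open>S\<close> change.
\<close>

lemma hadamard:
  fixes f :: "complex^'n \<Rightarrow> complex"
  assumes f: "f holo_on ball 0 \<rho>"
  shows "\<exists>g. (\<forall>s. g s holo_on ball 0 \<rho>) \<and> (\<forall>w\<in>ball 0 \<rho>. f w = f (slice S w) + (\<Sum>s\<in>S. w $ s * g s w))"
proof -
  \<comment> \<open>the segment from \<open>slice S w\<close> to \<open>w\<close>\<close>
  define \<gamma> where "\<gamma> t w = (\<chi> i. if i \<in> S then of_real t * w $ i else w $ i)" for t and w :: "complex^'n"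
  have \<gamma>: "\<gamma> t w \<in> ball 0 \<rho>" if "w \<in> ball 0 \<rho>" "t \<in> {0..1}" for t w
  proof -
    have "norm (\<gamma> t w) \<le> norm w"
      using that by (intro norm_vec_mono) (auto simp: \<gamma>_def norm_mult intro: mult_left_le_one_le)
    then show ?thesis using that by auto
  qed
  define F where "F s w t = partial s f (\<gamma> t w)" for s w t
  define g where "g s w = integral {0..1} (F s w)" for s w
  have p: "partial s f holo_on ball 0 \<rho>" for s by (rule holo_on_partial[OF f])
  have cont\<gamma>: "continuous_on UNIV (\<lambda>q. \<gamma> (snd q) (fst q))"
    unfolding \<gamma>_def
  proof (rule continuous_on_vec_lambda)
    fix i show "continuous_on UNIV (\<lambda>q. if i \<in> S then complex_of_real (snd q) * fst q $ i else fst q $ i)"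
      by (cases "i \<in> S") (auto intro!: continuous_intros)
  qed
  have contF: "continuous_on (ball 0 \<rho> \<times> {0..1}) (\<lambda>(w, t). F s w t)" for s
    unfolding F_def split_beta
    by (rule continuous_on_compose2[OF holo_on_continuous[OF p]])
      (use \<gamma> in \<open>auto intro: continuous_on_subset[OF cont\<gamma>]\<close>)
  have gh: "g s holo_on ball 0 \<rho>" for s
    unfolding g_def[abs_def]
  proof (rule holo_on_integral[OF contF])
    fix t :: real assume t: "t \<in> {0..1}"
    show "(\<lambda>w. F s w t) holo_on ball 0 \<rho>"
      unfolding F_def
    proof (rule holo_on_compose[OF p])
      fix j show "(\<lambda>w. \<gamma> t w $ j) holo_on ball 0 \<rho>"
        by (cases "j \<in> S") (auto simp: \<gamma>_def intro!: holo_on_coordinate holo_on_mult holo_on_const)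
    qed (rule \<gamma>[OF _ t])
  qed simp
  have "f w = f (slice S w) + (\<Sum>s\<in>S. w $ s * g s w)" if w: "w \<in> ball 0 \<rho>" for w
  proof -
    have int: "F s w integrable_on {0..1}" for s
    proof -
      have "continuous_on {0..1} (\<lambda>t. case (w, t) of (w, t) \<Rightarrow> F s w t)"
        using w by (intro continuous_on_compose2[OF contF, of _ "\<lambda>t. (w, t)"]) (auto intro!: continuous_intros)
      then show ?thesis by (intro integrable_continuous_interval) auto
    qed
    have der: "((\<lambda>t. f (\<gamma> t w)) has_vector_derivative (\<Sum>s\<in>S. w $ s * F s w t)) (at t within {0..1})"
      if t: "t \<in> {0..1}" for t
    proof -
      have "((\<lambda>t. \<gamma> t w) has_derivative (\<lambda>h. \<chi> i. if i \<in> S then of_real h * w $ i else 0)) (at t)"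
      proof (rule has_derivative_vec)
        fix j show "((\<lambda>t. \<gamma> t w $ j) has_derivative (\<lambda>h. if j \<in> S then of_real h * w $ j else 0)) (at t)"
          by (cases "j \<in> S") (auto simp: \<gamma>_def intro!: derivative_eq_intros)
      qed
      from has_derivative_compose[OF this holo_on_has_derivative[OF f \<gamma>[OF w t]]]
      have "((\<lambda>t. f (\<gamma> t w)) has_derivative
          (\<lambda>h. \<Sum>i\<in>UNIV. (if i \<in> S then of_real h * w $ i else 0) * F i w t)) (at t)"
        by (simp add: F_def)
      moreover have "(\<Sum>i\<in>UNIV. (if i \<in> S then of_real h * w $ i else 0) * F i w t) =
          h *\<^sub>R (\<Sum>s\<in>S. w $ s * F s w t)" for h :: real
      proof -
        have "(\<Sum>i\<in>UNIV. (if i \<in> S then of_real h * w $ i else 0) * F i w t) =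
            (\<Sum>i\<in>UNIV. if i \<in> S then of_real h * w $ i * F i w t else 0)"
          by (intro sum.cong) auto
        also have "\<dots> = (\<Sum>i\<in>S. of_real h * w $ i * F i w t)"
          by (simp add: sum.inter_restrict[symmetric])
        finally show ?thesis by (simp add: scaleR_conv_of_real sum_distrib_left mult.assoc)
      qed
      ultimately show ?thesis
        by (simp add: has_vector_derivative_def has_derivative_at_withinI)
    qed
    have "((\<lambda>t. \<Sum>s\<in>S. w $ s * F s w t) has_integral f (\<gamma> 1 w) - f (\<gamma> 0 w)) {0..1}"
      by (rule fundamental_theorem_of_calculus[OF _ der]) auto
    moreover have "((\<lambda>t. \<Sum>s\<in>S. w $ s * F s w t) has_integral (\<Sum>s\<in>S. w $ s * g s w)) {0..1}"
      unfolding g_def using int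
      by (intro has_integral_sum has_integral_mult_right integrable_integral) auto
    ultimately have "f (\<gamma> 1 w) - f (\<gamma> 0 w) = (\<Sum>s\<in>S. w $ s * g s w)"
      by (rule has_integral_unique)
    moreover have "\<gamma> 1 w = w" "\<gamma> 0 w = slice S w" by (auto simp: \<gamma>_def slice_def vec_eq_iff)
    ultimately show ?thesis by (simp add: algebra_simps)
  qed
  then show ?thesis using gh by blast
qed

text \<open>
  The identity theorem on the complex line through \<open>0\<close> and \<open>w\<close>. As \<open>w\<close> is supported in \<open>T\<close>, the
  derivative \<open>D\<close> in the direction of \<open>w\<close> preserves \<open>J\<close>; so all iterated derivatives \<open>D\<^sup>n f\<close> vanish
  at \<open>0\<close>, and they are the derivatives of \<open>f\<close> along the line.
\<close>

lemma vanishing_on_slice: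
  fixes J :: "(complex^'n \<Rightarrow> complex) set"
  assumes z: "\<And>f. f \<in> J \<Longrightarrow> f 0 = 0" and closed: "\<And>f k. f \<in> J \<Longrightarrow> k \<in> T \<Longrightarrow> partial k f \<in> J"
    and lin: "\<And>f c. (\<And>k. k \<in> T \<Longrightarrow> f k \<in> J) \<Longrightarrow> (\<lambda>z. \<Sum>k\<in>T. c k * f k z) \<in> J"
    and f: "f \<in> J" "f holo_on ball 0 \<rho>" and w: "w \<in> ball 0 \<rho>" "\<And>i. i \<notin> T \<Longrightarrow> w $ i = 0"
  shows "f w = 0"
proof (cases "w = 0")
  case True then show ?thesis using z f by simp
next
  case False
  define D where "D f = (\<lambda>z. \<Sum>k\<in>T. w $ k * partial k f z)" for f
  have DJ: "(D ^^ n) f \<in> J" for n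
    by (induction n) (use f in \<open>auto simp: D_def intro: lin closed\<close>)
  have Dh: "(D ^^ n) f holo_on ball 0 \<rho>" for n
    by (induction n) (use f in \<open>auto simp: D_def intro!: holo_on_sum holo_on_mult holo_on_const holo_on_partial\<close>)
  \<comment> \<open>\<open>t *s w\<close> stays in the ball for \<open>cmod t < R\<close>, which includes \<open>t = 1\<close>\<close>
  define R where "R = \<rho> / norm w"
  have R: "R > 1" using w False by (simp add: R_def field_simps)
  have inb: "t *s w \<in> ball 0 \<rho>" if "t \<in> ball 0 R" for t
  proof -
    have "norm (t *s w) \<le> norm (cmod t *\<^sub>R w)"
      by (intro norm_vec_mono) (auto simp: norm_mult)
    then show ?thesis using that False by (auto simp: R_def field_simps)
  qed
  define h where "h t = f (t *s w)" for t
  have der: "((\<lambda>t. (D ^^ n) f (t *s w)) has_field_derivative (D ^^ Suc n) f (t *s w)) (at t)"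
    if "t \<in> ball 0 R" for n t
  proof -
    have "((\<lambda>t. (D ^^ n) f (0 + t *s w)) has_field_derivative
        (\<Sum>i\<in>UNIV. w $ i * partial i ((D ^^ n) f) (0 + t *s w))) (at t)"
      by (rule holo_on_line[OF Dh]) (use inb[OF that] in auto)
    moreover have "(\<Sum>i\<in>UNIV. w $ i * partial i ((D ^^ n) f) (t *s w)) = (D ^^ Suc n) f (t *s w)"
      unfolding funpow.simps comp_def D_def[of "(D ^^ n) f"] using w(2) by (intro sum.mono_neutral_right) auto
    ultimately show ?thesis by simp
  qed
  have hn: "(deriv ^^ n) h t = (D ^^ n) f (t *s w)" if "t \<in> ball 0 R" for n t
    using that
  proof (induction n arbitrary: t)
    case (Suc n)
    have "\<forall>\<^sub>F s in nhds t. (deriv ^^ n) h s = (D ^^ n) f (s *s w)"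
      using Suc by (intro eventually_nhds_in_open[THEN eventually_mono, of "ball 0 R"]) auto
    then have "deriv ((deriv ^^ n) h) t = deriv (\<lambda>s. (D ^^ n) f (s *s w)) t" by (rule deriv_cong_ev) simp
    then show ?case using DERIV_imp_deriv[OF der[OF Suc.prems]] by simp
  qed (simp add: h_def)
  have "h 1 = 0"
  proof (rule holomorphic_fun_eq_0_on_ball[of h 0 R])
    show "h holomorphic_on ball 0 R"
      using der[of _ 0] unfolding h_def holomorphic_on_open[OF open_ball]
      by (intro ballI exI) simp
    show "(deriv ^^ n) h 0 = 0" for n using hn[of 0 n] z[OF DJ] R by simp
  qed (use R in auto)
  then show ?thesis by (simp add: h_def)
qed

text \<open>
  The derivative of the inverse function in the real sense is the inverse of a complex linear
  bijection, hence complex linear.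
\<close>

lemma holomorphic_inverse:
  fixes \<Phi> :: "complex^'n \<Rightarrow> complex^'n"
  assumes \<Phi>: "\<And>j. (\<lambda>z. \<Phi> z $ j) holo_on U" and x: "x \<in> U"
    and inv: "invertible (\<chi> j i. partial i (\<lambda>z. \<Phi> z $ j) x)"
  obtains W V \<psi> where "open W" "W \<subseteq> U" "x \<in> W" "open V" "\<Phi> x \<in> V" "homeomorphism W V \<Phi> \<psi>"
    "\<And>j. (\<lambda>y. \<psi> y $ j) holo_on V"
proof -
  have U: "open U" using \<Phi> by (rule holo_on_open)
  define L where "L z v = (\<chi> j. \<Sum>i\<in>UNIV. v $ i * partial i (\<lambda>z. \<Phi> z $ j) z)" for z and v :: "complex^'n"
  have Lvec: "L z v = (\<chi> j i. partial i (\<lambda>z. \<Phi> z $ j) z) *v v" for z v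
    by (simp add: L_def matrix_vector_mult_def vec_eq_iff mult.commute)
  have bl: "bounded_linear (L z)" for z
    unfolding linear_conv_bounded_linear[symmetric] linear_iff
    by (simp add: L_def vec_eq_iff sum.distrib ring_distribs sum_distrib_left scaleR_sum_right)
  define f' where "f' z = Blinfun (L z)" for z
  have f': "blinfun_apply (f' z) = L z" for z
    unfolding f'_def by (rule bounded_linear_Blinfun_apply[OF bl])
  have der: "(\<Phi> has_derivative blinfun_apply (f' z)) (at z)" if "z \<in> U" for z
    unfolding f' L_def by (intro has_derivative_vec holo_on_has_derivative[OF \<Phi> that])
  have cont: "continuous_on U f'"
  proof (rule continuous_on_blinfun_componentwise)
    fix v :: "complex^'n"
    show "continuous_on U (\<lambda>z. blinfun_apply (f' z) v)"
      unfolding f' L_def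
      by (intro continuous_on_vec_lambda continuous_intros holo_on_continuous holo_on_partial \<Phi>)
  qed
  obtain B where B: "B ** (\<chi> j i. partial i (\<lambda>z. \<Phi> z $ j) x) = mat 1"
    using inv unfolding invertible_def by blast
  have blB: "bounded_linear (\<lambda>v. B *v v)"
    unfolding linear_conv_bounded_linear[symmetric] linear_iff
    by (simp add: vec_eq_iff matrix_vector_mult_def scaleR_sum_right sum.distrib ring_distribs)
  have "Blinfun (\<lambda>v. B *v v) o\<^sub>L f' x = id_blinfun"
    by (rule blinfun_eqI) (simp add: bounded_linear_Blinfun_apply[OF blB] f' Lvec matrix_vector_mul_assoc B)
  from inverse_function_theorem[OF U der cont x this]
  obtain W V \<psi> g' where *: "open W" "W \<subseteq> U" "x \<in> W" "open V" "\<Phi> x \<in> V" "homeomorphism W V \<Phi> \<psi>"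
    and g: "\<And>y. y \<in> V \<Longrightarrow> (\<psi> has_derivative g' y) (at y)"
    and g': "\<And>y. y \<in> V \<Longrightarrow> g' y = inv_into UNIV (L (\<psi> y))" and bij: "\<And>y. y \<in> V \<Longrightarrow> bij (L (\<psi> y))"
    unfolding f' by blast
  have "(\<lambda>y. \<psi> y $ j) holo_on V" for j
    unfolding holo_on_def
  proof (intro conjI ballI \<open>open V\<close>)
    fix y assume y: "y \<in> V"
    have "((\<lambda>y. \<psi> y $ j) has_derivative (\<lambda>v. g' y v $ j)) (at y)"
      by (rule bounded_linear.has_derivative[OF bounded_linear_vec_nth g[OF y]])
    moreover have "g' y (c *s v) = c *s g' y v" for c v
    proof -
      have "L (\<psi> y) (c *s g' y v) = c *s L (\<psi> y) (g' y v)"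
        by (simp add: Lvec vector_scalar_commute)
      also have "\<dots> = c *s v" using bij[OF y] by (simp add: g'[OF y] bij_is_surj surj_f_inv_f)
      finally show ?thesis using bij[OF y] by (metis g'[OF y] bij_inv_eq_iff)
    qed
    ultimately show "\<exists>D. ((\<lambda>y. \<psi> y $ j) has_derivative D) (at y) \<and> (\<forall>c v. D (c *s v) = c * D v)"
      by (intro exI[of _ "\<lambda>v. g' y v $ j"]) auto
  qed
  with * show ?thesis by (rule that)
qed

section \<open>Rings of germs\<close>

lemma holo_near_common:
  assumes "holo_near x f" "holo_near x g"
  obtains U where "x \<in> U" "f holo_on U" "g holo_on U"
proof -
  obtain U V where UV: "x \<in> U" "f holo_on U" "x \<in> V" "g holo_on V"
    using assms unfolding holo_near_def by blast
  have o: "open (U \<inter> V)" using UV holo_on_open by (intro open_Int)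
  show ?thesis
    by (rule that[of "U \<inter> V"]) (use UV in \<open>auto intro: holo_on_subset[OF _ o]\<close>)
qed

lemma holo_near_add: "holo_near x f \<Longrightarrow> holo_near x g \<Longrightarrow> holo_near x (\<lambda>z. f z + g z)"
  by (erule holo_near_common) (auto simp: holo_near_def intro: holo_on_add)

lemma holo_near_mult: "holo_near x f \<Longrightarrow> holo_near x g \<Longrightarrow> holo_near x (\<lambda>z. f z * g z)"
  by (erule holo_near_common) (auto simp: holo_near_def intro: holo_on_mult)

lemma holo_near_const: "holo_near x (\<lambda>z. c)"
  unfolding holo_near_def using holo_on_const by blast

lemma holo_near_coordinate: "holo_near x (\<lambda>z. z $ i)"
  unfolding holo_near_def using holo_on_coordinate by blast

lemma holo_near_minus: "holo_near x f \<Longrightarrow> holo_near x g \<Longrightarrow> holo_near x (\<lambda>z. f z - g z)"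
  using holo_near_add[of x f "\<lambda>z. (-1) * g z"] holo_near_mult[OF holo_near_const, of x g "-1"] by simp

lemma holo_near_sum: "(\<And>a. a \<in> A \<Longrightarrow> holo_near x (f a)) \<Longrightarrow> holo_near x (\<lambda>z. \<Sum>a\<in>A. f a z)"
  by (induction A rule: infinite_finite_induct) (auto intro: holo_near_const holo_near_add)

lemma holo_near_partial: "holo_near x f \<Longrightarrow> holo_near x (partial i f)"
  unfolding holo_near_def using holo_on_partial by blast

lemma holo_near_inverse:
  assumes "holo_near x f" "f x \<noteq> 0"
  shows "holo_near x (\<lambda>z. inverse (f z))" "\<forall>\<^sub>F z in nhds x. f z * inverse (f z) = 1"
proof -
  obtain U where U: "x \<in> U" "f holo_on U" using assms unfolding holo_near_def by blast
  define V where "V = f -` (- {0}) \<inter> U"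
  have V: "open V" unfolding V_def
    using holo_on_continuous[OF U(2)] continuous_on_open_vimage[OF holo_on_open[OF U(2)], of f] by auto
  have x: "x \<in> V" using U assms by (simp add: V_def)
  have "(\<lambda>z. inverse (f z)) holo_on V"
    using V by (intro holo_on_inverse holo_on_subset[OF U(2)]) (auto simp: V_def)
  then show "holo_near x (\<lambda>z. inverse (f z))" using x unfolding holo_near_def by blast
  show "\<forall>\<^sub>F z in nhds x. f z * inverse (f z) = 1"
    using V x by (intro eventually_nhds_in_open[THEN eventually_mono, of V]) (auto simp: V_def)
qed

lemma holo_near_ball:
  assumes "holo_near x f" obtains r where "r > 0" "f holo_on ball x r"
proof -
  obtain U where U: "x \<in> U" "f holo_on U" using assms unfolding holo_near_def by blast
  then obtain r where "r > 0" "ball x r \<subseteq> U" using holo_on_open open_contains_ball by blast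
  then show ?thesis using that holo_on_subset[OF U(2), of "ball x r"] by auto
qed

lemma holo_ring_cring: "cring (holo_ring x)"
proof (rule cringI)
  show "abelian_group (holo_ring x)"
  proof (rule abelian_groupI, goal_cases)
    case (6 f)
    then show ?case using holo_near_mult[OF holo_near_const, of x f "-1"]
      by (intro bexI[of _ "\<lambda>z. - f z"]) (auto simp: holo_ring_def)
  qed (auto simp: holo_ring_def holo_near_add holo_near_const algebra_simps)
  show "comm_monoid (holo_ring x)"
    by (rule comm_monoidI) (auto simp: holo_ring_def holo_near_mult holo_near_const algebra_simps)
qed (auto simp: holo_ring_def algebra_simps)

lemma holo_ring_simps:
  "carrier (holo_ring x) = Collect (holo_near x)" "f \<oplus>\<^bsub>holo_ring x\<^esub> g = (\<lambda>z. f z + g z)"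
  "f \<otimes>\<^bsub>holo_ring x\<^esub> g = (\<lambda>z. f z * g z)" "\<one>\<^bsub>holo_ring x\<^esub> = (\<lambda>_. 1)" "\<zero>\<^bsub>holo_ring x\<^esub> = (\<lambda>_. 0)"
  by (auto simp: holo_ring_def)

lemma holo_ring_uminus:
  assumes "holo_near x f" shows "\<ominus>\<^bsub>holo_ring x\<^esub> f = (\<lambda>z. - f z)"
proof -
  interpret H: cring "holo_ring x" by (rule holo_ring_cring)
  show ?thesis
    using assms holo_near_mult[OF holo_near_const, of x f "-1"]
    by (intro H.minus_equality) (auto simp: holo_ring_simps)
qed

lemma holo_ring_idealI:
  assumes "I \<subseteq> Collect (holo_near x)" "(\<lambda>_. 0) \<in> I"
    and add: "\<And>f g. f \<in> I \<Longrightarrow> g \<in> I \<Longrightarrow> (\<lambda>z. f z + g z) \<in> I"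
    and mult: "\<And>f g. holo_near x f \<Longrightarrow> g \<in> I \<Longrightarrow> (\<lambda>z. f z * g z) \<in> I"
  shows "ideal I (holo_ring x)"
proof -
  interpret H: cring "holo_ring x" by (rule holo_ring_cring)
  show ?thesis
  proof (rule idealI)
    show "subgroup I (add_monoid (holo_ring x))"
    proof (rule H.add.subgroupI)
      fix f assume f: "f \<in> I"
      then have "(\<lambda>z. (-1) * f z) \<in> I" by (intro mult holo_near_const)
      then show "\<ominus>\<^bsub>holo_ring x\<^esub> f \<in> I" using f assms(1) holo_ring_uminus[of x f] by auto
    qed (use assms in \<open>auto simp: holo_ring_simps\<close>)
    show "g \<otimes>\<^bsub>holo_ring x\<^esub> f \<in> I" "f \<otimes>\<^bsub>holo_ring x\<^esub> g \<in> I" if "f \<in> I" "g \<in> carrier (holo_ring x)" for f g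
      using mult[of g f] that by (auto simp: holo_ring_simps mult.commute)
  qed (rule H.ring_axioms)
qed

lemma null_ideal_ideal: "ideal (null_ideal x) (holo_ring x)"
proof (rule holo_ring_idealI)
  fix f g assume "f \<in> null_ideal x" "g \<in> null_ideal x"
  then show "(\<lambda>z. f z + g z) \<in> null_ideal x"
    unfolding null_ideal_def by (auto intro: holo_near_add elim: eventually_elim2)
next
  fix f g assume "holo_near x f" "g \<in> null_ideal x"
  then show "(\<lambda>z. f z * g z) \<in> null_ideal x"
    unfolding null_ideal_def by (auto intro: holo_near_mult elim: eventually_mono)
qed (auto simp: null_ideal_def holo_near_const)

text \<open>
  The functions whose germs lie in the ideal generated by \<open>F\<close>. Analytic arguments concern these
  functions instead of classes in an iterated quotient ring.
\<close>

definition function_ideal :: "(complex^'n \<Rightarrow> complex) set \<Rightarrow> complex^'n \<Rightarrow> (complex^'n \<Rightarrow> complex) set" where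
  "function_ideal F x = {h. holo_near x h \<and>
    (\<exists>c. (\<forall>f\<in>F. holo_near x (c f)) \<and> (\<forall>\<^sub>F z in nhds x. h z = (\<Sum>f\<in>F. c f z * f z)))}"

locale germ_equations =
  fixes F :: "(complex^'n \<Rightarrow> complex) set" and x :: "complex^'n"
  assumes fin: "finite F" and holo: "\<And>f. f \<in> F \<Longrightarrow> holo_near x f" and zero: "\<And>f. f \<in> F \<Longrightarrow> f x = 0"
begin

lemma function_idealI:
  assumes "\<And>f. f \<in> F \<Longrightarrow> holo_near x (c f)" "\<forall>\<^sub>F z in nhds x. h z = (\<Sum>f\<in>F. c f z * f z)" "holo_near x h"
  shows "h \<in> function_ideal F x"
  using assms unfolding function_ideal_def by blast

lemma function_ideal_holo: "h \<in> function_ideal F x \<Longrightarrow> holo_near x h"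
  by (simp add: function_ideal_def)

lemma function_ideal_zero_at: "h \<in> function_ideal F x \<Longrightarrow> h x = 0"
  by (auto simp: function_ideal_def zero dest!: eventually_nhds_x_imp_x cong: sum.cong)

lemma function_ideal_add:
  assumes "g \<in> function_ideal F x" "h \<in> function_ideal F x"
  shows "(\<lambda>z. g z + h z) \<in> function_ideal F x"
proof -
  obtain c d where c: "\<And>f. f \<in> F \<Longrightarrow> holo_near x (c f)" "\<forall>\<^sub>F z in nhds x. g z = (\<Sum>f\<in>F. c f z * f z)"
    and d: "\<And>f. f \<in> F \<Longrightarrow> holo_near x (d f)" "\<forall>\<^sub>F z in nhds x. h z = (\<Sum>f\<in>F. d f z * f z)"
    using assms unfolding function_ideal_def by blast
  show ?thesis
  proof (rule function_idealI[of "\<lambda>f z. c f z + d f z"])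
    show "\<forall>\<^sub>F z in nhds x. g z + h z = (\<Sum>f\<in>F. (c f z + d f z) * f z)"
      using c(2) d(2) by eventually_elim (simp add: ring_distribs sum.distrib)
  qed (use c d assms in \<open>auto intro: holo_near_add function_ideal_holo\<close>)
qed

lemma function_ideal_mult:
  assumes "holo_near x g" "h \<in> function_ideal F x"
  shows "(\<lambda>z. g z * h z) \<in> function_ideal F x"
proof -
  obtain c where c: "\<And>f. f \<in> F \<Longrightarrow> holo_near x (c f)" "\<forall>\<^sub>F z in nhds x. h z = (\<Sum>f\<in>F. c f z * f z)"
    using assms unfolding function_ideal_def by blast
  show ?thesis
  proof (rule function_idealI[of "\<lambda>f z. g z * c f z"])
    show "\<forall>\<^sub>F z in nhds x. g z * h z = (\<Sum>f\<in>F. g z * c f z * f z)"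
      using c(2) by eventually_elim (simp add: sum_distrib_left mult.assoc)
  qed (use c assms in \<open>auto intro: holo_near_mult function_ideal_holo\<close>)
qed

lemma null_ideal_subset: "null_ideal x \<subseteq> function_ideal F x"
  by (auto simp: null_ideal_def intro!: function_idealI[of "\<lambda>_ _. 0"] holo_near_const)

lemma zero_in_function_ideal: "(\<lambda>_. 0) \<in> function_ideal F x"
  by (rule function_idealI[of "\<lambda>_ _. 0"]) (auto intro: holo_near_const)

lemma generator_in_function_ideal: "f \<in> F \<Longrightarrow> f \<in> function_ideal F x"
proof (rule function_idealI[of "\<lambda>g _. if g = f then 1 else 0"])
  assume "f \<in> F"
  then have "f z = (\<Sum>g\<in>F. (if g = f then 1 else 0) * g z)" for z
    using fin by (simp add: if_distrib[of "\<lambda>a. a * _"] cong: if_cong)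
  then show "\<forall>\<^sub>F z in nhds x. f z = (\<Sum>g\<in>F. (if g = f then 1 else 0) * g z)" by simp
qed (auto intro: holo_near_const holo)

lemma function_ideal_sum:
  "(\<And>a. a \<in> A \<Longrightarrow> h a \<in> function_ideal F x) \<Longrightarrow> (\<lambda>z. \<Sum>a\<in>A. h a z) \<in> function_ideal F x"
  by (induction A rule: infinite_finite_induct) (auto intro: zero_in_function_ideal function_ideal_add)

lemma function_ideal_cong:
  assumes "h \<in> function_ideal F x" "holo_near x g" "\<forall>\<^sub>F z in nhds x. g z = h z"
  shows "g \<in> function_ideal F x"
proof -
  obtain c where c: "\<And>f. f \<in> F \<Longrightarrow> holo_near x (c f)" "\<forall>\<^sub>F z in nhds x. h z = (\<Sum>f\<in>F. c f z * f z)"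
    using assms unfolding function_ideal_def by blast
  have "\<forall>\<^sub>F z in nhds x. g z = (\<Sum>f\<in>F. c f z * f z)"
    using c(2) assms(3) by eventually_elim simp
  then show ?thesis using c assms by (intro function_idealI)
qed

lemma function_ideal_ideal: "ideal (function_ideal F x) (holo_ring x)"
  by (rule holo_ring_idealI)
    (auto intro: function_ideal_holo zero_in_function_ideal function_ideal_add function_ideal_mult)

sublocale H: cring "holo_ring x" by (rule holo_ring_cring)

sublocale N: ideal "null_ideal x" "holo_ring x" by (rule null_ideal_ideal)

sublocale G: cring "germ_ring x"
  unfolding germ_ring_def by (rule N.quotient_is_cring[OF holo_ring_cring])

lemma germ_hom: "germ x \<in> ring_hom (holo_ring x) (germ_ring x)"
  using N.rcos_ring_hom unfolding germ_def[abs_def] germ_ring_def .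

lemma germ_closed: "holo_near x f \<Longrightarrow> germ x f \<in> carrier (germ_ring x)"
  using ring_hom_closed[OF germ_hom] by (simp add: holo_ring_simps)

lemma germ_ring_carrier: "carrier (germ_ring x) = germ x ` Collect (holo_near x)"
  unfolding germ_ring_def FactRing_def germ_def by (auto simp: A_RCOSETS_def' holo_ring_simps)

lemma germ_eq_iff:
  assumes "holo_near x f" "holo_near x g"
  shows "germ x f = germ x g \<longleftrightarrow> (\<lambda>z. f z - g z) \<in> null_ideal x"
proof -
  have "f \<in> null_ideal x +>\<^bsub>holo_ring x\<^esub> g \<longleftrightarrow> f \<oplus>\<^bsub>holo_ring x\<^esub> \<ominus>\<^bsub>holo_ring x\<^esub> g \<in> null_ideal x"
    using assms by (intro N.a_rcos_module) (auto simp: holo_ring_simps)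
  moreover have "f \<oplus>\<^bsub>holo_ring x\<^esub> \<ominus>\<^bsub>holo_ring x\<^esub> g = (\<lambda>z. f z - g z)"
    using assms by (simp add: holo_ring_uminus holo_ring_simps)
  moreover have "germ x f = germ x g \<longleftrightarrow> f \<in> null_ideal x +>\<^bsub>holo_ring x\<^esub> g"
    unfolding germ_def using assms N.a_repr_independence'[of f g] N.a_rcos_self[of f]
    by (auto simp: holo_ring_simps)
  ultimately show ?thesis by simp
qed

text \<open>
  Together with \<open>restr_eq_iff\<close> this reduces all computations in quotient rings to functions.
\<close>

lemma ideal_germ_eq: "ideal_germ F x = germ x ` function_ideal F x"
proof
  have ide: "ideal (germ x ` function_ideal F x) (germ_ring x)"
    using H.ring_ideal_imp_quot_ideal[OF null_ideal_ideal function_ideal_ideal]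
    unfolding germ_def[abs_def] germ_ring_def .
  show "ideal_germ F x \<subseteq> germ x ` function_ideal F x"
    unfolding ideal_germ_def
    by (rule G.genideal_minimal[OF ide]) (auto intro: generator_in_function_ideal)
  have sub: "germ x ` F \<subseteq> carrier (germ_ring x)" using holo germ_closed by auto
  interpret I: ideal "ideal_germ F x" "germ_ring x"
    unfolding ideal_germ_def by (rule G.genideal_ideal[OF sub])
  have gen: "germ x f \<in> ideal_germ F x" if "f \<in> F" for f
    using G.genideal_self[OF sub] that unfolding ideal_germ_def by auto
  show "germ x ` function_ideal F x \<subseteq> ideal_germ F x"
  proof (rule image_subsetI)
    fix h assume h: "h \<in> function_ideal F x"
    then obtain c where c: "\<And>f. f \<in> F \<Longrightarrow> holo_near x (c f)" "\<forall>\<^sub>F z in nhds x. h z = (\<Sum>f\<in>F. c f z * f z)"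
      unfolding function_ideal_def by blast
    have cf: "holo_near x (\<lambda>z. \<Sum>f\<in>A. c f z * f z)" if "A \<subseteq> F" for A
      using that c holo by (intro holo_near_sum holo_near_mult) auto
    have "germ x (\<lambda>z. \<Sum>f\<in>A. c f z * f z) \<in> ideal_germ F x" if "A \<subseteq> F" for A
      using finite_subset[OF that fin] that
    proof (induction A rule: finite_induct)
      case empty
      have "germ x (\<lambda>_. 0) = \<zero>\<^bsub>germ_ring x\<^esub>"
        using ring_hom_zero[OF germ_hom H.ring_axioms G.ring_axioms] by (simp add: holo_ring_simps)
      then show ?case by simp
    next
      case (insert f A)
      have f: "f \<in> F" using insert by auto
      have "germ x (\<lambda>z. c f z * f z) = germ x (c f) \<otimes>\<^bsub>germ_ring x\<^esub> germ x f"
        using ring_hom_mult[OF germ_hom, of "c f" f] c(1)[OF f] holo[OF f] by (simp add: holo_ring_simps)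
      then have "germ x (\<lambda>z. c f z * f z) \<in> ideal_germ F x"
        using I.I_l_closed[OF gen[OF f] germ_closed[OF c(1)[OF f]]] by simp
      moreover have "germ x (\<lambda>z. c f z * f z + (\<Sum>f\<in>A. c f z * f z)) =
          germ x (\<lambda>z. c f z * f z) \<oplus>\<^bsub>germ_ring x\<^esub> germ x (\<lambda>z. \<Sum>f\<in>A. c f z * f z)"
        using ring_hom_add[OF germ_hom, of "\<lambda>z. c f z * f z" "\<lambda>z. \<Sum>f\<in>A. c f z * f z"] c(1)[OF f] holo[OF f]
          cf[of A] insert.prems by (simp add: holo_ring_simps holo_near_mult)
      ultimately show ?case using insert I.a_closed by simp
    qed
    from this[OF order_refl] show "germ x h \<in> ideal_germ F x"
      using germ_eq_iff[OF function_ideal_holo[OF h] cf[OF order_refl]] c(2) function_ideal_holo[OF h] cf[OF order_refl]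
      by (auto simp: null_ideal_def intro: holo_near_minus elim: eventually_mono)
  qed
qed

sublocale I: ideal "ideal_germ F x" "germ_ring x"
  unfolding ideal_germ_def by (rule G.genideal_ideal) (use holo germ_closed in auto)

sublocale R: cring "local_ring F x"
  unfolding local_ring_def by (rule I.quotient_is_cring[OF G.cring_axioms])

lemma restr_hom: "restr F x \<in> ring_hom (holo_ring x) (local_ring F x)"
proof -
  have "restr F x = ((+>\<^bsub>germ_ring x\<^esub>) (ideal_germ F x)) \<circ> germ x" by (auto simp: restr_def fun_eq_iff)
  then show ?thesis using ring_hom_trans[OF germ_hom I.rcos_ring_hom] by (simp add: local_ring_def)
qed

lemma restr_closed [simp]: "holo_near x f \<Longrightarrow> restr F x f \<in> carrier (local_ring F x)"
  using ring_hom_closed[OF restr_hom] by (simp add: holo_ring_simps)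

lemma restr_add: "holo_near x f \<Longrightarrow> holo_near x g \<Longrightarrow>
    restr F x (\<lambda>z. f z + g z) = restr F x f \<oplus>\<^bsub>local_ring F x\<^esub> restr F x g"
  using ring_hom_add[OF restr_hom, of f g] by (simp add: holo_ring_simps)

lemma restr_mult: "holo_near x f \<Longrightarrow> holo_near x g \<Longrightarrow>
    restr F x (\<lambda>z. f z * g z) = restr F x f \<otimes>\<^bsub>local_ring F x\<^esub> restr F x g"
  using ring_hom_mult[OF restr_hom, of f g] by (simp add: holo_ring_simps)

lemma restr_one: "restr F x (\<lambda>_. 1) = \<one>\<^bsub>local_ring F x\<^esub>"
  using ring_hom_one[OF restr_hom] by (simp add: holo_ring_simps)

lemma restr_zero: "restr F x (\<lambda>_. 0) = \<zero>\<^bsub>local_ring F x\<^esub>"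
  using ring_hom_zero[OF restr_hom H.ring_axioms R.ring_axioms] by (simp add: holo_ring_simps)

lemma local_ring_carrier: "carrier (local_ring F x) = restr F x ` Collect (holo_near x)"
proof -
  have "carrier (local_ring F x) = (\<lambda>g. ideal_germ F x +>\<^bsub>germ_ring x\<^esub> g) ` carrier (germ_ring x)"
    unfolding local_ring_def FactRing_def by (auto simp: A_RCOSETS_def')
  then show ?thesis by (auto simp: germ_ring_carrier restr_def)
qed

lemma restr_eq_iff:
  assumes f: "holo_near x f" and g: "holo_near x g"
  shows "restr F x f = restr F x g \<longleftrightarrow> (\<lambda>z. f z - g z) \<in> function_ideal F x"
proof -
  have gf: "germ x f \<in> carrier (germ_ring x)" and gg: "germ x g \<in> carrier (germ_ring x)"
    using assms germ_closed by auto
  have "restr F x f = restr F x g \<longleftrightarrow> germ x f \<in> ideal_germ F x +>\<^bsub>germ_ring x\<^esub> germ x g"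
    unfolding restr_def using I.a_repr_independence'[OF _ gg, of "germ x f"] I.a_rcos_self[OF gf] by auto
  also have "\<dots> \<longleftrightarrow> germ x f \<oplus>\<^bsub>germ_ring x\<^esub> \<ominus>\<^bsub>germ_ring x\<^esub> germ x g \<in> ideal_germ F x"
    by (rule I.a_rcos_module[OF gg gf])
  also have "germ x f \<oplus>\<^bsub>germ_ring x\<^esub> \<ominus>\<^bsub>germ_ring x\<^esub> germ x g = germ x (\<lambda>z. f z - g z)"
  proof -
    have "germ x (\<lambda>z. f z - g z) \<oplus>\<^bsub>germ_ring x\<^esub> germ x g = germ x f"
      using ring_hom_add[OF germ_hom, of "\<lambda>z. f z - g z" g] assms by (simp add: holo_ring_simps holo_near_minus)
    then show ?thesis
      using G.add.inv_solve_right[OF germ_closed[OF holo_near_minus[OF f g]] gf gg] by simp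
  qed
  also have "germ x (\<lambda>z. f z - g z) \<in> ideal_germ F x \<longleftrightarrow> (\<lambda>z. f z - g z) \<in> function_ideal F x"
  proof
    assume "germ x (\<lambda>z. f z - g z) \<in> ideal_germ F x"
    then obtain h where h: "h \<in> function_ideal F x" "germ x (\<lambda>z. f z - g z) = germ x h"
      unfolding ideal_germ_eq by auto
    then have "(\<lambda>z. f z - g z - h z) \<in> null_ideal x"
      using germ_eq_iff[OF holo_near_minus[OF f g] function_ideal_holo[OF h(1)]] by simp
    then have "(\<lambda>z. (f z - g z - h z) + h z) \<in> function_ideal F x"
      using null_ideal_subset h by (intro function_ideal_add) auto
    then show "(\<lambda>z. f z - g z) \<in> function_ideal F x" by simp
  qed (auto simp: ideal_germ_eq)
  finally show ?thesis .
qed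

lemma restr_cong:
  assumes "holo_near x f" "holo_near x g" "\<forall>\<^sub>F z in nhds x. f z = g z"
  shows "restr F x f = restr F x g"
proof -
  have "(\<lambda>z. f z - g z) \<in> null_ideal x"
    using assms by (auto simp: null_ideal_def intro: holo_near_minus elim: eventually_mono)
  then show ?thesis using restr_eq_iff[OF assms(1,2)] null_ideal_subset by auto
qed

lemma restr_eq_zero_iff: "holo_near x f \<Longrightarrow> restr F x f = \<zero>\<^bsub>local_ring F x\<^esub> \<longleftrightarrow> f \<in> function_ideal F x"
  using restr_eq_iff[of f "\<lambda>_. 0"] by (simp add: restr_zero holo_near_const)

lemma restr_sum:
  assumes "finite A" "\<And>a. a \<in> A \<Longrightarrow> holo_near x (f a)"
  shows "restr F x (\<lambda>z. \<Sum>a\<in>A. f a z) = (\<Oplus>\<^bsub>local_ring F x\<^esub>a\<in>A. restr F x (f a))"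
  using assms
proof (induction A rule: finite_induct)
  case (insert a A)
  have "restr F x (\<lambda>z. f a z + (\<Sum>a\<in>A. f a z)) = restr F x (f a) \<oplus>\<^bsub>local_ring F x\<^esub> restr F x (\<lambda>z. \<Sum>a\<in>A. f a z)"
    using insert.prems by (intro restr_add holo_near_sum) auto
  also have "\<dots> = (\<Oplus>\<^bsub>local_ring F x\<^esub>a\<in>insert a A. restr F x (f a))"
    using insert by (subst R.finsum_insert) auto
  finally show ?case using insert.hyps by simp
qed (simp add: restr_zero)

definition value_at :: "(complex^'n \<Rightarrow> complex) set set \<Rightarrow> complex" where
  "value_at a = (SOME f. holo_near x f \<and> a = restr F x f) x"

lemma value_at_restr:
  assumes f: "holo_near x f" shows "value_at (restr F x f) = f x"
proof -
  define g where "g = (SOME g. holo_near x g \<and> restr F x f = restr F x g)"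
  have g: "holo_near x g \<and> restr F x f = restr F x g" unfolding g_def by (rule someI[of _ f]) (simp add: f)
  then have "f x - g x = 0" using restr_eq_iff[OF f, of g] function_ideal_zero_at by blast
  then show ?thesis by (simp add: value_at_def g_def)
qed

sublocale residue_ring "local_ring F x" value_at "\<lambda>c. restr F x (\<lambda>_. c)"
proof
  fix a b assume "a \<in> carrier (local_ring F x)" "b \<in> carrier (local_ring F x)"
  then obtain f g where fg: "a = restr F x f" "b = restr F x g" "holo_near x f" "holo_near x g"
    unfolding local_ring_carrier by auto
  show "value_at (a \<oplus>\<^bsub>local_ring F x\<^esub> b) = value_at a + value_at b"
    using fg by (simp add: restr_add[symmetric] value_at_restr holo_near_add)
  show "value_at (a \<otimes>\<^bsub>local_ring F x\<^esub> b) = value_at a * value_at b"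
    using fg by (simp add: restr_mult[symmetric] value_at_restr holo_near_mult)
next
  show "value_at \<one>\<^bsub>local_ring F x\<^esub> = 1"
    by (simp add: restr_one[symmetric] value_at_restr holo_near_const)
  show "restr F x (\<lambda>_. c) \<in> carrier (local_ring F x)" for c by (simp add: holo_near_const)
  show "value_at (restr F x (\<lambda>_. c)) = c" for c by (simp add: value_at_restr holo_near_const)
next
  fix a assume "a \<in> carrier (local_ring F x)" and v: "value_at a \<noteq> 0"
  then obtain f where f: "a = restr F x f" "holo_near x f" unfolding local_ring_carrier by auto
  have "f x \<noteq> 0" using v f by (simp add: value_at_restr)
  note i = holo_near_inverse[OF f(2) this]
  have "restr F x (\<lambda>z. f z * inverse (f z)) = restr F x (\<lambda>_. 1)"
    by (rule restr_cong) (auto intro: holo_near_mult holo_near_const f i)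
  then have "a \<otimes>\<^bsub>local_ring F x\<^esub> restr F x (\<lambda>z. inverse (f z)) = \<one>\<^bsub>local_ring F x\<^esub>"
    using restr_mult[OF f(2) i(1)] by (simp add: f restr_one)
  then show "a \<in> Units (local_ring F x)"
    using f i R.m_comm[of a "restr F x (\<lambda>z. inverse (f z))"] by (auto simp: Units_def)
qed

end

section \<open>The embedding dimension\<close>

lemma (in residue_ring) residue_kernel_ideal: "ideal {a \<in> carrier R. ev a = 0} R" (is "ideal ?m R")
proof (rule idealI)
  show "subgroup ?m (add_monoid R)"
  proof (rule add.subgroupI)
    show "\<ominus> a \<in> ?m" if "a \<in> ?m" for a
      using that ev_minus[of \<zero> a] by (simp add: minus_eq ev_zero)
  qed (auto simp: ev_add ev_zero intro!: exI[of _ \<zero>])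
qed (auto simp: ev_mult ring_axioms)

text \<open>
  Elements with non-zero residue are units, so every proper ideal lies in the kernel of the residue
  map.
\<close>

lemma (in residue_ring) max_ideal_eq: "max_ideal R = {a \<in> carrier R. ev a = 0}"
proof -
  let ?m = "{a \<in> carrier R. ev a = 0}"
  note m = residue_kernel_ideal
  have all: "J = carrier R" if J: "ideal J R" "a \<in> J" "ev a \<noteq> 0" for J a
  proof -
    interpret J: ideal J R by (rule J)
    have a: "a \<in> carrier R" using J by auto
    then have "inv a \<otimes> a \<in> J" using J ev_unit[OF a] by (intro J.I_l_closed) auto
    then have "\<one> \<in> J" using ev_unit[OF a J(3)] by simp
    then show ?thesis by (rule J.one_imp_carrier)
  qed
  have ne: "\<one> \<notin> ?m" by (simp add: ev_one)
  have "maximalideal ?m R"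
  proof (rule maximalidealI[OF m])
    show "carrier R \<noteq> ?m" using ne by auto
    show "J = ?m \<or> J = carrier R" if "ideal J R" "?m \<subseteq> J" "J \<subseteq> carrier R" for J
      using that all[OF that(1)] by blast
  qed
  moreover have "J = ?m" if J: "maximalideal J R" for J
  proof -
    have i: "ideal J R" "carrier R \<noteq> J" using J by (auto simp: maximalideal_def maximalideal_axioms_def)
    have "J \<subseteq> carrier R" using i(1) by (simp add: additive_subgroup.a_subset ideal.axioms(1))
    then have "J \<subseteq> ?m" using all[OF i(1)] i(2) by blast
    then have "?m = J \<or> ?m = carrier R"
      using J m by (intro maximalideal.I_maximal) auto
    then show ?thesis using ne by auto
  qed
  ultimately show ?thesis unfolding max_ideal_def by (rule the_equality)
qed

lemma complex_field_simps:
  "carrier complex_field = UNIV" "a \<otimes>\<^bsub>complex_field\<^esub> b = a * b" "a \<oplus>\<^bsub>complex_field\<^esub> b = a + b"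
  "\<one>\<^bsub>complex_field\<^esub> = 1" "\<zero>\<^bsub>complex_field\<^esub> = 0"
  by (auto simp: complex_field_def)

lemma complex_field_cring: "cring complex_field"
proof (rule cringI)
  show "abelian_group complex_field"
  proof (rule abelian_groupI, goal_cases)
    case (6 a) then show ?case by (intro bexI[of _ "- a"]) (auto simp: complex_field_simps)
  qed (auto simp: complex_field_simps)
  show "comm_monoid complex_field" by (rule comm_monoidI) (auto simp: complex_field_simps)
qed (auto simp: complex_field_simps algebra_simps)

text \<open>
  Preimages of basis elements under a linear surjection are linearly independent. The source of
  \<open>L\<close> is the space of vectors supported in \<open>T\<close>, of dimension \<open>card T\<close>.
\<close>

lemma card_basis_le_if_surjective:
  fixes L :: "complex^'n \<Rightarrow> 'q"
  assumes Q: "module complex_field Q" and basis: "module_basis complex_field Q B" and B: "finite B"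
    and L: "\<And>v. (\<And>i. i \<notin> T \<Longrightarrow> v $ i = 0) \<Longrightarrow> L v \<in> carrier Q"
    and surj: "\<And>q. q \<in> carrier Q \<Longrightarrow> \<exists>v. (\<forall>i. i \<notin> T \<longrightarrow> v $ i = 0) \<and> L v = q"
    and add: "\<And>v w. (\<And>i. i \<notin> T \<Longrightarrow> v $ i = 0) \<Longrightarrow> (\<And>i. i \<notin> T \<Longrightarrow> w $ i = 0) \<Longrightarrow> L (v + w) = L v \<oplus>\<^bsub>Q\<^esub> L w"
    and smult: "\<And>c v. (\<And>i. i \<notin> T \<Longrightarrow> v $ i = 0) \<Longrightarrow> L (c *s v) = c \<odot>\<^bsub>Q\<^esub> L v"
  shows "card B \<le> card T"
proof -
  interpret Q: module complex_field Q by (rule Q)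
  have BQ: "B \<subseteq> carrier Q" using basis by (simp add: module_basis_def)
  have "\<forall>b\<in>B. \<exists>v. (\<forall>i. i \<notin> T \<longrightarrow> v $ i = 0) \<and> L v = b" using surj BQ by blast
  then obtain r where r: "\<And>b i. b \<in> B \<Longrightarrow> i \<notin> T \<Longrightarrow> r b $ i = 0" and Lr: "\<And>b. b \<in> B \<Longrightarrow> L (r b) = b"
    by (metis (no_types, lifting) bchoice)
  have inj: "inj_on r B" using Lr by (rule inj_on_inverseI)
  have L0: "L 0 = \<zero>\<^bsub>Q\<^esub>"
    using smult[of 0 0] Q.smult_l_null[OF L[of 0]] by (simp add: complex_field_simps)
  have sumL: "L (\<Sum>b\<in>X. u b *s r b) = (\<Oplus>\<^bsub>Q\<^esub>b\<in>X. u b \<odot>\<^bsub>Q\<^esub> b)" if "X \<subseteq> B" for u X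
    using finite_subset[OF that B] that
  proof (induction X rule: finite_induct)
    case (insert b X)
    have "L (u b *s r b + (\<Sum>b\<in>X. u b *s r b)) = L (u b *s r b) \<oplus>\<^bsub>Q\<^esub> L (\<Sum>b\<in>X. u b *s r b)"
      using insert.prems r by (intro add) (auto intro!: sum.neutral)
    also have "\<dots> = u b \<odot>\<^bsub>Q\<^esub> b \<oplus>\<^bsub>Q\<^esub> (\<Oplus>\<^bsub>Q\<^esub>b\<in>X. u b \<odot>\<^bsub>Q\<^esub> b)"
      using insert r Lr by (simp add: smult)
    also have "\<dots> = (\<Oplus>\<^bsub>Q\<^esub>b\<in>insert b X. u b \<odot>\<^bsub>Q\<^esub> b)"
      using insert BQ by (subst Q.M.finsum_insert) (auto simp: complex_field_simps)
    finally show ?case using insert.hyps by simp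
  qed (simp add: L0)
  have "vec.independent (r ` B)"
  proof
    assume "vec.dependent (r ` B)"
    then obtain u v where uv: "v \<in> r ` B" "u v \<noteq> 0" "(\<Sum>v\<in>r ` B. u v *s v) = 0"
      using vec.dependent_finite[of "r ` B"] B by auto
    define c where "c b = (if b \<in> B then u (r b) else 0)" for b
    have c: "c \<in> carrier (free_mod complex_field B)"
      using B by (auto simp: free_mod_def complex_field_simps c_def)
    have "(\<Sum>b\<in>B. c b *s r b) = 0"
      using uv(3) by (simp add: sum.reindex[OF inj] c_def)
    then have "\<zero>\<^bsub>Q\<^esub> = (\<Oplus>\<^bsub>Q\<^esub>b\<in>B. c b \<odot>\<^bsub>Q\<^esub> b)" using sumL[of B c] L0 by simp
    also have "\<dots> = lincomb complex_field Q c (\<lambda>b. b)"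
      using B BQ by (intro Q.lincomb_superset[OF c, symmetric]) (auto simp: c_def complex_field_simps split: if_splits)
    finally have 1: "\<zero>\<^bsub>Q\<^esub> = (\<Oplus>\<^bsub>Q\<^esub>b\<in>{b. c b \<noteq> \<zero>\<^bsub>complex_field\<^esub>}. c b \<odot>\<^bsub>Q\<^esub> b)"
      by (simp add: lincomb_def)
    have z: "(\<lambda>_. 0) \<in> carrier (free_mod complex_field B)"
      by (auto simp: free_mod_def complex_field_simps)
    have 2: "\<zero>\<^bsub>Q\<^esub> = (\<Oplus>\<^bsub>Q\<^esub>b\<in>{b. (\<lambda>_. 0) b \<noteq> \<zero>\<^bsub>complex_field\<^esub>}. (\<lambda>_. 0) b \<odot>\<^bsub>Q\<^esub> b)"
      by (simp add: complex_field_simps)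
    define zero_comb where "zero_comb c \<longleftrightarrow> c \<in> carrier (free_mod complex_field B) \<and>
        \<zero>\<^bsub>Q\<^esub> = (\<Oplus>\<^bsub>Q\<^esub>b\<in>{b. c b \<noteq> \<zero>\<^bsub>complex_field\<^esub>}. c b \<odot>\<^bsub>Q\<^esub> b)" for c
    have "\<exists>!c. zero_comb c"
      using basis Q.M.zero_closed unfolding module_basis_def zero_comb_def by (elim conjE) (erule bspec)
    moreover have "zero_comb c" "zero_comb (\<lambda>_. 0)"
      unfolding zero_comb_def by (rule conjI[OF c 1], rule conjI[OF z 2])
    ultimately have "c = (\<lambda>_. 0)" by blast
    then show False using uv by (auto simp: c_def fun_eq_iff split: if_splits)
  qed
  moreover have "r ` B \<subseteq> vec.span ((\<lambda>i. axis i 1) ` T)"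
  proof (rule image_subsetI)
    fix b assume b: "b \<in> B"
    have "r b = (\<Sum>i\<in>UNIV. r b $ i *s axis i 1)" by (simp add: basis_expansion)
    also have "\<dots> = (\<Sum>i\<in>T. r b $ i *s axis i 1)"
      using r[OF b] by (intro sum.mono_neutral_right) auto
    also have "\<dots> \<in> vec.span ((\<lambda>i. axis i 1) ` T)"
      by (intro vec.span_sum vec.span_scale vec.span_base) auto
    finally show "r b \<in> vec.span ((\<lambda>i. axis i 1) ` T)" .
  qed
  ultimately have "card (r ` B) \<le> card ((\<lambda>i. axis i (1::complex)) ` T :: (complex^'n) set)"
    using vec.independent_span_bound by (metis finite finite_imageI)
  also have "\<dots> \<le> card T" by (rule card_image_le) simp
  finally show ?thesis by (simp add: card_image[OF inj])
qed

context germ_equations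
begin

text \<open>
  If the \<open>\<Phi> k\<close> generate the maximal ideal, then their classes span the cotangent space: in
  \<open>\<Sum>k. h k * \<Phi> k\<close> each \<open>h k\<close> may be replaced by its value at \<open>x\<close>, because
  \<open>(h k - h k x) * \<Phi> k\<close> lies in the square of the maximal ideal.
\<close>

lemma embdim_le_if_generated:
  assumes e: "has_embdim F x e"
    and \<Phi>: "\<And>k. k \<in> T \<Longrightarrow> holo_near x (\<Phi> k)" "\<And>k. k \<in> T \<Longrightarrow> \<Phi> k x = 0"
    and gen: "\<And>f. holo_near x f \<Longrightarrow> f x = 0 \<Longrightarrow>
      \<exists>h. (\<forall>k\<in>T. holo_near x (h k)) \<and> (\<lambda>z. f z - (\<Sum>k\<in>T. h k z * \<Phi> k z)) \<in> function_ideal F x"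
  shows "e \<le> card (T :: 'n set)"
proof -
  let ?R = "local_ring F x" and ?c = "\<lambda>c. restr F x (\<lambda>_. c)"
  define m where "m = max_ideal ?R"
  define V :: "(complex, (complex^'n \<Rightarrow> complex) set set) module" where "V = \<lparr>carrier = m, mult = undefined, one = undefined, zero = \<zero>\<^bsub>?R\<^esub>, add = add ?R,
         smult = (\<lambda>c a. ?c c \<otimes>\<^bsub>?R\<^esub> a)\<rparr>"
  define P where "P = ideal_prod ?R m m"
  have m: "a \<in> m \<longleftrightarrow> a \<in> carrier ?R \<and> value_at a = 0" for a by (simp add: m_def max_ideal_eq)
  have mideal: "ideal m ?R" unfolding m_def max_ideal_eq by (rule residue_kernel_ideal)
  interpret m: ideal m ?R by (rule mideal)
  interpret P: ideal P ?R unfolding P_def by (rule R.ideal_prod_is_ideal[OF mideal mideal])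
  have Pm: "P \<subseteq> m" unfolding P_def using R.ideal_prod_inter[OF mideal mideal] by blast
  have Pmult: "a \<otimes>\<^bsub>?R\<^esub> b \<in> P" if "a \<in> m" "b \<in> m" for a b
    unfolding P_def using that by (rule ideal_prod.prod)
  have V[simp]: "carrier V = m" "zero V = \<zero>\<^bsub>?R\<^esub>" "add V = add ?R" "smult V = (\<lambda>c a. ?c c \<otimes>\<^bsub>?R\<^esub> a)"
    by (auto simp: V_def)
  have mc: "a \<in> m \<Longrightarrow> a \<in> carrier ?R" for a by (simp add: m)
  have cadd: "?c (a + b) = ?c a \<oplus>\<^bsub>?R\<^esub> ?c b" and cmult: "?c (a * b) = ?c a \<otimes>\<^bsub>?R\<^esub> ?c b" for a b
    using restr_add[of "\<lambda>_. a" "\<lambda>_. b"] restr_mult[of "\<lambda>_. a" "\<lambda>_. b"] by (auto simp: holo_near_const)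
  interpret V: module complex_field V
  proof (rule moduleI[OF complex_field_cring])
    show "abelian_group V"
    proof (rule abelian_groupI, goal_cases)
      case (6 a)
      then show ?case by (intro bexI[of _ "\<ominus>\<^bsub>?R\<^esub> a"]) (auto simp: mc R.l_neg)
    qed (auto simp: mc R.a_ac)
  qed (auto simp: complex_field_simps mc cadd cmult R.l_distr R.r_distr R.m_assoc restr_one m.I_l_closed)
  have PV: "submodule P complex_field V"
  proof (rule V.submoduleI)
    fix a assume a: "a \<in> P"
    have "\<ominus>\<^bsub>V\<^esub> a = \<ominus>\<^bsub>?R\<^esub> a"
      using a Pm mc by (intro V.M.minus_equality) (auto simp: R.l_neg)
    then show "\<ominus>\<^bsub>V\<^esub> a \<in> P" using a by simp
  qed (use Pm in \<open>auto intro: P.I_l_closed\<close>)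
  define Q where "Q = quot_mod V P"
  have Q: "module complex_field Q" unfolding Q_def by (rule V.quot_mod_module[OF PV])
  have Qe: "has_dim complex_field Q e"
    using e by (simp add: has_embdim_def cotangent_space_def Let_def Q_def V_def P_def m_def)
  then obtain B where B: "module_basis complex_field Q B" "finite B" "card B = e"
    unfolding has_dim_def by blast
  define \<Lambda> where "\<Lambda> v z = (\<Sum>k\<in>T. v $ k * \<Phi> k z)" for v :: "complex^'n" and z
  have \<Lambda>h: "holo_near x (\<Lambda> v)" for v
    unfolding \<Lambda>_def[abs_def] by (intro holo_near_sum holo_near_mult holo_near_const \<Phi>)
  have \<Lambda>0: "\<Lambda> v x = 0" for v unfolding \<Lambda>_def using \<Phi> by (intro sum.neutral) auto
  have rm: "restr F x f \<in> m" if "holo_near x f" "f x = 0" for f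
    using that by (simp add: m value_at_restr)
  define L where "L v = P +>\<^bsub>V\<^esub> restr F x (\<Lambda> v)" for v
  have "card B \<le> card T"
  proof (rule card_basis_le_if_surjective[OF Q B(1,2), of T L])
    show "L v \<in> carrier Q" for v
      unfolding L_def Q_def V.quot_mod_carrier using rm[OF \<Lambda>h \<Lambda>0] by auto
    show "L (v + w) = L v \<oplus>\<^bsub>Q\<^esub> L w" for v w
    proof -
      have "restr F x (\<Lambda> (v + w)) = restr F x (\<Lambda> v) \<oplus>\<^bsub>?R\<^esub> restr F x (\<Lambda> w)"
        unfolding restr_add[OF \<Lambda>h \<Lambda>h, symmetric] by (simp add: \<Lambda>_def[abs_def] ring_distribs sum.distrib)
      then show ?thesis
        unfolding L_def Q_def using V.quot_mod_add[OF PV, of "restr F x (\<Lambda> v)" "restr F x (\<Lambda> w)"] rm[OF \<Lambda>h \<Lambda>0] by simp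
    qed
    show "L (c *s v) = c \<odot>\<^bsub>Q\<^esub> L v" for c v
    proof -
      have "restr F x (\<Lambda> (c *s v)) = ?c c \<otimes>\<^bsub>?R\<^esub> restr F x (\<Lambda> v)"
        unfolding restr_mult[OF holo_near_const \<Lambda>h, symmetric] by (simp add: \<Lambda>_def[abs_def] sum_distrib_left mult.assoc)
      then show ?thesis
        unfolding L_def Q_def using V.quot_mod_smult[OF PV, of c "restr F x (\<Lambda> v)"] rm[OF \<Lambda>h \<Lambda>0]
        by (simp add: complex_field_simps)
    qed
    fix q assume "q \<in> carrier Q"
    then obtain a where a: "a \<in> m" "q = P +>\<^bsub>V\<^esub> a" unfolding Q_def V.quot_mod_carrier by auto
    then obtain f where f: "holo_near x f" "a = restr F x f" "f x = 0"
      using value_at_restr by (auto simp: m local_ring_carrier)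
    obtain h where h: "\<And>k. k \<in> T \<Longrightarrow> holo_near x (h k)"
      and I: "(\<lambda>z. f z - (\<Sum>k\<in>T. h k z * \<Phi> k z)) \<in> function_ideal F x"
      using gen[OF f(1,3)] by blast
    define v where "v = (\<chi> k. if k \<in> T then h k x else 0)"
    have hh: "holo_near x (\<lambda>z. h k z - h k x)" if "k \<in> T" for k
      using h[OF that] by (intro holo_near_minus holo_near_const)
    \<comment> \<open>the part of \<open>f\<close> in the square of the maximal ideal\<close>
    define w where "w z = (\<Sum>k\<in>T. (h k z - h k x) * \<Phi> k z)" for z
    have wh: "holo_near x w" unfolding w_def[abs_def] by (intro holo_near_sum holo_near_mult \<Phi> hh)
    have Psum: "(\<Oplus>\<^bsub>?R\<^esub>k\<in>X. g k) \<in> P" if "finite X" "\<And>k. k \<in> X \<Longrightarrow> g k \<in> P" for X :: "'n set" and g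
      using that by (induction X rule: finite_induct) auto
    have "restr F x w = (\<Oplus>\<^bsub>?R\<^esub>k\<in>T. restr F x (\<lambda>z. (h k z - h k x) * \<Phi> k z))"
      unfolding w_def[abs_def] by (intro restr_sum holo_near_mult \<Phi> hh) auto
    moreover have "restr F x (\<lambda>z. (h k z - h k x) * \<Phi> k z) \<in> P" if "k \<in> T" for k
      unfolding restr_mult[OF hh[OF that] \<Phi>(1)[OF that]]
      using that by (intro Pmult rm hh \<Phi>) auto
    ultimately have wP: "restr F x w \<in> P"
      using Psum by simp
    have "restr F x f = restr F x (\<lambda>z. w z + \<Lambda> v z)"
    proof -
      have "(\<lambda>z. f z - (w z + \<Lambda> v z)) = (\<lambda>z. f z - (\<Sum>k\<in>T. h k z * \<Phi> k z))"
        by (auto simp: w_def \<Lambda>_def v_def sum.distrib[symmetric] algebra_simps intro!: sum.cong)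
      then show ?thesis using I restr_eq_iff[OF f(1) holo_near_add[OF wh \<Lambda>h]] by simp
    qed
    then have fw: "a = restr F x w \<oplus>\<^bsub>?R\<^esub> restr F x (\<Lambda> v)"
      using restr_add[OF wh \<Lambda>h] f by simp
    have "q = P +>\<^bsub>V\<^esub> (restr F x w \<oplus>\<^bsub>V\<^esub> restr F x (\<Lambda> v))" by (simp add: a(2) fw)
    also have "\<dots> = (P +>\<^bsub>V\<^esub> restr F x w) \<oplus>\<^bsub>Q\<^esub> (P +>\<^bsub>V\<^esub> restr F x (\<Lambda> v))"
      unfolding Q_def using wP Pm rm[OF \<Lambda>h \<Lambda>0] by (intro V.quot_mod_add[OF PV, symmetric]) auto
    also have "P +>\<^bsub>V\<^esub> restr F x w = \<zero>\<^bsub>Q\<^esub>"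
      unfolding Q_def V.quot_mod_zero using V.coset_eq_zero_iff[OF PV, of "restr F x w"] wP Pm by auto
    also have "\<zero>\<^bsub>Q\<^esub> \<oplus>\<^bsub>Q\<^esub> (P +>\<^bsub>V\<^esub> restr F x (\<Lambda> v)) = L v"
    proof -
      interpret Q: module complex_field Q by (rule Q)
      have "L v \<in> carrier Q" unfolding L_def Q_def V.quot_mod_carrier using rm[OF \<Lambda>h \<Lambda>0] by auto
      then show ?thesis by (simp add: L_def)
    qed
    finally show "\<exists>v. (\<forall>i. i \<notin> T \<longrightarrow> v $ i = 0) \<and> L v = q"
      by (intro exI[of _ v]) (auto simp: v_def)
  qed
  then show ?thesis using B by simp
qed

end

section \<open>Coordinates adapted to a germ\<close>

text \<open>
  A maximal independent subset of \<open>G\<close> is completed to a basis by coordinate axes. \<open>T\<close> is the set of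
  these axes; the other indices are matched with the chosen elements of \<open>G\<close>.
\<close>

lemma extend_rows_to_invertible:
  fixes G :: "('a::field^'n) set"
  obtains T \<beta> where "\<And>s. s \<notin> T \<Longrightarrow> \<beta> s \<in> G" "G \<subseteq> vec.span (\<beta> ` (- T))"
    "invertible (\<chi> j. if j \<in> T then axis j 1 else \<beta> j)"
proof -
  obtain B where B: "B \<subseteq> G" "vec.independent B" "G \<subseteq> vec.span B"
    using vec.maximal_independent_subset by blast
  obtain B' where B': "B \<subseteq> B'" "B' \<subseteq> B \<union> cart_basis" "vec.independent B'" "B \<union> cart_basis \<subseteq> vec.span B'"
    using vec.maximal_independent_subset_extend[of B "B \<union> cart_basis"] B by auto
  have "vec.span cart_basis \<subseteq> vec.span B'"
    using B'(4) by (intro vec.span_minimal) (auto simp: vec.subspace_span)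
  then have span: "vec.span B' = UNIV" using vec.span_Basis by auto
  have finB': "finite B'" using B'(3) vec.finiteI_independent by blast
  have "card B' = vec.dim (UNIV :: ('a^'n) set)"
    using B'(3) span by (intro vec.basis_card_eq_dim) auto
  then have card: "card B' = CARD('n)" by (simp add: vec.dim_UNIV card_cart_basis vec_dim_card)
  define T where "T = {i. axis i 1 \<in> B' - B}"
  have inj: "inj (\<lambda>i. axis i (1::'a) :: 'a^'n)" by (auto simp: inj_def axis_eq_axis)
  have B'T: "B' - B = (\<lambda>i. axis i 1) ` T" using B'(2) by (auto simp: T_def cart_basis_def)
  have "card (B' - B) = card T" unfolding B'T by (rule card_image) (rule inj_on_subset[OF inj], simp)
  then have "card B + card T = CARD('n)"
    using card B'(1) finB' by (metis card_Diff_subset card_mono finite_subset le_add_diff_inverse)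
  then have "card (- T) = card B" by (simp add: Compl_eq_Diff_UNIV card_Diff_subset)
  then obtain \<beta> where \<beta>: "bij_betw \<beta> (- T) B"
    using finite_same_card_bij[of "- T" B] B'(1) finB' finite_subset by (metis finite)
  define f where "f j = (if j \<in> T then axis j 1 else \<beta> j)" for j
  have f_img: "f ` UNIV = B'"
  proof -
    have "f ` UNIV = f ` T \<union> f ` (- T)" by (metis Compl_partition image_Un)
    also have "f ` T = B' - B" unfolding B'T by (auto simp: f_def)
    also have "f ` (- T) = B" using \<beta> by (auto simp: f_def bij_betw_def)
    finally show ?thesis using B'(1) by auto
  qed
  then have injf: "inj f" using card by (intro eq_card_imp_inj_on) auto
  have "c i = 0" if c: "(\<Sum>i\<in>UNIV. c i *s f i) = 0" for c i
  proof -
    define u where "u v = c (inv_into UNIV f v)" for v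
    have u: "u (f i) = c i" for i using injf by (simp add: u_def)
    have sum: "(\<Sum>v\<in>B'. u v *s v) = 0"
      unfolding f_img[symmetric] using c by (simp add: sum.reindex[OF injf] u)
    have "u v = 0" if "v \<in> B'" for v
    proof (rule ccontr)
      assume "u v \<noteq> 0"
      then have "vec.dependent B'"
        unfolding vec.dependent_finite[OF finB'] using that sum by (intro exI[of _ u]) blast
      then show False using B'(3) by simp
    qed
    then have "u (f i) = 0" using f_img by blast
    then show ?thesis by (simp add: u)
  qed
  then have "\<exists>A. (\<chi> j. f j) ** A = mat 1"
    unfolding matrix_right_invertible_independent_rows by (auto simp: row_def)
  then have inv: "invertible (\<chi> j. f j)" by (simp add: invertible_right_inverse)
  show ?thesis
  proof (rule that[of T \<beta>])
    show "\<beta> s \<in> G" if "s \<notin> T" for s using that \<beta> B(1) by (auto simp: bij_betw_def)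
    show "G \<subseteq> vec.span (\<beta> ` (- T))" using B(3) \<beta> by (simp add: bij_betw_def)
    show "invertible (\<chi> j. if j \<in> T then axis j 1 else \<beta> j)" using inv by (simp add: f_def)
  qed
qed

lemma holo_near_compose:
  assumes \<phi>: "\<And>j. (\<lambda>z. \<phi> z $ j) holo_on V" and y: "y \<in> V" and f: "holo_near (\<phi> y) f"
  shows "holo_near y (\<lambda>z. f (\<phi> z))"
proof -
  obtain U where U: "\<phi> y \<in> U" "f holo_on U" using f unfolding holo_near_def by blast
  have V: "open V" using \<phi> by (rule holo_on_open)
  have "continuous_on V (\<lambda>z. \<chi> j. \<phi> z $ j)"
    by (intro continuous_on_vec_lambda holo_on_continuous \<phi>)
  then have "continuous_on V \<phi>" by simp
  then have o: "open (\<phi> -` U \<inter> V)"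
    using continuous_on_open_vimage[OF V, of \<phi>] holo_on_open[OF U(2)] by auto
  have "(\<lambda>z. f (\<phi> z)) holo_on (\<phi> -` U \<inter> V)"
    by (rule holo_on_compose[OF U(2) holo_on_subset[OF \<phi> o]]) auto
  then show ?thesis
    unfolding holo_near_def using U(1) y by (intro exI[of _ "\<phi> -` U \<inter> V"]) simp
qed

text \<open>
  \<open>\<Phi>\<close> is a chart centred at \<open>x\<close> with inverse \<open>\<psi>\<close>. The coordinates outside \<open>T\<close> are equations of the
  germ, as many as there are equations with independent differentials at \<open>x\<close>; therefore the
  differentials at \<open>x\<close> of all equations vanish in the directions in \<open>T\<close>, which span the Zariski
  tangent space.
\<close>

locale adapted_coordinates = germ_equations F x for F and x :: "complex^'n" +
  fixes T :: "'n set" and \<Phi> \<psi> :: "complex^'n \<Rightarrow> complex^'n" and W V :: "(complex^'n) set"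
  assumes W: "open W" "x \<in> W" and V: "open V" and homeo: "homeomorphism W V \<Phi> \<psi>" and \<Phi>x: "\<Phi> x = 0"
    and \<Phi>_holo: "\<And>j. (\<lambda>z. \<Phi> z $ j) holo_on W" and \<psi>_holo: "\<And>j. (\<lambda>y. \<psi> y $ j) holo_on V"
    and \<Phi>_T: "\<And>k z. k \<in> T \<Longrightarrow> \<Phi> z $ k = z $ k - x $ k"
    and \<Phi>_S: "\<And>s. s \<notin> T \<Longrightarrow> (\<lambda>z. \<Phi> z $ s) \<in> F"
    and tangent: "\<And>f k. f \<in> F \<Longrightarrow> k \<in> T \<Longrightarrow> partial k (\<lambda>y. f (\<psi> y)) 0 = 0"

text \<open>
  The equations are chosen with gradients forming a maximal independent set, and the inverse function
  theorem applies because axes complete these gradients to an invertible Jacobian.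
\<close>

lemma adapted_coordinates_exist:
  fixes x :: "complex^'n"
  assumes X: "local_model U F x"
  obtains T \<Phi> \<psi> W V where "adapted_coordinates F x T \<Phi> \<psi> W V"
proof -
  have U: "open U" "x \<in> U" and fin: "finite F" and F: "\<And>f. f \<in> F \<Longrightarrow> f holo_on U" "\<And>f. f \<in> F \<Longrightarrow> f x = 0"
    using X by (auto simp: local_model_def)
  define grad where "grad f = (\<chi> i. partial i f x)" for f :: "complex^'n \<Rightarrow> complex"
  obtain T \<beta> where \<beta>: "\<And>s. s \<notin> T \<Longrightarrow> \<beta> s \<in> grad ` F" and span: "grad ` F \<subseteq> vec.span (\<beta> ` (- T))"
    and inv: "invertible (\<chi> j. if j \<in> T then axis j 1 else \<beta> j)"
    using extend_rows_to_invertible[of "grad ` F"] by blast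
  have "\<forall>s\<in>-T. \<exists>f. f \<in> F \<and> grad f = \<beta> s" using \<beta> by fastforce
  from bchoice[OF this] obtain \<sigma> where "\<forall>s\<in>-T. \<sigma> s \<in> F \<and> grad (\<sigma> s) = \<beta> s" by (rule exE)
  then have \<sigma>: "\<And>s. s \<notin> T \<Longrightarrow> \<sigma> s \<in> F" "\<And>s. s \<notin> T \<Longrightarrow> grad (\<sigma> s) = \<beta> s" by auto
  define \<Phi> where "\<Phi> z = (\<chi> j. if j \<in> T then z $ j - x $ j else \<sigma> j z)" for z
  have \<Phi>j: "(\<lambda>z. \<Phi> z $ j) = (if j \<in> T then (\<lambda>z. z $ j - x $ j) else \<sigma> j)" for j
    by (auto simp: \<Phi>_def)
  have \<Phi>h: "(\<lambda>z. \<Phi> z $ j) holo_on U" for j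
    unfolding \<Phi>j using U \<sigma>(1) F(1) by (auto intro!: holo_on_minus holo_on_coordinate holo_on_const)
  have part_T: "partial i (\<lambda>z. z $ j - c) z = (if i = j then 1 else 0)" for i j :: 'n and c and z :: "complex^'n"
    using partial_unique[OF has_derivative_coordinate[of j "- c" z]] by simp
  have "(\<chi> j i. partial i (\<lambda>z. \<Phi> z $ j) x) = (\<chi> j. if j \<in> T then axis j 1 else \<beta> j)"
    unfolding \<Phi>j using \<sigma>(2) by (auto simp: vec_eq_iff part_T axis_def grad_def)
  then have "invertible (\<chi> j i. partial i (\<lambda>z. \<Phi> z $ j) x)" using inv by simp
  from holomorphic_inverse[OF \<Phi>h U(2) this]
  obtain W V \<psi> where WV: "open W" "W \<subseteq> U" "x \<in> W" "open V" "\<Phi> x \<in> V" "homeomorphism W V \<Phi> \<psi>"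
    and \<psi>h: "\<And>j. (\<lambda>y. \<psi> y $ j) holo_on V" by blast
  have \<Phi>x: "\<Phi> x = 0" using F(2) \<sigma>(1) by (auto simp: \<Phi>_def vec_eq_iff)
  have V0: "0 \<in> V" using WV \<Phi>x by simp
  have \<psi>0: "\<psi> 0 = x" using homeomorphism_apply1[OF WV(6,3)] \<Phi>x by simp
  have \<psi>W: "\<psi> y \<in> W" if "y \<in> V" for y
    using homeomorphism_image2[OF WV(6)] that by auto
  have tangent: "partial k (\<lambda>y. f (\<psi> y)) 0 = 0" if f: "f \<in> F" and k: "k \<in> T" for f k
  proof -
    \<comment> \<open>the derivative in direction \<open>k\<close> as a function of the gradient: it vanishes on the chosen gradients, hence on their span\<close>
    define l where "l u = (\<Sum>i\<in>UNIV. u $ i * partial k (\<lambda>y. \<psi> y $ i) 0)" for u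
    have l: "partial k (\<lambda>y. g (\<psi> y)) 0 = l (grad g)" if "g holo_on U" for g
      using partial_compose[OF that \<psi>h V0, of k] U \<psi>0 by (simp add: l_def grad_def)
    have "l (\<beta> s) = 0" if s: "s \<notin> T" for s
    proof -
      have "l (\<beta> s) = partial k (\<lambda>y. \<sigma> s (\<psi> y)) 0" using l[OF F(1)] \<sigma> s by simp
      also have "\<dots> = partial k (\<lambda>y. y $ s - 0) 0"
      proof (rule partial_unique[symmetric, OF has_derivative_transform_within_open])
        show "((\<lambda>y. \<sigma> s (\<psi> y)) has_derivative (\<lambda>v. \<Sum>i\<in>UNIV. v $ i * partial i (\<lambda>y. \<sigma> s (\<psi> y)) 0)) (at 0)"
          by (rule holo_on_has_derivative[OF holo_on_compose[OF F(1)[OF \<sigma>(1)[OF s]] \<psi>h] V0]) (use \<psi>W WV in auto)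
        show "\<sigma> s (\<psi> y) = y $ s - 0" if "y \<in> V" for y
        proof -
          have "\<sigma> s (\<psi> y) = \<Phi> (\<psi> y) $ s" using s by (simp add: \<Phi>_def)
          then show ?thesis using homeomorphism_apply2[OF WV(6) that] by simp
        qed
      qed (use WV V0 in auto)
      also have "\<dots> = 0" using part_T[of k s 0] s k by auto
      finally show ?thesis .
    qed
    moreover have "vec.subspace {u. l u = 0}"
      by (auto simp: vec.subspace_def l_def ring_distribs sum.distrib mult.assoc sum_distrib_left[symmetric])
    ultimately have "vec.span (\<beta> ` (- T)) \<subseteq> {u. l u = 0}"
      by (intro vec.span_minimal) auto
    then have "l (grad f) = 0" using span f by auto
    then show ?thesis using l[OF F(1)[OF f]] by simp
  qed
  have "adapted_coordinates F x T \<Phi> \<psi> W V"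
  proof
    show "holo_near x f" if "f \<in> F" for f using F(1)[OF that] U unfolding holo_near_def by blast
    show "(\<lambda>z. \<Phi> z $ j) holo_on W" for j by (rule holo_on_subset[OF \<Phi>h]) (use WV in auto)
  qed (use WV fin F(2) \<Phi>x \<psi>h tangent \<sigma>(1) in \<open>auto simp: \<Phi>_def\<close>)
  then show ?thesis by (rule that)
qed

section \<open>Differentials modulo the ideal\<close>

lemma eventually_nhds_compose:
  assumes "open V" "continuous_on V \<psi>" "y \<in> V" "\<forall>\<^sub>F z in nhds (\<psi> y). P z"
  shows "\<forall>\<^sub>F y in nhds y. P (\<psi> y)"
proof -
  obtain S where S: "open S" "\<psi> y \<in> S" "\<And>z. z \<in> S \<Longrightarrow> P z"
    using assms(4) unfolding eventually_nhds by blast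
  have "open (\<psi> -` S \<inter> V)" using continuous_on_open_vimage[OF assms(1)] assms(2) S(1) by blast
  then show ?thesis
    using S assms(3) by (intro eventually_nhds_in_open[THEN eventually_mono, of "\<psi> -` S \<inter> V"]) auto
qed

lemma partial_eventually_cong:
  assumes "holo_near x g" "\<forall>\<^sub>F z in nhds x. f z = g z"
  shows "\<forall>\<^sub>F z in nhds x. partial i f z = partial i g z"
proof -
  obtain U where U: "x \<in> U" "g holo_on U" using assms unfolding holo_near_def by blast
  obtain S where S: "open S" "x \<in> S" "\<And>z. z \<in> S \<Longrightarrow> f z = g z"
    using assms(2) unfolding eventually_nhds by blast
  have o: "open (S \<inter> U)" using S(1) holo_on_open[OF U(2)] by (rule open_Int)
  have "partial i f z = partial i g z" if z: "z \<in> S \<inter> U" for z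
    by (rule partial_unique, rule has_derivative_transform_within_open[OF holo_on_has_derivative[OF U(2)] o z])
      (use z S(3) in auto)
  then show ?thesis using o S U by (intro eventually_nhds_in_open[THEN eventually_mono, of "S \<inter> U"]) auto
qed

lemma partial_add:
  assumes "f holo_on U" "g holo_on U" "z \<in> U"
  shows "partial i (\<lambda>z. f z + g z) z = partial i f z + partial i g z"
  using has_derivative_add[OF holo_on_has_derivative[OF assms(1,3)] holo_on_has_derivative[OF assms(2,3)]]
  by (intro partial_unique) (simp add: sum.distrib ring_distribs)

lemma partial_mult:
  assumes "f holo_on U" "g holo_on U" "z \<in> U"
  shows "partial i (\<lambda>z. f z * g z) z = f z * partial i g z + partial i f z * g z"
proof (rule partial_unique)
  have "(\<lambda>v. f z * (\<Sum>i\<in>UNIV. v $ i * partial i g z) + (\<Sum>i\<in>UNIV. v $ i * partial i f z) * g z)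
     = (\<lambda>v. \<Sum>i\<in>UNIV. v $ i * (f z * partial i g z + partial i f z * g z))"
    by (simp add: sum_distrib_left sum_distrib_right sum.distrib[symmetric] algebra_simps)
  then show "((\<lambda>z. f z * g z) has_derivative
      (\<lambda>v. \<Sum>i\<in>UNIV. v $ i * (f z * partial i g z + partial i f z * g z))) (at z)"
    using has_derivative_mult[OF holo_on_has_derivative[OF assms(1,3)] holo_on_has_derivative[OF assms(2,3)]]
    by simp
qed

lemma (in module) coset_finsum:
  assumes N: "submodule N R M" and "finite X" "c \<in> X \<rightarrow> carrier R" "u \<in> X \<rightarrow> carrier M"
  shows "N +>\<^bsub>M\<^esub> (\<Oplus>\<^bsub>M\<^esub>b\<in>X. c b \<odot>\<^bsub>M\<^esub> u b) =
    (\<Oplus>\<^bsub>quot_mod M N\<^esub>b\<in>X. c b \<odot>\<^bsub>quot_mod M N\<^esub> (N +>\<^bsub>M\<^esub> u b))"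
  using assms(2-)
proof (induction X rule: finite_induct)
  case empty
  interpret Q: module R "quot_mod M N" by (rule quot_mod_module[OF N])
  have "\<zero>\<^bsub>M\<^esub> \<in> N" using N by (simp add: submodule_def subgroup_def)
  then have "N +>\<^bsub>M\<^esub> \<zero>\<^bsub>M\<^esub> = \<zero>\<^bsub>quot_mod M N\<^esub>"
    using coset_eq_zero_iff[OF N, of "\<zero>\<^bsub>M\<^esub>"] by (simp add: quot_mod_zero)
  then show ?case by simp
next
  case (insert x X)
  interpret Q: module R "quot_mod M N" by (rule quot_mod_module[OF N])
  have cu: "c b \<in> carrier R" "u b \<in> carrier M" if "b \<in> insert x X" for b
    using insert.prems that by auto
  have s: "(\<Oplus>\<^bsub>M\<^esub>b\<in>X. c b \<odot>\<^bsub>M\<^esub> u b) \<in> carrier M" using cu by (intro M.finsum_closed) auto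
  have "(\<Oplus>\<^bsub>M\<^esub>b\<in>insert x X. c b \<odot>\<^bsub>M\<^esub> u b) = c x \<odot>\<^bsub>M\<^esub> u x \<oplus>\<^bsub>M\<^esub> (\<Oplus>\<^bsub>M\<^esub>b\<in>X. c b \<odot>\<^bsub>M\<^esub> u b)"
    using insert.hyps cu by (intro M.finsum_insert) auto
  then have "N +>\<^bsub>M\<^esub> (\<Oplus>\<^bsub>M\<^esub>b\<in>insert x X. c b \<odot>\<^bsub>M\<^esub> u b) =
      (N +>\<^bsub>M\<^esub> (c x \<odot>\<^bsub>M\<^esub> u x)) \<oplus>\<^bsub>quot_mod M N\<^esub> (N +>\<^bsub>M\<^esub> (\<Oplus>\<^bsub>M\<^esub>b\<in>X. c b \<odot>\<^bsub>M\<^esub> u b))"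
    using cu s by (simp add: quot_mod_add[OF N])
  also have "\<dots> = c x \<odot>\<^bsub>quot_mod M N\<^esub> (N +>\<^bsub>M\<^esub> u x) \<oplus>\<^bsub>quot_mod M N\<^esub>
      (\<Oplus>\<^bsub>quot_mod M N\<^esub>b\<in>X. c b \<odot>\<^bsub>quot_mod M N\<^esub> (N +>\<^bsub>M\<^esub> u b))"
    using cu insert by (simp add: quot_mod_smult[OF N])
  also have "\<dots> = (\<Oplus>\<^bsub>quot_mod M N\<^esub>b\<in>insert x X. c b \<odot>\<^bsub>quot_mod M N\<^esub> (N +>\<^bsub>M\<^esub> u b))"
  proof -
    have "N +>\<^bsub>M\<^esub> u b \<in> carrier (quot_mod M N)" if "b \<in> insert x X" for b
      unfolding quot_mod_carrier using cu(2)[OF that] by (rule imageI)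
    then show ?thesis using insert.hyps cu by (intro Q.M.finsum_insert[symmetric]) auto
  qed
  finally show ?case .
qed

lemma (in cring) free_mod_finsum_apply:
  assumes "finite X" "u \<in> X \<rightarrow> carrier (free_mod R A)"
  shows "(\<Oplus>\<^bsub>free_mod R A\<^esub>b\<in>X. u b) i = (\<Oplus>b\<in>X. u b i)"
  using assms
proof (induction X rule: finite_induct)
  case empty
  interpret F: module R "free_mod R A" by (rule free_mod_module)
  show ?case by (simp add: free_mod_simps)
next
  case (insert x X)
  interpret F: module R "free_mod R A" by (rule free_mod_module)
  have u: "u b \<in> carrier (free_mod R A)" if "b \<in> insert x X" for b using insert.prems that by auto
  have "(\<Oplus>\<^bsub>free_mod R A\<^esub>b\<in>insert x X. u b) = u x \<oplus>\<^bsub>free_mod R A\<^esub> (\<Oplus>\<^bsub>free_mod R A\<^esub>b\<in>X. u b)"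
    using insert.hyps u by (intro F.M.finsum_insert) auto
  then have "(\<Oplus>\<^bsub>free_mod R A\<^esub>b\<in>insert x X. u b) i = u x i \<oplus> (\<Oplus>b\<in>X. u b i)"
    using insert by (simp add: free_mod_simps)
  also have "\<dots> = (\<Oplus>b\<in>insert x X. u b i)"
    using insert.hyps free_mod_coeff[OF u] by (intro finsum_insert[symmetric]) auto
  finally show ?case .
qed

context germ_equations
begin

abbreviation ambient :: "((complex^'n \<Rightarrow> complex) set set, 'n \<Rightarrow> (complex^'n \<Rightarrow> complex) set set) module" where
  "ambient \<equiv> free_mod (local_ring F x) UNIV"

text \<open>
  The submodule divided out in the definition of the Kaehler differentials; it is the image of the
  conormal module \<open>I/I\<^sup>2\<close>.
\<close>

abbreviation conormal :: "('n \<Rightarrow> (complex^'n \<Rightarrow> complex) set set) set" where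
  "conormal \<equiv> mod_span (local_ring F x) ambient (differential F x ` F)"

sublocale A: module "local_ring F x" ambient by (rule R.free_mod_module)

lemma differential_closed: "holo_near x f \<Longrightarrow> differential F x f \<in> carrier ambient"
  by (auto simp: free_mod_def differential_def holo_near_partial)

lemma conormal_submodule: "submodule conormal (local_ring F x) ambient"
  by (rule A.mod_span_submodule) (use differential_closed holo in auto)

lemma differential_cong:
  assumes "holo_near x f" "holo_near x g" "\<forall>\<^sub>F z in nhds x. f z = g z"
  shows "differential F x f = differential F x g"
  unfolding differential_def
  by (intro ext restr_cong holo_near_partial assms partial_eventually_cong)

lemma differential_add:
  assumes "holo_near x f" "holo_near x g"
  shows "differential F x (\<lambda>z. f z + g z) = differential F x f \<oplus>\<^bsub>ambient\<^esub> differential F x g"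
proof
  fix i
  obtain U where U: "x \<in> U" "f holo_on U" "g holo_on U" using holo_near_common[OF assms] .
  have "restr F x (partial i (\<lambda>z. f z + g z)) = restr F x (\<lambda>z. partial i f z + partial i g z)"
  proof (rule restr_cong)
    show "\<forall>\<^sub>F z in nhds x. partial i (\<lambda>z. f z + g z) z = partial i f z + partial i g z"
      using partial_add[OF U(2,3)] U
      by (intro eventually_nhds_in_open[THEN eventually_mono, of U]) (auto intro: holo_on_open)
  qed (intro holo_near_partial holo_near_add assms)+
  then show "differential F x (\<lambda>z. f z + g z) i = (differential F x f \<oplus>\<^bsub>ambient\<^esub> differential F x g) i"
    by (simp add: differential_def free_mod_simps restr_add holo_near_partial assms)
qed

text \<open>
  In the product rule the summand with factor \<open>f\<close> disappears, as \<open>f\<close> is zero in the local ring.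
\<close>

lemma differential_mult:
  assumes c: "holo_near x c" and f: "f \<in> function_ideal F x"
  shows "differential F x (\<lambda>z. c z * f z) = restr F x c \<odot>\<^bsub>ambient\<^esub> differential F x f"
proof
  fix i
  have fh: "holo_near x f" using f by (rule function_ideal_holo)
  obtain U where U: "x \<in> U" "c holo_on U" "f holo_on U" using holo_near_common[OF c fh] .
  have "restr F x (partial i (\<lambda>z. c z * f z)) = restr F x (\<lambda>z. c z * partial i f z + partial i c z * f z)"
  proof (rule restr_cong)
    show "\<forall>\<^sub>F z in nhds x. partial i (\<lambda>z. c z * f z) z = c z * partial i f z + partial i c z * f z"
      using partial_mult[OF U(2,3)] U
      by (intro eventually_nhds_in_open[THEN eventually_mono, of U]) (auto intro: holo_on_open)
  qed (intro holo_near_partial holo_near_add holo_near_mult c fh)+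
  also have "\<dots> = restr F x c \<otimes>\<^bsub>local_ring F x\<^esub> restr F x (partial i f) \<oplus>\<^bsub>local_ring F x\<^esub>
      restr F x (partial i c) \<otimes>\<^bsub>local_ring F x\<^esub> restr F x f"
    by (simp add: restr_add restr_mult holo_near_partial holo_near_mult c fh)
  also have "restr F x f = \<zero>\<^bsub>local_ring F x\<^esub>" using f restr_eq_zero_iff[OF fh] by simp
  finally show "differential F x (\<lambda>z. c z * f z) i = (restr F x c \<odot>\<^bsub>ambient\<^esub> differential F x f) i"
    by (simp add: differential_def free_mod_simps holo_near_partial c fh)
qed

text \<open>
  The relations imposed for the equations in \<open>F\<close> extend to the whole ideal.
\<close>

lemma differential_of_ideal:
  assumes f: "f \<in> function_ideal F x" shows "differential F x f \<in> conormal"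
proof -
  obtain c where c: "\<And>a. a \<in> F \<Longrightarrow> holo_near x (c a)" "\<forall>\<^sub>F z in nhds x. f z = (\<Sum>a\<in>F. c a z * a z)"
    using f unfolding function_ideal_def by blast
  have h: "holo_near x (\<lambda>z. \<Sum>a\<in>A. c a z * a z)" if "A \<subseteq> F" for A
    using that c holo by (intro holo_near_sum holo_near_mult) auto
  interpret N: submodule conormal "local_ring F x" ambient by (rule conormal_submodule)
  have "differential F x (\<lambda>z. \<Sum>a\<in>A. c a z * a z) \<in> conormal" if "A \<subseteq> F" for A
    using finite_subset[OF that fin] that
  proof (induction A rule: finite_induct)
    case empty
    have "partial i (\<lambda>_. 0) = (\<lambda>_. 0)" for i :: 'n by (auto simp: partial_def)
    then have "differential F x (\<lambda>_. 0) = \<zero>\<^bsub>ambient\<^esub>"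
      by (simp add: differential_def free_mod_simps restr_zero)
    then show ?case using N.one_closed by simp
  next
    case (insert a A)
    then have a: "a \<in> F" by simp
    have "differential F x (\<lambda>z. c a z * a z + (\<Sum>a\<in>A. c a z * a z)) =
        restr F x (c a) \<odot>\<^bsub>ambient\<^esub> differential F x a \<oplus>\<^bsub>ambient\<^esub> differential F x (\<lambda>z. \<Sum>a\<in>A. c a z * a z)"
      using insert.prems
      by (simp add: differential_add differential_mult generator_in_function_ideal a c holo_near_mult holo h)
    moreover have "differential F x a \<in> conormal" using a mod_span_superset by fast
    then have "restr F x (c a) \<odot>\<^bsub>ambient\<^esub> differential F x a \<in> conormal"
      using c(1)[OF a] by (intro N.smult_closed) auto
    ultimately show ?case using insert N.m_closed by simp
  qed
  from this[OF order_refl] show ?thesis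
    using differential_cong[OF function_ideal_holo[OF f] h[OF order_refl] c(2)] by simp
qed

end

section \<open>The germ in adapted coordinates\<close>

context adapted_coordinates
begin

lemma zero_in_V: "0 \<in> V" and \<psi>_zero: "\<psi> 0 = x"
  and \<psi>_\<Phi>: "z \<in> W \<Longrightarrow> \<psi> (\<Phi> z) = z" and \<Phi>_\<psi>: "y \<in> V \<Longrightarrow> \<Phi> (\<psi> y) = y"
proof -
  show "\<psi> (\<Phi> z) = z" if "z \<in> W" for z using homeomorphism_apply1[OF homeo that] .
  then show "\<psi> 0 = x" using W(2) \<Phi>x by metis
  show "0 \<in> V" using homeomorphism_image1[OF homeo] W(2) \<Phi>x by (metis imageI)
  show "\<Phi> (\<psi> y) = y" if "y \<in> V" using homeomorphism_apply2[OF homeo that] .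
qed

lemma holo_near_pullback: "holo_near x f \<Longrightarrow> holo_near 0 (\<lambda>y. f (\<psi> y))"
  using holo_near_compose[OF \<psi>_holo zero_in_V] \<psi>_zero by simp

lemma holo_near_pushforward: "holo_near 0 g \<Longrightarrow> holo_near x (\<lambda>z. g (\<Phi> z))"
  using holo_near_compose[OF \<Phi>_holo W(2)] \<Phi>x by simp

lemma eventually_pushforward: "\<forall>\<^sub>F y in nhds 0. P y \<Longrightarrow> \<forall>\<^sub>F z in nhds x. P (\<Phi> z)"
  using eventually_nhds_compose[OF W(1) homeomorphism_cont1[OF homeo] W(2), of P] \<Phi>x by simp

lemma eventually_in_W: "\<forall>\<^sub>F z in nhds x. z \<in> W"
  using W by (rule eventually_nhds_in_open)

lemma eventually_in_V: "\<forall>\<^sub>F y in nhds 0. y \<in> V"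
  using V zero_in_V by (rule eventually_nhds_in_open)

lemma \<Phi>_near: "holo_near x (\<lambda>z. \<Phi> z $ j)"
  using \<Phi>_holo W(2) unfolding holo_near_def by blast

text \<open>
  The chain rule. The coefficients are the derivatives with respect to the new coordinates.
\<close>

lemma differential_in_coordinates:
  assumes g: "holo_near 0 g"
  shows "differential F x (\<lambda>z. g (\<Phi> z)) =
    (\<Oplus>\<^bsub>ambient\<^esub>j\<in>UNIV. restr F x (\<lambda>z. partial j g (\<Phi> z)) \<odot>\<^bsub>ambient\<^esub> differential F x (\<lambda>z. \<Phi> z $ j))"
proof
  fix i
  obtain U where U: "0 \<in> U" "g holo_on U" using g unfolding holo_near_def by blast
  have p: "holo_near x (\<lambda>z. partial j g (\<Phi> z))" for j
    by (intro holo_near_pushforward holo_near_partial g)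
  have "restr F x (partial i (\<lambda>z. g (\<Phi> z))) =
      restr F x (\<lambda>z. \<Sum>j\<in>UNIV. partial j g (\<Phi> z) * partial i (\<lambda>z. \<Phi> z $ j) z)"
  proof (rule restr_cong)
    have "\<forall>\<^sub>F y in nhds 0. y \<in> U" using U holo_on_open by (intro eventually_nhds_in_open)
    from eventually_pushforward[OF this] eventually_in_W
    show "\<forall>\<^sub>F z in nhds x. partial i (\<lambda>z. g (\<Phi> z)) z =
        (\<Sum>j\<in>UNIV. partial j g (\<Phi> z) * partial i (\<lambda>z. \<Phi> z $ j) z)"
      by eventually_elim (rule partial_compose[OF U(2) \<Phi>_holo])
  qed (intro holo_near_partial holo_near_pushforward g holo_near_sum holo_near_mult \<Phi>_near)+
  also have "\<dots> = (\<Oplus>\<^bsub>local_ring F x\<^esub>j\<in>UNIV. restr F x (\<lambda>z. partial j g (\<Phi> z)) \<otimes>\<^bsub>local_ring F x\<^esub>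
      restr F x (partial i (\<lambda>z. \<Phi> z $ j)))"
    by (simp add: restr_sum restr_mult holo_near_mult p holo_near_partial \<Phi>_near)
  also have "\<dots> = (\<Oplus>\<^bsub>ambient\<^esub>j\<in>UNIV. restr F x (\<lambda>z. partial j g (\<Phi> z)) \<odot>\<^bsub>ambient\<^esub>
      differential F x (\<lambda>z. \<Phi> z $ j)) i"
  proof -
    have "restr F x (\<lambda>z. partial j g (\<Phi> z)) \<odot>\<^bsub>ambient\<^esub> differential F x (\<lambda>z. \<Phi> z $ j) \<in> carrier ambient" for j
      by (intro A.smult_closed restr_closed p differential_closed \<Phi>_near)
    then show ?thesis
      by (subst R.free_mod_finsum_apply) (auto simp only: free_mod_simps differential_def finite Pi_iff)
  qed
  finally show "differential F x (\<lambda>z. g (\<Phi> z)) i = \<dots>" by (simp add: differential_def)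
qed

lemma differential_coordinate:
  assumes "k \<in> T" shows "differential F x (\<lambda>z. \<Phi> z $ k) = unit_vec (local_ring F x) k"
proof
  fix i
  have "partial i (\<lambda>z. \<Phi> z $ k) = (\<lambda>_. if i = k then 1 else 0)"
    using partial_unique[OF has_derivative_coordinate[of k "- (x $ k)"]] by (simp add: \<Phi>_T[OF assms] fun_eq_iff)
  then show "differential F x (\<lambda>z. \<Phi> z $ k) i = unit_vec (local_ring F x) k i"
    by (simp add: differential_def unit_vec_def restr_zero restr_one)
qed

text \<open>
  The pairing of differentials with the tangent vectors \<open>\<partial>\<psi>/\<partial>y\<^sub>k\<close> at \<open>0\<close> for \<open>k \<in> T\<close>. It kills the
  differentials of the equations by \<open>tangent\<close>, and it shows that the \<open>d\<Phi>\<^sub>k\<close> for \<open>k \<in> T\<close> remain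
  independent modulo the maximal ideal.
\<close>

lemma cotangent_coordinates:
  obtains \<theta> where "semilinear (local_ring F x) (kaehler1 F x) (\<lambda>r v. value_at r *s v) \<theta>"
    and "\<And>k. k \<in> T \<Longrightarrow> \<theta> (conormal +>\<^bsub>ambient\<^esub> unit_vec (local_ring F x) k) = axis k 1"
proof -
  define D where "D k i = partial k (\<lambda>y. \<psi> y $ i) 0" for k i
  define \<theta> where "\<theta> c = (\<chi> k. if k \<in> T then (\<Sum>i\<in>UNIV. value_at (c i) * D k i) else 0)"
    for c :: "'n \<Rightarrow> (complex^'n \<Rightarrow> complex) set set"
  have lin: "semilinear (local_ring F x) ambient (\<lambda>r v. value_at r *s v) \<theta>"
    unfolding semilinear_def
    by (auto simp: \<theta>_def vec_eq_iff free_mod_simps ev_add ev_mult R.free_mod_coeff ring_distribs sum.distrib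
        sum_distrib_left mult.assoc)
  have kill: "\<theta> a = 0" if "a \<in> differential F x ` F" for a
  proof -
    from that obtain f where f: "a = differential F x f" "f \<in> F" by (rule imageE)
    obtain U where U: "x \<in> U" "f holo_on U" using holo[OF f(2)] unfolding holo_near_def by blast
    have "(\<Sum>i\<in>UNIV. value_at (a i) * D k i) = 0" if k: "k \<in> T" for k
    proof -
      have "(\<Sum>i\<in>UNIV. value_at (a i) * D k i) = (\<Sum>i\<in>UNIV. partial i f (\<psi> 0) * partial k (\<lambda>y. \<psi> y $ i) 0)"
        using f holo by (simp add: differential_def value_at_restr holo_near_partial D_def \<psi>_zero)
      also have "\<dots> = partial k (\<lambda>y. f (\<psi> y)) 0"
        using U by (intro partial_compose[symmetric, OF U(2) \<psi>_holo zero_in_V]) (simp add: \<psi>_zero)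
      also have "\<dots> = 0" by (rule tangent[OF f(2) k])
      finally show ?thesis .
    qed
    then show ?thesis by (simp add: \<theta>_def vec_eq_iff)
  qed
  have D: "D l k = (if l = k then 1 else 0)" if k: "k \<in> T" for k l
    unfolding D_def
  proof (rule partial_unique)
    show "((\<lambda>y. \<psi> y $ k) has_derivative (\<lambda>v. \<Sum>i\<in>UNIV. v $ i * (if i = k then 1 else 0))) (at 0)"
    proof (rule has_derivative_transform_within_open[OF has_derivative_coordinate V zero_in_V])
      fix y assume "y \<in> V"
      then have "\<Phi> (\<psi> y) $ k = y $ k" by (simp add: \<Phi>_\<psi>)
      then show "y $ k + x $ k = \<psi> y $ k" by (simp add: \<Phi>_T[OF k] algebra_simps)
    qed
  qed
  have unit: "\<theta> (unit_vec (local_ring F x) k) = axis k 1" if k: "k \<in> T" for k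
  proof -
    have "(\<Sum>i\<in>UNIV. value_at (unit_vec (local_ring F x) k i) * D l i) = D l k" for l
    proof -
      have "(\<Sum>i\<in>UNIV. value_at (unit_vec (local_ring F x) k i) * D l i) = (\<Sum>i\<in>UNIV. if i = k then D l i else 0)"
        by (intro sum.cong) (auto simp: unit_vec_def ev_one ev_zero)
      then show ?thesis by simp
    qed
    then show ?thesis using k D[OF k] by (auto simp: \<theta>_def vec_eq_iff axis_def)
  qed
  have "\<exists>h. semilinear (local_ring F x) (quot_mod ambient conormal) (\<lambda>r v. value_at r *s v) h \<and>
      (\<forall>a\<in>carrier ambient. h (conormal +>\<^bsub>ambient\<^esub> a) = \<theta> a)"
    by (rule A.semilinear_descends_span[OF _ lin _ kill]) (use differential_closed holo in auto)
  then obtain h where h: "semilinear (local_ring F x) (quot_mod ambient conormal) (\<lambda>r v. value_at r *s v) h"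
    "\<And>a. a \<in> carrier ambient \<Longrightarrow> h (conormal +>\<^bsub>ambient\<^esub> a) = \<theta> a" by blast
  have "unit_vec (local_ring F x) k \<in> carrier ambient" for k
    by (rule R.unit_vec_closed) simp
  then show ?thesis
    by (intro that[of h]) (use h unit in \<open>auto simp: kaehler1_def Let_def\<close>)
qed

text \<open>
  In the module of Kaehler differentials the differential of an element of the ideal is zero, and so
  is \<open>d\<Phi>\<^sub>s\<close> for \<open>s \<notin> T\<close>. The chain rule thus becomes a relation among the \<open>d\<Phi>\<^sub>k\<close> with \<open>k \<in> T\<close>, and
  its coefficients vanish in the local ring if an exterior power is free.
\<close>

lemma ideal_closed_under_tangential_derivatives:
  assumes p: "1 \<le> p" "p \<le> card T" and free: "is_free (local_ring F x) (kaehler F x p)"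
    and g: "holo_near 0 g" "(\<lambda>z. g (\<Phi> z)) \<in> function_ideal F x" and k: "k \<in> T"
  shows "(\<lambda>z. partial k g (\<Phi> z)) \<in> function_ideal F x"
proof -
  let ?R = "local_ring F x" and ?M = "kaehler1 F x"
  have Mq: "?M = quot_mod ambient conormal" by (simp add: kaehler1_def Let_def)
  note N = conormal_submodule
  have M: "module ?R ?M" unfolding Mq by (rule A.quot_mod_module[OF N])
  interpret M: module ?R ?M by (rule M)
  obtain \<theta> where \<theta>: "semilinear ?R ?M (\<lambda>r v. value_at r *s v) \<theta>"
    and \<theta>1: "\<And>k. k \<in> T \<Longrightarrow> \<theta> (conormal +>\<^bsub>ambient\<^esub> unit_vec ?R k) = axis k 1"
    by (rule cotangent_coordinates) (blast intro: that)
  define \<gamma> where "\<gamma> j = conormal +>\<^bsub>ambient\<^esub> differential F x (\<lambda>z. \<Phi> z $ j)" for j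
  have \<gamma>c: "\<gamma> j \<in> carrier ?M" for j
    unfolding \<gamma>_def Mq A.quot_mod_carrier using differential_closed[OF \<Phi>_near] by blast
  define a where "a j = restr F x (\<lambda>z. partial j g (\<Phi> z))" for j
  have ph: "holo_near x (\<lambda>z. partial j g (\<Phi> z))" for j
    by (intro holo_near_pushforward holo_near_partial g)
  have ac: "a j \<in> carrier ?R" for j unfolding a_def using ph by simp
  have "\<zero>\<^bsub>?M\<^esub> = conormal +>\<^bsub>ambient\<^esub> differential F x (\<lambda>z. g (\<Phi> z))"
    using A.coset_eq_zero_iff[OF N differential_closed[OF function_ideal_holo[OF g(2)]]] differential_of_ideal[OF g(2)]
    by (simp add: Mq A.quot_mod_zero)
  also have "\<dots> = (\<Oplus>\<^bsub>?M\<^esub>j\<in>UNIV. a j \<odot>\<^bsub>?M\<^esub> \<gamma> j)"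
    unfolding differential_in_coordinates[OF g(1)] Mq \<gamma>_def a_def[symmetric]
    by (rule A.coset_finsum[OF N]) (use ac differential_closed[OF \<Phi>_near] in auto)
  also have "\<dots> = (\<Oplus>\<^bsub>?M\<^esub>j\<in>T. a j \<odot>\<^bsub>?M\<^esub> \<gamma> j)"
  proof (rule M.M.add.finprod_mono_neutral_cong_right)
    fix s assume "s \<in> UNIV - T"
    then have "differential F x (\<lambda>z. \<Phi> z $ s) \<in> conormal"
      using \<Phi>_S mod_span_superset by fast
    then have "\<gamma> s = \<zero>\<^bsub>?M\<^esub>"
      unfolding \<gamma>_def Mq A.quot_mod_zero using A.coset_eq_zero_iff[OF N differential_closed[OF \<Phi>_near]] by simp
    then show "a s \<odot>\<^bsub>?M\<^esub> \<gamma> s = \<zero>\<^bsub>?M\<^esub>" using ac by simp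
  qed (use ac \<gamma>c in auto)
  finally have rel: "(\<Oplus>\<^bsub>?M\<^esub>j\<in>T. a j \<odot>\<^bsub>?M\<^esub> \<gamma> j) = \<zero>\<^bsub>?M\<^esub>" by simp
  have "\<forall>j\<in>T. a j = \<zero>\<^bsub>?R\<^esub>"
    by (rule independent_if_ext_power_free[OF M \<theta> \<gamma>c _ p free[unfolded kaehler_def] ac rel])
      (simp add: \<gamma>_def differential_coordinate \<theta>1)
  then show ?thesis using k restr_eq_zero_iff[OF ph] by (simp add: a_def)
qed

text \<open>
  By Hadamard's lemma the coordinates \<open>\<Phi>\<^sub>j\<close> generate the maximal ideal, and those with
  \<open>j \<notin> T\<close> are zero in the local ring.
\<close>

lemma embdim_le_card_T:
  assumes "has_embdim F x e" shows "e \<le> card T"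
proof (rule embdim_le_if_generated[OF assms, of T "\<lambda>k z. \<Phi> z $ k"])
  show "(\<Phi> x) $ k = 0" for k by (simp add: \<Phi>x)
  fix f assume f: "holo_near x f" "f x = 0"
  obtain \<rho> where \<rho>: "\<rho> > 0" "(\<lambda>y. f (\<psi> y)) holo_on ball 0 \<rho>"
    using holo_near_ball[OF holo_near_pullback[OF f(1)]] .
  obtain h where h: "\<And>s. h s holo_on ball 0 \<rho>"
    and fh: "\<And>y. y \<in> ball 0 \<rho> \<Longrightarrow> f (\<psi> y) = f (\<psi> (slice UNIV y)) + (\<Sum>s\<in>UNIV. y $ s * h s y)"
    using hadamard[OF \<rho>(2), of UNIV] by blast
  have hn: "holo_near x (\<lambda>z. h s (\<Phi> z))" for s
    using h \<rho>(1) unfolding holo_near_def[of 0] by (intro holo_near_pushforward) (simp add: holo_near_def exI[of _ "ball 0 \<rho>"])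
  have "slice UNIV y = 0" for y :: "complex^'n" by (simp add: slice_def vec_eq_iff)
  then have fh': "f (\<psi> y) = (\<Sum>s\<in>UNIV. y $ s * h s y)" if "y \<in> ball 0 \<rho>" for y
    using fh[OF that] f(2) \<psi>_zero by simp
  have "\<forall>\<^sub>F y in nhds 0. y \<in> ball 0 \<rho>" using \<rho>(1) by (intro eventually_nhds_in_open) auto
  from eventually_pushforward[OF this] eventually_in_W
  have ev: "\<forall>\<^sub>F z in nhds x. f z - (\<Sum>k\<in>T. h k (\<Phi> z) * \<Phi> z $ k) = (\<Sum>s\<in>-T. h s (\<Phi> z) * \<Phi> z $ s)"
  proof eventually_elim
    case (elim z)
    have "f z = (\<Sum>s\<in>UNIV. h s (\<Phi> z) * \<Phi> z $ s)"
      using fh'[OF elim(1)] \<psi>_\<Phi>[OF elim(2)] by (simp add: mult.commute)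
    also have "\<dots> = (\<Sum>s\<in>T. h s (\<Phi> z) * \<Phi> z $ s) + (\<Sum>s\<in>-T. h s (\<Phi> z) * \<Phi> z $ s)"
      using sum.union_disjoint[of T "- T" "\<lambda>s. h s (\<Phi> z) * \<Phi> z $ s"] by (simp add: Compl_partition)
    finally show ?case by simp
  qed
  have mem: "(\<lambda>z. \<Sum>s\<in>-T. h s (\<Phi> z) * \<Phi> z $ s) \<in> function_ideal F x"
    by (intro function_ideal_sum function_ideal_mult hn generator_in_function_ideal \<Phi>_S) auto
  have "(\<lambda>z. f z - (\<Sum>k\<in>T. h k (\<Phi> z) * \<Phi> z $ k)) \<in> function_ideal F x"
    by (rule function_ideal_cong[OF mem _ ev]) (intro holo_near_minus f(1) holo_near_sum holo_near_mult hn \<Phi>_near)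
  then show "\<exists>h. (\<forall>k\<in>T. holo_near x (h k)) \<and> (\<lambda>z. f z - (\<Sum>k\<in>T. h k z * \<Phi> z $ k)) \<in> function_ideal F x"
    using hn by (intro exI[of _ "\<lambda>k z. h k (\<Phi> z)"]) auto
qed (rule \<Phi>_near)

text \<open>
  The ideal of the germ is generated by the coordinates outside \<open>T\<close>. These coordinates are
  equations, so their ideal is contained in that of the germ. Conversely, the ideal of the germ is
  closed under the derivatives in the directions of \<open>T\<close>; hence its elements vanish on the coordinate
  subspace, and Hadamard's lemma writes them in terms of the coordinates outside \<open>T\<close>.
\<close>

lemma pullback_in_coordinate_ideal_iff:
  assumes p: "1 \<le> p" "p \<le> card T" and free: "is_free (local_ring F x) (kaehler F x p)"
    and f: "holo_near x f"
  shows "f \<in> function_ideal F x \<longleftrightarrow> (\<lambda>y. f (\<psi> y)) \<in> function_ideal ((\<lambda>i z. z $ i) ` (- T)) 0"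
proof -
  let ?G = "(\<lambda>i z. z $ i) ` (- T) :: (complex^'n \<Rightarrow> complex) set"
  interpret G: germ_equations ?G "0 :: complex^'n"
    by unfold_locales (auto intro: holo_near_coordinate)
  show ?thesis
  proof
    assume fI: "f \<in> function_ideal F x"
    define J where "J = {g. holo_near 0 g \<and> (\<lambda>z. g (\<Phi> z)) \<in> function_ideal F x}"
    define g where "g y = f (\<psi> y)" for y
    have gh: "holo_near 0 g" unfolding g_def[abs_def] by (rule holo_near_pullback[OF f])
    have "\<forall>\<^sub>F z in nhds x. g (\<Phi> z) = f z"
      using eventually_in_W by eventually_elim (simp add: g_def \<psi>_\<Phi>)
    then have gJ: "g \<in> J"
      unfolding J_def using gh function_ideal_cong[OF fI holo_near_pushforward[OF gh]] by simp
    obtain \<rho> where \<rho>: "\<rho> > 0" "g holo_on ball 0 \<rho>" using holo_near_ball[OF gh] .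
    have van: "g w = 0" if w: "w \<in> ball 0 \<rho>" "\<And>i. i \<notin> T \<Longrightarrow> w $ i = 0" for w
    proof (rule vanishing_on_slice[of J T g \<rho> w])
      show "g 0 = 0" if "g \<in> J" for g
        using that function_ideal_zero_at[of "\<lambda>z. g (\<Phi> z)"] by (simp add: J_def \<Phi>x)
      show "partial k g \<in> J" if "g \<in> J" "k \<in> T" for g k
        using that ideal_closed_under_tangential_derivatives[OF p free, of g k]
        by (simp add: J_def holo_near_partial)
      show "(\<lambda>z. \<Sum>k\<in>T. c k * g k z) \<in> J" if "\<And>k. k \<in> T \<Longrightarrow> g k \<in> J" for g c
        using that unfolding J_def
        by (auto intro!: holo_near_sum holo_near_mult holo_near_const function_ideal_sum function_ideal_mult)
    qed (use gJ \<rho> w in auto)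
    obtain h where h: "\<And>s. h s holo_on ball 0 \<rho>"
      and gh': "\<And>w. w \<in> ball 0 \<rho> \<Longrightarrow> g w = g (slice (- T) w) + (\<Sum>s\<in>- T. w $ s * h s w)"
      using hadamard[OF \<rho>(2), of "- T"] by blast
    have hn: "holo_near 0 (h s)" for s
      using h \<rho>(1) unfolding holo_near_def by (intro exI[of _ "ball 0 \<rho>"]) simp
    have mem: "(\<lambda>w. \<Sum>s\<in>- T. h s w * w $ s) \<in> function_ideal ?G 0"
      by (intro G.function_ideal_sum G.function_ideal_mult hn G.generator_in_function_ideal imageI)
    have "g w = (\<Sum>s\<in>- T. h s w * w $ s)" if w: "w \<in> ball 0 \<rho>" for w
    proof -
      have "norm (slice (- T) w) \<le> norm w" by (intro norm_vec_mono) (simp add: slice_def)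
      then have "g (slice (- T) w) = 0" using w by (intro van) (auto simp: slice_def)
      then show ?thesis using gh'[OF w] by (simp add: mult.commute)
    qed
    then have "\<forall>\<^sub>F w in nhds 0. g w = (\<Sum>s\<in>- T. h s w * w $ s)"
      using \<rho>(1) by (intro eventually_nhds_in_open[THEN eventually_mono, of "ball 0 \<rho>"]) auto
    then have "g \<in> function_ideal ?G 0" by (rule G.function_ideal_cong[OF mem gh])
    then show "(\<lambda>y. f (\<psi> y)) \<in> function_ideal ?G 0" by (simp add: g_def[abs_def])
  next
    assume "(\<lambda>y. f (\<psi> y)) \<in> function_ideal ?G 0"
    then obtain c where c: "\<And>a. a \<in> ?G \<Longrightarrow> holo_near 0 (c a)"
      and ev: "\<forall>\<^sub>F y in nhds 0. f (\<psi> y) = (\<Sum>a\<in>?G. c a y * a y)"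
      unfolding function_ideal_def by blast
    have mem: "(\<lambda>z. \<Sum>a\<in>?G. c a (\<Phi> z) * a (\<Phi> z)) \<in> function_ideal F x"
    proof (intro function_ideal_sum function_ideal_mult)
      show "holo_near x (\<lambda>z. c a (\<Phi> z))" if "a \<in> ?G" for a
        by (intro holo_near_pushforward c that)
      show "(\<lambda>z. a (\<Phi> z)) \<in> function_ideal F x" if "a \<in> ?G" for a
        using that \<Phi>_S generator_in_function_ideal by auto
    qed
    from eventually_pushforward[OF ev] eventually_in_W
    have "\<forall>\<^sub>F z in nhds x. f z = (\<Sum>a\<in>?G. c a (\<Phi> z) * a (\<Phi> z))"
      by eventually_elim (simp add: \<psi>_\<Phi>)
    then show "f \<in> function_ideal F x" by (rule function_ideal_cong[OF mem f])
  qed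
qed

end

text \<open>
  Composition with \<open>\<psi>\<close> induces a map of local rings; \<open>iff\<close> makes it well defined and injective.
\<close>

lemma germ_isoI:
  fixes F :: "(complex^'n \<Rightarrow> complex) set" and G :: "(complex^'m \<Rightarrow> complex) set"
  assumes "germ_equations F x" "germ_equations G y"
    and pull: "\<And>f. holo_near x f \<Longrightarrow> holo_near y (\<lambda>w. f (\<psi> w))"
    and iff: "\<And>f. holo_near x f \<Longrightarrow> f \<in> function_ideal F x \<longleftrightarrow> (\<lambda>w. f (\<psi> w)) \<in> function_ideal G y"
    and surj: "\<And>g. holo_near y g \<Longrightarrow> \<exists>f. holo_near x f \<and> (\<forall>\<^sub>F w in nhds y. f (\<psi> w) = g w)"
  shows "germ_iso F x G y"
proof -
  interpret F: germ_equations F x by fact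
  interpret G: germ_equations G y by fact
  have eq_iff: "restr F x f = restr F x g \<longleftrightarrow> restr G y (\<lambda>w. f (\<psi> w)) = restr G y (\<lambda>w. g (\<psi> w))"
    if "holo_near x f" "holo_near x g" for f g
    using that iff[OF holo_near_minus[OF that]] by (simp add: F.restr_eq_iff G.restr_eq_iff pull)
  define \<phi> where "\<phi> a = restr G y (\<lambda>w. (SOME f. holo_near x f \<and> a = restr F x f) (\<psi> w))" for a
  have \<phi>: "\<phi> (restr F x f) = restr G y (\<lambda>w. f (\<psi> w))" if f: "holo_near x f" for f
  proof -
    define g where "g = (SOME g. holo_near x g \<and> restr F x f = restr F x g)"
    have "holo_near x g \<and> restr F x f = restr F x g" unfolding g_def by (rule someI[of _ f]) (simp add: f)
    then have "restr G y (\<lambda>w. f (\<psi> w)) = restr G y (\<lambda>w. g (\<psi> w))" using eq_iff[OF f] by blast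
    then show ?thesis by (simp add: \<phi>_def g_def)
  qed
  have "\<phi> \<in> ring_hom (local_ring F x) (local_ring G y)"
  proof (rule ring_hom_memI)
    fix a b assume "a \<in> carrier (local_ring F x)" "b \<in> carrier (local_ring F x)"
    then obtain f g where fg: "a = restr F x f" "b = restr F x g" "holo_near x f" "holo_near x g"
      unfolding F.local_ring_carrier by auto
    show "\<phi> (a \<otimes>\<^bsub>local_ring F x\<^esub> b) = \<phi> a \<otimes>\<^bsub>local_ring G y\<^esub> \<phi> b"
      using fg by (simp add: F.restr_mult[symmetric] \<phi> holo_near_mult G.restr_mult pull)
    show "\<phi> (a \<oplus>\<^bsub>local_ring F x\<^esub> b) = \<phi> a \<oplus>\<^bsub>local_ring G y\<^esub> \<phi> b"
      using fg by (simp add: F.restr_add[symmetric] \<phi> holo_near_add G.restr_add pull)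
  next
    fix a assume "a \<in> carrier (local_ring F x)"
    then show "\<phi> a \<in> carrier (local_ring G y)"
      unfolding F.local_ring_carrier by (auto simp: \<phi> pull)
  next
    show "\<phi> \<one>\<^bsub>local_ring F x\<^esub> = \<one>\<^bsub>local_ring G y\<^esub>"
      using \<phi>[OF holo_near_const, of 1] by (simp add: F.restr_one G.restr_one)
  qed
  moreover have "inj_on \<phi> (carrier (local_ring F x))"
    unfolding F.local_ring_carrier
  proof (rule inj_onI; elim imageE CollectE)
    show "a = b" if "\<phi> a = \<phi> b" "a = restr F x f" "b = restr F x g" "holo_near x f" "holo_near x g" for a b f g
      using that eq_iff[of f g] by (simp add: \<phi>)
  qed
  moreover have "b \<in> \<phi> ` carrier (local_ring F x)" if "b \<in> carrier (local_ring G y)" for b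
  proof -
    from that obtain g where g: "b = restr G y g" "holo_near y g"
      unfolding G.local_ring_carrier by auto
    from surj[OF g(2)] obtain f where f: "holo_near x f" "\<forall>\<^sub>F w in nhds y. f (\<psi> w) = g w" by blast
    have "b = \<phi> (restr F x f)" unfolding g(1) \<phi>[OF f(1)] using G.restr_cong[OF pull[OF f(1)] g(2) f(2)] by simp
    then show ?thesis using F.restr_closed[OF f(1)] by (rule image_eqI)
  qed
  ultimately have "\<phi> \<in> ring_iso (local_ring F x) (local_ring G y)"
    unfolding ring_iso_def bij_betw_def using ring_hom_closed[of \<phi>] by blast
  moreover have "\<phi> (restr F x (\<lambda>_. c)) = restr G y (\<lambda>_. c)" for c
    by (simp add: \<phi> holo_near_const)
  ultimately show ?thesis unfolding germ_iso_def by blast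
qed

theorem theorem1p10:
  fixes U :: "(complex^'n) set"
    and F :: "(complex^'n \<Rightarrow> complex) set"
    and x :: "complex^'n"
    and e p :: nat
  assumes "local_model U F x"
    and "has_embdim F x e"
    and "1 \<le> p" and "p \<le> e"
    and "is_free (local_ring F x) (kaehler F x p)"
  shows "smooth_germ F x"
proof -
  obtain T \<Phi> \<psi> W V where coords: "adapted_coordinates F x T \<Phi> \<psi> W V"
    using adapted_coordinates_exist[OF assms(1)] .
  interpret adapted_coordinates F x T \<Phi> \<psi> W V by (rule coords)
  have p: "p \<le> card T" using assms(4) embdim_le_card_T[OF assms(2)] by simp
  have "germ_iso F x ((\<lambda>i z. z $ i) ` (- T)) (0 :: complex^'n)"
  proof (rule germ_isoI[of F x _ 0 \<psi>])
    show "germ_equations F x" by (rule germ_equations_axioms)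
    show "germ_equations ((\<lambda>i z. z $ i) ` (- T)) (0 :: complex^'n)"
      by unfold_locales (auto intro: holo_near_coordinate)
    show "f \<in> function_ideal F x \<longleftrightarrow> (\<lambda>w. f (\<psi> w)) \<in> function_ideal ((\<lambda>i z. z $ i) ` (- T)) 0"
      if "holo_near x f" for f
      by (rule pullback_in_coordinate_ideal_iff[OF assms(3) p assms(5) that])
    show "\<exists>f. holo_near x f \<and> (\<forall>\<^sub>F w in nhds 0. f (\<psi> w) = g w)" if "holo_near 0 g" for g
    proof (intro exI conjI)
      show "holo_near x (\<lambda>z. g (\<Phi> z))" by (rule holo_near_pushforward[OF that])
      show "\<forall>\<^sub>F w in nhds 0. g (\<Phi> (\<psi> w)) = g w"
        using eventually_in_V by eventually_elim (simp add: \<Phi>_\<psi>)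
    qed
  qed (rule holo_near_pullback)
  then show ?thesis unfolding smooth_germ_def by blast
qed

end
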